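(* Assume (A1) and (A2), let $\ell_n=n^s$ with $s\in(0.5,0.75)$, and suppose there exists a sequence of positive integers $m_n\to\infty$ with $m_n=o(n^{2s-1})$ and $b_n\beta_Y(m_n)\to0$. Then under the null hypothesis $\sigma\equiv\sigma_H$, $$\frac{\sqrt{\ell_n}}{\kappa}U(n)\xrightarrow{P}\frac{2}{\sqrt\pi}\qquad(n\to\infty).$$
   Context: Let $(Y_i)_{i\in\mathbb N}$ be a strictly stationary real-valued process with $E[Y_1]=0$, $\mathrm{Var}(Y_1)=1$, which is absolutely regular, i.e. $\beta_Y(k):=\sup_{m\in\mathbb N}\beta\big(\sigma(Y_i,1\le i\le m),\sigma(Y_i,i\ge k+m)\big)\to0$ as $k\to\infty$, where $\beta(\mathcal A,\mathcal B)=E\big[\operatorname{ess\,sup}_{A\in\mathcal A}|P(A\mid\mathcal B)-P(A)|\big]$. Let $\mu:[0,1]\to\mathbb R$ be Lipschitz-continuous and $\sigma:[0,1]\to[\sigma_0,\infty)$ be càdlàg for some constant $\sigma_0>0$. The observations form the triangular array $X_i=X_{i,n}=\sigma(i/n)Y_i+\mu(i/n)$, $1\le i\le n$. The null hypothesis means $\sigma\equiv\sigma_H$ for a constant $\sigma_H>0$. The long-run variance $\kappa^2:=\mathrm{Var}(Y_1^2)+2\sum_{k\ge1}\mathrm{Cov}(Y_1^2,Y_{k+1}^2)$ is assumed finite and strictly positive; $\kappa>0$ denotes its positive square root. For $s\in(0,1)$ the block length is $\ell_n=n^s$ and the number of blocks is $b_n=n/\ell_n$ (both assumed to be integers). The $j$-th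 block is $\{(j-1)\ell_n+1,\dots,j\ell_n\}$, and $\hat\sigma_j^2=\frac1{\ell_n}\sum_{i=(j-1)\ell_n+1}^{j\ell_n}\big(X_i-\frac1{\ell_n}\sum_{r=(j-1)\ell_n+1}^{j\ell_n}X_r\big)^2$. The test statistic is $U(n)=\frac{1}{b_n(b_n-1)}\sum_{1\le j\ne k\le b_n}|\log\hat\sigma_j^2-\log\hat\sigma_k^2|$. Assumptions: (A1) there is $\vartheta>0$ with $E|Y_1|^{4+2\vartheta}<\infty$; (A2) for the same $\vartheta$, $\sum_{k=1}^\infty\beta_Y(k)^{\vartheta/(2+\vartheta)}<\infty$. *)

theory Defs
  imports "HOL-Probability.Probability" "HOL-Library.Landau_Symbols"
begin

definition gen_sigma :: "'a measure \<Rightarrow> (nat \<Rightarrow> 'a \<Rightarrow> real) \<Rightarrow> nat set \<Rightarrow> 'a measure" where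
  "gen_sigma M Y I = sigma (space M) (\<Union>i\<in>I. {Y i -` B \<inter> space M | B. B \<in> sets borel})"

text \<open>beta(A,B) = E[ess sup over S in A of |P(S|B) - P(S)|]; the expectation of the essential
  supremum of a family equals the infimum of E[Z] over measurable Z dominating every member a.e.\<close>
definition beta_coeff :: "'a measure \<Rightarrow> 'a measure \<Rightarrow> 'a measure \<Rightarrow> ennreal" where
  "beta_coeff M A B =
     (INF Z \<in> {Z \<in> borel_measurable M.
                 \<forall>S\<in>sets A. AE \<omega> in M. \<bar>real_cond_exp M B (indicator S) \<omega> - measure M S\<bar> \<le> Z \<omega>}.
        \<integral>\<^sup>+ \<omega>. ennreal (Z \<omega>) \<partial>M)"

definition betaY :: "'a measure \<Rightarrow> (nat \<Rightarrow> 'a \<Rightarrow> real) \<Rightarrow> nat \<Rightarrow> real" where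
  "betaY M Y k = enn2real (SUP m\<in>{1..}. beta_coeff M (gen_sigma M Y {1..m}) (gen_sigma M Y {k+m..}))"

definition strictly_stationary :: "'a measure \<Rightarrow> (nat \<Rightarrow> 'a \<Rightarrow> real) \<Rightarrow> bool" where
  "strictly_stationary M Y \<longleftrightarrow>
     (\<forall>h n. distr M (PiM {..<n} (\<lambda>_. borel)) (\<lambda>\<omega>. \<lambda>i\<in>{..<n}. Y (Suc i + h) \<omega>)
          = distr M (PiM {..<n} (\<lambda>_. borel)) (\<lambda>\<omega>. \<lambda>i\<in>{..<n}. Y (Suc i) \<omega>))"

definition cov_sq :: "'a measure \<Rightarrow> (nat \<Rightarrow> 'a \<Rightarrow> real) \<Rightarrow> nat \<Rightarrow> real" where
  "cov_sq M Y j =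
     integral\<^sup>L M (\<lambda>\<omega>. ((Y 1 \<omega>)\<^sup>2 - integral\<^sup>L M (\<lambda>x. (Y 1 x)\<^sup>2)) * ((Y j \<omega>)\<^sup>2 - integral\<^sup>L M (\<lambda>x. (Y j x)\<^sup>2)))"

definition kappa_sq :: "'a measure \<Rightarrow> (nat \<Rightarrow> 'a \<Rightarrow> real) \<Rightarrow> real" where
  "kappa_sq M Y = cov_sq M Y 1 + 2 * (\<Sum>k. cov_sq M Y (k + 2))"

definition blen :: "real \<Rightarrow> nat \<Rightarrow> nat" where
  "blen s n = nat \<lfloor>real n powr s\<rfloor>"

definition bnum :: "real \<Rightarrow> nat \<Rightarrow> nat" where
  "bnum s n = n div blen s n"

definition block_var :: "(nat \<Rightarrow> real) \<Rightarrow> nat \<Rightarrow> nat \<Rightarrow> real" where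
  "block_var X l j =
     (let I = {(j - 1) * l + 1 .. j * l}; mean = (\<Sum>r\<in>I. X r) / real l
      in (\<Sum>i\<in>I. (X i - mean)\<^sup>2) / real l)"

definition Ustat :: "(nat \<Rightarrow> real) \<Rightarrow> nat \<Rightarrow> nat \<Rightarrow> real" where
  "Ustat X l b = (1 / (real b * (real b - 1))) *
     (\<Sum>j\<in>{1..b}. \<Sum>k\<in>{1..b} - {j}. \<bar>ln (block_var X l j) - ln (block_var X l k)\<bar>)"

end

theory Submission
  imports Defs "HOL-Real_Asymp.Real_Asymp"
begin

text \<open>With the notation of the statement, let \<open>W\<^sub>j\<close> be the normalised sum of \<open>Y\<^sub>i\<^sup>2 - 1\<close> over block j.
  By the identity \<open>c * |x| = \<integral> (1 - cos (t * x)) / t\<^sup>2 dt\<close> over \<open>t > 0\<close>, the mean of \<open>|W\<^sub>j - W\<^sub>k|\<close> over all pairs of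
  blocks is an integral of \<open>1 - |F(t)|\<^sup>2\<close>, where F is the empirical characteristic function of the
  \<open>W\<^sub>j\<close>. A central limit theorem for one block, together with the asymptotic independence of
  non-adjacent blocks, gives \<open>F(t) \<longlongrightarrow> exp (- t\<^sup>2 / 2)\<close> in mean for every fixed t, and dominated
  convergence yields the limit. Replacing \<open>W\<^sub>j\<close> by the logarithm of the block variance costs a
  negligible error, since by Chebyshev's inequality and a union bound over the blocks all block
  variances are close to the true variance with probability tending to 1; this is where \<open>s > 1/2\<close>
  enters. The drift mu contributes only through a centred term, whose variance is small by the
  covariance inequality, and a quadratic deterministic term.\<close>

section \<open>Covariance inequalities from absolute regularity\<close>

text \<open>The obstacle is that the absolute difference of two block sums is neither bounded nor a
  product of functions of single blocks, while mixing controls covariances of functions of two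
  separated index ranges. Under the Fourier integral each block enters through a bounded
  exponential, so the fluctuation of F(t) is a variance over pairs of blocks. The weight
  \<open>1 / t^2\<close> is singular at 0; second moments of the block sums, bounded uniformly over
  blocks and n, supply the factor \<open>t^2\<close> that compensates it. The assumed moments bound
  a block sum in mean square only, so the central limit theorem splits the summand function into a
  part truncated at a fixed level N and a tail. The truncated part is expanded to third order, the
  tail is estimated by its variance, and N tends to infinity after n. This needs variance bounds
  that are uniform over a class of functions, namely those dominated by \<open>1 + y^2\<close>: the
  class contains the identity (for the drift and the block mean), the square, and both parts of a
  truncation.\<close>

lemma space_gen_sigma [simp]: "space (gen_sigma M Y I) = space M"
  unfolding gen_sigma_def by (rule space_measure_of) auto

lemma sets_gen_sigma:
  "sets (gen_sigma M Y I) = sigma_sets (space M) (\<Union>i\<in>I. {Y i -` B \<inter> space M | B. B \<in> sets borel})"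
  unfolding gen_sigma_def by (rule sets_measure_of) auto

lemma measurable_gen_sigma:
  assumes "i \<in> I"
  shows "Y i \<in> borel_measurable (gen_sigma M Y I)"
proof (rule measurableI)
  fix A :: "real set" assume "A \<in> sets borel"
  with assms show "Y i -` A \<inter> space (gen_sigma M Y I) \<in> sets (gen_sigma M Y I)"
    unfolding sets_gen_sigma space_gen_sigma by (intro sigma_sets.Basic) blast
qed simp

lemma subalgebra_gen_sigma:
  assumes "\<And>i. i \<in> I \<Longrightarrow> Y i \<in> borel_measurable M"
  shows "subalgebra M (gen_sigma M Y I)"
  unfolding subalgebra_def sets_gen_sigma
  using assms by (auto intro!: sets.sigma_sets_subset simp: measurable_sets)

lemma sets_gen_sigma_mono: "I \<subseteq> J \<Longrightarrow> sets (gen_sigma M Y I) \<subseteq> sets (gen_sigma M Y J)"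
  unfolding sets_gen_sigma by (intro sigma_sets_mono') blast

lemma (in prob_space) bounded_factors_integrable:
  fixes f g :: "'a \<Rightarrow> 'b::{real_normed_field, banach, second_countable_topology}"
  assumes [measurable]: "f \<in> borel_measurable M" "g \<in> borel_measurable M"
    and "\<And>x. x \<in> space M \<Longrightarrow> norm (f x) \<le> 1" "\<And>x. x \<in> space M \<Longrightarrow> norm (g x) \<le> 1"
  shows "integrable M f" "integrable M g" "integrable M (\<lambda>x. f x * g x)"
  using assms by (auto intro!: integrable_const_bound[of _ 1] simp: norm_mult mult_le_one)

context prob_space
begin

text \<open>Conditioning on \<open>B\<close> turns the covariance into the expectation of
  \<open>g\<close> times the deviation of the conditional probability of \<open>S\<close> from its
  mean. Since \<open>|g| <= 1\<close>, every \<open>Z\<close> admissible in the infimum dominates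
  it.\<close>

lemma cov_indicator_le_beta_coeff:
  fixes g :: "'a \<Rightarrow> real"
  assumes B: "subalgebra M B" and A: "subalgebra M A"
    and S: "S \<in> sets A" and g: "g \<in> borel_measurable B" and gb: "\<And>x. x \<in> space M \<Longrightarrow> \<bar>g x\<bar> \<le> 1"
  shows "ennreal \<bar>(\<integral>x. indicator S x * g x \<partial>M) - prob S * (\<integral>x. g x \<partial>M)\<bar> \<le> beta_coeff M A B"
  unfolding beta_coeff_def
proof (rule INF_greatest, clarify)
  fix Z :: "'a \<Rightarrow> real"
  assume Z [measurable]: "Z \<in> borel_measurable M"
    and Zd: "\<forall>S\<in>sets A. AE x in M. \<bar>real_cond_exp M B (indicator S) x - prob S\<bar> \<le> Z x"
  interpret B: finite_measure_subalgebra M B by standard (rule B)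
  have SM [measurable]: "S \<in> sets M" using S A unfolding subalgebra_def by auto
  have gM [measurable]: "g \<in> borel_measurable M" using measurable_from_subalg[OF B g] .
  have gi: "integrable M g" by (rule integrable_const_bound[of _ 1]) (use gb in auto)
  have igi: "integrable M (\<lambda>x. g x * indicator S x :: real)"
    by (rule integrable_const_bound[of _ 1]) (use gb in \<open>auto simp: indicator_def\<close>)
  have ci: "integrable M (\<lambda>x. g x * real_cond_exp M B (indicator S) x)"
    and ce: "(\<integral>x. g x * real_cond_exp M B (indicator S) x \<partial>M) = (\<integral>x. g x * indicator S x \<partial>M)"
    using B.real_cond_exp_intg[OF igi g] by auto
  have eq: "(\<integral>x. indicator S x * g x \<partial>M) - prob S * (\<integral>x. g x \<partial>M)
     = (\<integral>x. g x * (real_cond_exp M B (indicator S) x - prob S) \<partial>M)"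
    using ci ce gi by (simp add: right_diff_distrib mult.commute)
  have "ennreal \<bar>(\<integral>x. g x * (real_cond_exp M B (indicator S) x - prob S) \<partial>M)\<bar>
     \<le> (\<integral>\<^sup>+x. norm (g x * (real_cond_exp M B (indicator S) x - prob S)) \<partial>M)"
    using integral_norm_bound_ennreal[of M "\<lambda>x. g x * (real_cond_exp M B (indicator S) x - prob S)"] ci gi
    by (simp add: right_diff_distrib)
  also have "\<dots> \<le> (\<integral>\<^sup>+x. ennreal (Z x) \<partial>M)"
  proof (rule nn_integral_mono_AE)
    show "AE x in M. ennreal (norm (g x * (real_cond_exp M B (indicator S) x - prob S))) \<le> ennreal (Z x)"
      using Zd[rule_format, OF S] AE_space
    proof eventually_elim
      case (elim x)
      have "\<bar>g x\<bar> * \<bar>real_cond_exp M B (indicator S) x - prob S\<bar> \<le> 1 * Z x"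
        by (rule mult_mono) (use elim gb[of x] in auto)
      then show ?case by (auto intro!: ennreal_leI simp: abs_mult)
    qed
  qed
  finally show "ennreal \<bar>(\<integral>x. indicator S x * g x \<partial>M) - prob S * (\<integral>x. g x \<partial>M)\<bar> \<le> (\<integral>\<^sup>+x. ennreal (Z x) \<partial>M)"
    unfolding eq .
qed

text \<open>The constant 1 is an admissible majorant. The bound keeps the supremum inside
  \<open>betaY\<close> finite, where \<open>enn2real\<close> would turn infinity into 0.\<close>

lemma beta_coeff_le_1:
  assumes B: "subalgebra M B" and A: "subalgebra M A"
  shows "beta_coeff M A B \<le> 1"
proof -
  interpret B: finite_measure_subalgebra M B by standard (rule B)
  have "AE x in M. \<bar>real_cond_exp M B (indicator S) x - prob S\<bar> \<le> 1" if "S \<in> sets A" for S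
  proof -
    have [measurable]: "S \<in> sets M" using that A unfolding subalgebra_def by auto
    have i: "integrable M (indicator S :: 'a \<Rightarrow> real)"
      by (rule integrable_const_bound[of _ 1]) (auto simp: indicator_def)
    have "AE x in M. real_cond_exp M B (indicator S) x \<ge> 0"
      by (rule B.real_cond_exp_ge_c[OF i]) auto
    moreover have "AE x in M. real_cond_exp M B (indicator S) x \<le> 1"
      by (rule B.real_cond_exp_le_c[OF i]) (auto simp: indicator_def)
    ultimately show ?thesis
    proof eventually_elim
      case (elim x)
      then show ?case using measure_nonneg[of M S] prob_le_1[of S] by linarith
    qed
  qed
  then have "beta_coeff M A B \<le> (\<integral>\<^sup>+x. ennreal 1 \<partial>M)"
    unfolding beta_coeff_def by (intro INF_lower) auto
  then show ?thesis by (simp add: emeasure_space_1)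
qed

text \<open>Averages of indicators of superlevel sets of \<open>f\<close> approximate
  \<open>f\<close> uniformly, and a bound common to all indicators survives averaging without loss
  of a constant. Dominated convergence then passes to \<open>f\<close>.\<close>

lemma cov_le_of_cov_indicator_le:
  fixes f g :: "'a \<Rightarrow> real"
  assumes A: "subalgebra M A" and f: "f \<in> borel_measurable A" and fb: "\<And>x. x \<in> space M \<Longrightarrow> 0 \<le> f x \<and> f x \<le> 1"
    and g: "g \<in> borel_measurable M" and gb: "\<And>x. x \<in> space M \<Longrightarrow> \<bar>g x\<bar> \<le> 1"
    and ind: "\<And>S. S \<in> sets A \<Longrightarrow> \<bar>(\<integral>x. indicator S x * g x \<partial>M) - prob S * (\<integral>x. g x \<partial>M)\<bar> \<le> b"
  shows "\<bar>(\<integral>x. f x * g x \<partial>M) - (\<integral>x. f x \<partial>M) * (\<integral>x. g x \<partial>M)\<bar> \<le> b"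
proof -
  note g [measurable]
  have fM [measurable]: "f \<in> borel_measurable M" using measurable_from_subalg[OF A f] .
  have fi: "integrable M f" and gi: "integrable M g" and fgi: "integrable M (\<lambda>x. f x * g x)"
    using bounded_factors_integrable[OF fM g] fb gb by auto
  \<comment> \<open>Counting the levels \<open>i / n\<close> reached by \<open>f\<close> gives the
    step function floor(n f) / n; since f takes values in [0, 1], the levels i = 1..n
    suffice.\<close>
  define L where "L i n = {x \<in> space A. real i \<le> real n * f x}" for i n :: nat
  have LA: "L i n \<in> sets A" for i n unfolding L_def using f by measurable
  have LM [measurable]: "L i n \<in> sets M" for i n using LA A unfolding subalgebra_def by blast
  have spA: "space A = space M" using A unfolding subalgebra_def by auto
  define h where "h n x = (\<Sum>i\<in>{1..n}. indicator (L i n) x :: real) / real n" for n :: nat and x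
  have hf: "\<bar>f x - h n x\<bar> \<le> 1 / real n" if "n > 0" "x \<in> space M" for n x
  proof -
    have fl: "0 \<le> real n * f x" "real n * f x \<le> real n" using fb[OF that(2)] that by (auto intro: mult_left_le)
    define k where "k = nat \<lfloor>real n * f x\<rfloor>"
    have kn: "k \<le> n" using fl unfolding k_def by linarith
    have "(\<Sum>i\<in>{1..n}. indicator (L i n) x :: real) = (\<Sum>i\<in>{1..n}. if i \<le> k then 1 else 0)"
    proof (rule sum.cong[OF refl])
      fix i assume "i \<in> {1..n}"
      have "real i \<le> real n * f x \<longleftrightarrow> i \<le> k" unfolding k_def using fl by linarith
      then show "indicator (L i n) x = (if i \<le> k then 1 else (0::real))"
        using that spA by (auto simp: L_def indicator_def)
    qed
    also have "\<dots> = real (card ({1..n} \<inter> {i. i \<le> k}))" by (simp add: sum.If_cases)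
    also have "{1..n} \<inter> {i. i \<le> k} = {1..k}" using kn by auto
    finally have "h n x = real k / real n" unfolding h_def by simp
    moreover have "real k \<le> real n * f x" "real n * f x < real k + 1" unfolding k_def using fl by linarith+
    ultimately show ?thesis using that by (auto simp: abs_le_iff field_simps)
  qed
  have hcov: "\<bar>(\<integral>x. h n x * g x \<partial>M) - (\<integral>x. h n x \<partial>M) * (\<integral>x. g x \<partial>M)\<bar> \<le> b" if "n > 0" for n
  proof -
    have igi: "integrable M (\<lambda>x. indicator (L i n) x * g x)" for i
      by (rule integrable_const_bound[of _ 1]) (use gb in \<open>auto simp: indicator_def\<close>)
    have e1: "(\<integral>x. h n x * g x \<partial>M) = (\<Sum>i\<in>{1..n}. \<integral>x. indicator (L i n) x * g x \<partial>M) / real n"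
    proof -
      have "(\<integral>x. h n x * g x \<partial>M) = (\<integral>x. (\<Sum>i\<in>{1..n}. indicator (L i n) x * g x) / real n \<partial>M)"
        unfolding h_def by (intro Bochner_Integration.integral_cong refl) (simp add: sum_distrib_right)
      also have "\<dots> = (\<integral>x. (\<Sum>i\<in>{1..n}. indicator (L i n) x * g x) \<partial>M) / real n"
        by (rule integral_divide_zero)
      also have "(\<integral>x. (\<Sum>i\<in>{1..n}. indicator (L i n) x * g x) \<partial>M) = (\<Sum>i\<in>{1..n}. \<integral>x. indicator (L i n) x * g x \<partial>M)"
        by (rule Bochner_Integration.integral_sum) (rule igi)
      finally show ?thesis .
    qed
    have e2: "(\<integral>x. h n x \<partial>M) = (\<Sum>i\<in>{1..n}. prob (L i n)) / real n"
    proof -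
      have ii: "integrable M (indicator (L i n) :: 'a \<Rightarrow> real)" for i
        by (rule integrable_const_bound[of _ 1]) (auto simp: indicator_def)
      have "(\<integral>x. h n x \<partial>M) = (\<integral>x. (\<Sum>i\<in>{1..n}. indicator (L i n) x) \<partial>M) / real n"
        unfolding h_def by (rule integral_divide_zero)
      also have "(\<integral>x. (\<Sum>i\<in>{1..n}. indicator (L i n) x) \<partial>M) = (\<Sum>i\<in>{1..n}. (\<integral>x. indicator (L i n) x \<partial>M) :: real)"
        by (rule Bochner_Integration.integral_sum) (rule ii)
      finally show ?thesis by simp
    qed
    have "\<bar>(\<integral>x. h n x * g x \<partial>M) - (\<integral>x. h n x \<partial>M) * (\<integral>x. g x \<partial>M)\<bar>
      = \<bar>(\<Sum>i\<in>{1..n}. (\<integral>x. indicator (L i n) x * g x \<partial>M) - prob (L i n) * (\<integral>x. g x \<partial>M))\<bar> / real n"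
      unfolding e1 e2 by (simp add: sum_subtractf sum_distrib_right diff_divide_distrib[symmetric])
    also have "\<dots> \<le> (\<Sum>i\<in>{1..n}. b) / real n"
      by (intro divide_right_mono order_trans[OF sum_abs] sum_mono ind LA) auto
    finally show ?thesis using that by simp
  qed
  have hm [measurable]: "h n \<in> borel_measurable M" for n unfolding h_def by measurable
  have h01: "0 \<le> h n x \<and> h n x \<le> 1" for n x
  proof -
    have "(\<Sum>i\<in>{1..n}. indicator (L i n) x :: real) \<le> (\<Sum>i\<in>{1..n}. 1)" by (intro sum_mono) (auto simp: indicator_def)
    then show ?thesis unfolding h_def by (auto intro!: divide_nonneg_nonneg sum_nonneg simp: divide_le_eq)
  qed
  have hlim: "(\<lambda>n. h n x) \<longlonglongrightarrow> f x" if "x \<in> space M" for x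
  proof (rule Lim_null[THEN iffD2], rule Lim_null_comparison)
    show "eventually (\<lambda>n. norm (h n x - f x) \<le> 1 / real n) sequentially"
      using eventually_gt_at_top[of 0] by eventually_elim (use hf that in \<open>simp add: abs_minus_commute\<close>)
    show "(\<lambda>n. 1 / real n) \<longlonglongrightarrow> 0" by real_asymp
  qed
  have l1: "(\<lambda>n. \<integral>x. h n x \<partial>M) \<longlonglongrightarrow> (\<integral>x. f x \<partial>M)"
    by (rule integral_dominated_convergence[where w="\<lambda>_. 1"]) (use hlim h01 in auto)
  have l2: "(\<lambda>n. \<integral>x. h n x * g x \<partial>M) \<longlonglongrightarrow> (\<integral>x. f x * g x \<partial>M)"
    by (rule integral_dominated_convergence[where w="\<lambda>_. 1"])
       (use hlim h01 gb in \<open>auto intro!: tendsto_intros simp: abs_mult mult_le_one\<close>)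
  have "(\<lambda>n. \<bar>(\<integral>x. h n x * g x \<partial>M) - (\<integral>x. h n x \<partial>M) * (\<integral>x. g x \<partial>M)\<bar>)
      \<longlonglongrightarrow> \<bar>(\<integral>x. f x * g x \<partial>M) - (\<integral>x. f x \<partial>M) * (\<integral>x. g x \<partial>M)\<bar>"
    by (intro tendsto_intros l1 l2)
  then show ?thesis
    by (rule tendsto_upperbound) (auto intro!: eventually_mono[OF eventually_gt_at_top[of 0]] hcov)
qed

end

section \<open>Fourier representation of the mean absolute difference\<close>

lemma one_minus_cos_bounds:
  fixes x :: real
  shows "0 \<le> 1 - cos x" "1 - cos x \<le> 2" "1 - cos x \<le> x\<^sup>2 / 2"
proof -
  have "1 - cos x = 2 * (sin (x / 2))\<^sup>2" using cos_double_sin[of "x / 2"] by simp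
  also have "(sin (x / 2))\<^sup>2 \<le> (x / 2)\<^sup>2"
    using abs_sin_x_le_abs_x[of "x / 2"] by (simp only: abs_le_square_iff)
  finally show "1 - cos x \<le> x\<^sup>2 / 2" by (simp add: power2_eq_square)
qed (use cos_ge_minus_one[of x] in auto)

lemma integrable_half_line_inverse:
  "integrable lborel (\<lambda>t::real. indicator {0<..} t * (1 / (1 + t\<^sup>2)))"
  using integrable_I0i_1_div_plus_square
  unfolding interval_lebesgue_integrable_def zero_ereal_def
  by (simp add: set_integrable_def)

text \<open>The weight on the positive half line is written as a function on the whole line, so that
  all integrals are over \<open>lborel\<close>; it is linear in \<open>v\<close>, which lets it pass
  through sums and expectations.\<close>

definition half_kernel :: "real \<Rightarrow> real \<Rightarrow> real" where
  "half_kernel t v = indicator {0<..} t * (v / t\<^sup>2)"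

lemma half_kernel_measurable [measurable]:
  assumes [measurable]: "f \<in> borel_measurable N" "g \<in> borel_measurable N"
  shows "(\<lambda>x. half_kernel (f x) (g x)) \<in> borel_measurable N"
  unfolding half_kernel_def by measurable

lemma half_kernel_nonneg: "0 \<le> v \<Longrightarrow> 0 \<le> half_kernel t v"
  unfolding half_kernel_def by simp

lemma half_kernel_abs: "\<bar>half_kernel t v\<bar> = half_kernel t \<bar>v\<bar>"
  unfolding half_kernel_def by (simp add: abs_mult)

text \<open>The quadratic bound serves near 0 and the constant bound at infinity. One majorant of
  order \<open>1 / (1 + t^2)\<close> combines them and is used both for integrability and for
  dominated convergence.\<close>

lemma half_kernel_le:
  assumes "v \<le> C * t\<^sup>2" "v \<le> D"
  shows "half_kernel t v \<le> (C + D) * (indicator {0<..} t * (1 / (1 + t\<^sup>2)))"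
proof (cases "0 < t")
  case True
  have "v * (1 + t\<^sup>2) = v + v * t\<^sup>2" by (simp add: algebra_simps)
  also have "\<dots> \<le> C * t\<^sup>2 + D * t\<^sup>2" using assms by (intro add_mono mult_right_mono) auto
  finally have "v * (1 + t\<^sup>2) \<le> (C + D) * t\<^sup>2" by (simp add: algebra_simps)
  moreover have "0 < 1 + t\<^sup>2" by (simp add: add_pos_nonneg)
  ultimately show ?thesis using True unfolding half_kernel_def by (simp add: divide_le_eq le_divide_eq)
qed (simp add: half_kernel_def)

lemma half_kernel_integrable:
  assumes [measurable]: "v \<in> borel_measurable borel" and "\<And>t. \<bar>v t\<bar> \<le> C * t\<^sup>2" "\<And>t. \<bar>v t\<bar> \<le> D"
  shows "integrable lborel (\<lambda>t. half_kernel t (v t))"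
proof (rule Bochner_Integration.integrable_bound)
  show "integrable lborel (\<lambda>t. (C + D) * (indicator {0<..} t * (1 / (1 + t\<^sup>2))))"
    by (intro integrable_mult_right integrable_half_line_inverse)
  show "AE t in lborel. norm (half_kernel t (v t)) \<le> norm ((C + D) * (indicator {0<..} t * (1 / (1 + t\<^sup>2))))"
  proof (rule AE_I2)
    fix t
    have "norm (half_kernel t (v t)) \<le> (C + D) * (indicator {0<..} t * (1 / (1 + t\<^sup>2)))"
      using half_kernel_le[OF assms(2,3)] by (simp only: real_norm_def half_kernel_abs)
    then show "norm (half_kernel t (v t)) \<le> norm ((C + D) * (indicator {0<..} t * (1 / (1 + t\<^sup>2))))"
      by (rule order_trans) (simp only: real_norm_def abs_ge_self)
  qed
qed measurable

text \<open>The classical integral with value pi / 2, kept here as a symbol that occurs as a common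
  factor on both sides.\<close>

definition abs_const :: real where
  "abs_const = (\<integral>t. half_kernel t (1 - cos t) \<partial>lborel)"

lemma half_kernel_cos_integrable: "integrable lborel (\<lambda>t. half_kernel t (1 - cos (t * x)))"
proof (rule half_kernel_integrable)
  fix t
  show "\<bar>1 - cos (t * x)\<bar> \<le> (x\<^sup>2 / 2) * t\<^sup>2" "\<bar>1 - cos (t * x)\<bar> \<le> 2"
    using one_minus_cos_bounds[of "t * x"] by (auto simp: power_mult_distrib mult_ac)
qed simp

text \<open>Scaling: replacing t by |x| t multiplies Lebesgue measure by |x| and the kernel by
  \<open>1 / x^2\<close>, and the cosine is even, so the integral is homogeneous of degree one in
  |x|.\<close>

lemma half_kernel_cos_integral: "(\<integral>t. half_kernel t (1 - cos (t * x)) \<partial>lborel) = abs_const * \<bar>x\<bar>"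
proof (cases "x = 0")
  case True
  then show ?thesis by (simp add: half_kernel_def)
next
  case False
  have "abs_const = \<bar>\<bar>x\<bar>\<bar> *\<^sub>R (\<integral>t. half_kernel (0 + \<bar>x\<bar> * t) (1 - cos (0 + \<bar>x\<bar> * t)) \<partial>lborel)"
    unfolding abs_const_def using False by (intro lborel_integral_real_affine) auto
  also have "(\<lambda>t. half_kernel (0 + \<bar>x\<bar> * t) (1 - cos (0 + \<bar>x\<bar> * t))) = (\<lambda>t. half_kernel t (1 - cos (t * x)) / x\<^sup>2)"
  proof
    fix t
    have "cos (\<bar>x\<bar> * t) = cos (t * x)" by (cases "0 \<le> x") (auto simp: mult.commute)
    then show "half_kernel (0 + \<bar>x\<bar> * t) (1 - cos (0 + \<bar>x\<bar> * t)) = half_kernel t (1 - cos (t * x)) / x\<^sup>2"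
      using False unfolding half_kernel_def by (simp add: indicator_def zero_less_mult_iff power_mult_distrib)
  qed
  finally have "abs_const = \<bar>x\<bar> * ((\<integral>t. half_kernel t (1 - cos (t * x)) \<partial>lborel) / x\<^sup>2)" by simp
  then have "abs_const * \<bar>x\<bar> = \<bar>x\<bar> * ((\<integral>t. half_kernel t (1 - cos (t * x)) \<partial>lborel) / x\<^sup>2) * \<bar>x\<bar>"
    by (rule arg_cong)
  also have "\<dots> = (\<integral>t. half_kernel t (1 - cos (t * x)) \<partial>lborel)"
  proof -
    have "\<bar>x\<bar> * (c / x\<^sup>2) * \<bar>x\<bar> = c" for c
      using False by (cases "0 < x") (auto simp: power2_eq_square)
    then show ?thesis .
  qed
  finally show ?thesis by simp
qed

lemma abs_const_pos: "0 < abs_const"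
proof -
  have nn: "AE t in lborel. 0 \<le> half_kernel t (1 - cos t)"
    by (intro AE_I2 half_kernel_nonneg one_minus_cos_bounds(1))
  have i: "integrable lborel (\<lambda>t. half_kernel t (1 - cos t))"
    using half_kernel_cos_integrable[of 1] by simp
  have "abs_const \<noteq> 0"
  proof
    assume "abs_const = 0"
    then have "AE t in lborel. half_kernel t (1 - cos t) = 0"
      unfolding abs_const_def using integral_nonneg_eq_0_iff_AE[OF i nn] by simp
    \<comment> \<open>On [1, 2], which lies inside (0, pi], the cosine is strictly below 1, so a
      vanishing integral would make this interval a null set.\<close>
    then have "AE t in lborel. t \<notin> {1..2::real}"
    proof eventually_elim
      case (elim t)
      show ?case
      proof
        assume t: "t \<in> {1..2}"
        then have "cos t < 1" using cos_monotone_0_pi[of 0 t] pi_ge_two by simp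
        then show False using elim t unfolding half_kernel_def by auto
      qed
    qed
    then have "{1..2::real} \<in> null_sets lborel"
      by (subst AE_iff_null_sets) auto
    then show False by (simp add: null_sets_def)
  qed
  moreover have "0 \<le> abs_const" unfolding abs_const_def using nn by (rule integral_nonneg_AE)
  ultimately show ?thesis by simp
qed

lemma half_kernel_cos_nn_integral:
  "(\<integral>\<^sup>+t. half_kernel t (1 - cos (t * x)) \<partial>lborel) = ennreal (abs_const * \<bar>x\<bar>)"
  using nn_integral_eq_integral[OF half_kernel_cos_integrable[of x]] half_kernel_cos_integral[of x]
  by (simp add: half_kernel_nonneg one_minus_cos_bounds(1))

lemma half_kernel_gauss_integrable: "integrable lborel (\<lambda>t. half_kernel t (1 - exp (- t\<^sup>2)))"
proof (rule half_kernel_integrable)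
  fix t :: real
  show "\<bar>1 - exp (- t\<^sup>2)\<bar> \<le> 1 * t\<^sup>2" "\<bar>1 - exp (- t\<^sup>2)\<bar> \<le> 1"
    using exp_ge_add_one_self[of "- t\<^sup>2"] by auto
qed simp

text \<open>Both sides equal \<open>abs_const * E|sqrt 2 * N|\<close> for a standard normal N, so abs_const never has to be evaluated.\<close>

lemma half_kernel_gauss_integral:
  "(\<integral>t. half_kernel t (1 - exp (- t\<^sup>2)) \<partial>lborel) = abs_const * (2 / sqrt pi)"
proof -
  let ?N = "std_normal_distribution"
  interpret N: real_distribution ?N by (rule real_dist_normal_dist)
  interpret P: pair_sigma_finite lborel ?N
    by (intro pair_sigma_finite.intro lborel.sigma_finite_measure_axioms N.sigma_finite_measure_axioms)
  have g: "(\<integral>x. 1 - cos (t * (sqrt 2 * x)) \<partial>?N) = 1 - exp (- t\<^sup>2)" for t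
  proof -
    have i: "integrable ?N (\<lambda>x. cos (t * (sqrt 2 * x)))"
      by (rule N.integrable_const_bound[of _ 1]) auto
    have ie: "complex_integrable ?N (\<lambda>x. iexp (t * sqrt 2 * x))"
      by (rule N.integrable_iexp) (simp_all)
    have "(\<integral>x. cos (t * (sqrt 2 * x)) \<partial>?N) = (\<integral>x. Re (iexp (t * sqrt 2 * x)) \<partial>?N)"
      by (intro Bochner_Integration.integral_cong refl) (simp add: Re_exp mult.assoc Im_i_times del: of_real_mult)
    also have "\<dots> = Re (char ?N (t * sqrt 2))" unfolding char_def by (rule integral_Re[OF ie])
    also have "\<dots> = exp (- t\<^sup>2)" unfolding char_std_normal_distribution by (simp add: power_mult_distrib)
    finally show ?thesis using i N.prob_space by simp
  qed
  have cm [measurable]: "(\<lambda>(t, x). ennreal (half_kernel t (1 - cos (t * (sqrt 2 * x))))) \<in> borel_measurable (lborel \<Otimes>\<^sub>M ?N)"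
    unfolding split_beta by measurable
  have "(\<integral>\<^sup>+t. half_kernel t (1 - exp (- t\<^sup>2)) \<partial>lborel)
      = (\<integral>\<^sup>+t. \<integral>\<^sup>+x. half_kernel t (1 - cos (t * (sqrt 2 * x))) \<partial>?N \<partial>lborel)"
  proof (rule nn_integral_cong)
    fix t :: real
    have i: "integrable ?N (\<lambda>x. half_kernel t (1 - cos (t * (sqrt 2 * x))))"
      unfolding half_kernel_def
      by (intro integrable_mult_right integrable_divide N.integrable_const_bound[of _ 2])
         (auto simp: one_minus_cos_bounds)
    have "(\<integral>\<^sup>+x. half_kernel t (1 - cos (t * (sqrt 2 * x))) \<partial>?N) = ennreal (\<integral>x. half_kernel t (1 - cos (t * (sqrt 2 * x))) \<partial>?N)"
      by (rule nn_integral_eq_integral[OF i]) (auto intro!: half_kernel_nonneg simp: one_minus_cos_bounds)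
    also have "(\<integral>x. half_kernel t (1 - cos (t * (sqrt 2 * x))) \<partial>?N) = half_kernel t (1 - exp (- t\<^sup>2))"
      unfolding half_kernel_def g[symmetric] by (simp only: integral_mult_right_zero integral_divide_zero)
    finally show "ennreal (half_kernel t (1 - exp (- t\<^sup>2))) = (\<integral>\<^sup>+x. half_kernel t (1 - cos (t * (sqrt 2 * x))) \<partial>?N)" by simp
  qed
  also have "\<dots> = (\<integral>\<^sup>+x. \<integral>\<^sup>+t. half_kernel t (1 - cos (t * (sqrt 2 * x))) \<partial>lborel \<partial>?N)"
    using P.Fubini'[OF cm] by simp
  also have "\<dots> = (\<integral>\<^sup>+x. ennreal (abs_const * sqrt 2 * \<bar>x\<bar>) \<partial>?N)"
    unfolding half_kernel_cos_nn_integral by (simp add: abs_mult mult_ac)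
  also have "\<dots> = ennreal (\<integral>x. abs_const * sqrt 2 * \<bar>x\<bar> \<partial>?N)"
  proof (rule nn_integral_eq_integral)
    have "integrable ?N (\<lambda>x. \<bar>x\<bar> ^ 1)"
      using integrable_std_normal_moment_abs[of 1]
      by (subst integrable_density) (auto simp: normal_density_nonneg)
    then show "integrable ?N (\<lambda>x. abs_const * sqrt 2 * \<bar>x\<bar>)" by simp
  qed (use abs_const_pos in auto)
  \<comment> \<open>The first absolute moment sqrt (2 / pi) of the standard normal law, times sqrt
    2, is the constant 2 / sqrt pi of the theorem.\<close>
  also have "(\<integral>x. abs_const * sqrt 2 * \<bar>x\<bar> \<partial>?N) = abs_const * (2 / sqrt pi)"
    using std_normal_distribution_odd_moments_abs[of 0] by (simp add: real_sqrt_divide)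
  finally have "(\<integral>\<^sup>+t. half_kernel t (1 - exp (- t\<^sup>2)) \<partial>lborel) = ennreal (abs_const * (2 / sqrt pi))" .
  moreover have "(\<integral>\<^sup>+t. half_kernel t (1 - exp (- t\<^sup>2)) \<partial>lborel) = ennreal (\<integral>t. half_kernel t (1 - exp (- t\<^sup>2)) \<partial>lborel)"
    by (rule nn_integral_eq_integral[OF half_kernel_gauss_integrable]) (auto intro!: half_kernel_nonneg)
  moreover have "0 \<le> (\<integral>t. half_kernel t (1 - exp (- t\<^sup>2)) \<partial>lborel)"
    by (intro integral_nonneg_AE AE_I2 half_kernel_nonneg) simp
  ultimately show ?thesis using abs_const_pos by (simp add: ennreal_inj)
qed

text \<open>Gini's mean difference with the zero diagonal included and divisor \<open>b^2\<close>,
  unlike \<open>Ustat\<close>. In this form it corresponds exactly to the squared modulus of the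
  empirical characteristic function.\<close>

definition gini :: "nat \<Rightarrow> (nat \<Rightarrow> real) \<Rightarrow> real" where
  "gini b w = (\<Sum>j\<in>{1..b}. \<Sum>k\<in>{1..b}. \<bar>w j - w k\<bar>) / (real b)\<^sup>2"

lemma gini_scale:
  assumes "0 \<le> K"
  shows "gini b (\<lambda>j. K * w j) = K * gini b w"
  unfolding gini_def right_diff_distrib[symmetric] abs_mult using assms by (simp add: sum_distrib_left)

definition emp_char :: "nat \<Rightarrow> (nat \<Rightarrow> real) \<Rightarrow> real \<Rightarrow> complex" where
  "emp_char b w t = (\<Sum>j\<in>{1..b}. iexp (t * w j)) / of_nat b"

lemma emp_char_norm_le_1: "cmod (emp_char b w t) \<le> 1"
proof (cases "b = 0")
  case False
  have "cmod (\<Sum>j\<in>{1..b}. iexp (t * w j)) \<le> (\<Sum>j\<in>{1..b}. 1)"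
    by (rule sum_norm_le) simp
  then show ?thesis using False unfolding emp_char_def by (simp add: norm_divide divide_le_eq)
qed (simp add: emp_char_def)

text \<open>The squared sums of cosines and of sines recombine by the addition formula, so only
  differences \<open>w j - w k\<close> survive.\<close>

lemma emp_char_norm_square:
  assumes "0 < b"
  shows "1 - (cmod (emp_char b w t))\<^sup>2 = (\<Sum>j\<in>{1..b}. \<Sum>k\<in>{1..b}. 1 - cos (t * (w j - w k))) / (real b)\<^sup>2"
proof -
  have "(cmod (\<Sum>j\<in>{1..b}. iexp (t * w j)))\<^sup>2 = (\<Sum>j\<in>{1..b}. cos (t * w j))\<^sup>2 + (\<Sum>j\<in>{1..b}. sin (t * w j))\<^sup>2"
    by (simp add: cmod_power2 Re_exp Im_exp)
  also have "\<dots> = (\<Sum>j\<in>{1..b}. \<Sum>k\<in>{1..b}. cos (t * (w j - w k)))"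
    by (simp add: power2_eq_square sum_product sum.distrib[symmetric] cos_diff right_diff_distrib)
  finally show ?thesis using assms
    by (simp add: emp_char_def norm_divide power_divide sum_subtractf diff_divide_distrib power2_eq_square)
qed

lemma emp_char_half_kernel:
  assumes "0 < b"
  shows "integrable lborel (\<lambda>t. half_kernel t (1 - (cmod (emp_char b w t))\<^sup>2))"
    and "(\<integral>t. half_kernel t (1 - (cmod (emp_char b w t))\<^sup>2) \<partial>lborel)
      = abs_const * gini b w"
proof -
  have e: "half_kernel t (1 - (cmod (emp_char b w t))\<^sup>2)
     = (\<Sum>j\<in>{1..b}. \<Sum>k\<in>{1..b}. half_kernel t (1 - cos (t * (w j - w k)))) / (real b)\<^sup>2" for t
    unfolding emp_char_norm_square[OF assms] half_kernel_def
    by (simp add: sum_distrib_left sum_divide_distrib mult_ac)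
  show "integrable lborel (\<lambda>t. half_kernel t (1 - (cmod (emp_char b w t))\<^sup>2))"
    unfolding e by (intro integrable_divide Bochner_Integration.integrable_sum half_kernel_cos_integrable)
  show "(\<integral>t. half_kernel t (1 - (cmod (emp_char b w t))\<^sup>2) \<partial>lborel)
      = abs_const * gini b w"
    unfolding e gini_def using half_kernel_cos_integrable half_kernel_cos_integral
    by (simp add: sum_distrib_left)
qed

section \<open>Truncation and covariances of unbounded variables\<close>

lemma mult_truncation_error:
  fixes x y A p :: real
  assumes "2 < p" "1 \<le> A"
  shows "\<bar>x * y - (if \<bar>x\<bar> \<le> A then x else 0) * (if \<bar>y\<bar> \<le> A then y else 0)\<bar>
    \<le> A powr (2 - p) * (\<bar>x\<bar> powr p + \<bar>y\<bar> powr p)"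
proof (cases "\<bar>x\<bar> \<le> A \<and> \<bar>y\<bar> \<le> A")
  case True
  then show ?thesis by simp
next
  case False
  \<comment> \<open>Where truncation changes the product, \<open>c\<close> exceeds \<open>A\<close>;
    then c^2 = c^(2-p) c^p, and the negative exponent 2 - p allows \<open>c\<close> to be replaced
    by \<open>A\<close> in the first factor.\<close>
  define c where "c = max \<bar>x\<bar> \<bar>y\<bar>"
  have c: "A < c" "1 < c" using False assms unfolding c_def by auto
  have "\<bar>x * y - (if \<bar>x\<bar> \<le> A then x else 0) * (if \<bar>y\<bar> \<le> A then y else 0)\<bar> = \<bar>x\<bar> * \<bar>y\<bar>"
    using False by (auto simp: abs_mult)
  also have "\<dots> \<le> c * c" unfolding c_def by (intro mult_mono) auto
  also have "\<dots> = c powr (2 - p) * c powr p" using c by (simp flip: powr_add add: power2_eq_square)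
  also have "\<dots> \<le> A powr (2 - p) * c powr p"
    using c assms by (intro mult_right_mono powr_mono2') auto
  also have "\<dots> \<le> A powr (2 - p) * (\<bar>x\<bar> powr p + \<bar>y\<bar> powr p)"
    unfolding c_def by (intro mult_left_mono) (auto simp: max_def)
  finally show ?thesis .
qed

text \<open>Because \<open>A >= 1\<close>, the bound |x| <= x^2 holds wherever truncation acts, so a
  single variable gives the same power of \<open>A\<close> as a product of two.\<close>

lemma truncation_error:
  fixes x A p :: real
  assumes "2 < p" "1 \<le> A"
  shows "\<bar>x - (if \<bar>x\<bar> \<le> A then x else 0)\<bar> \<le> A powr (2 - p) * \<bar>x\<bar> powr p"
proof (cases "\<bar>x\<bar> \<le> A")
  case False
  then have "1 < \<bar>x\<bar>" using assms by auto
  then have "\<bar>x\<bar> powr 1 \<le> \<bar>x\<bar> powr 2" by (intro powr_mono) auto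
  then have "\<bar>x\<bar> \<le> \<bar>x\<bar> powr 2" by simp
  also have "\<dots> = \<bar>x\<bar> powr (2 - p) * \<bar>x\<bar> powr p" using False by (simp flip: powr_add)
  also have "\<dots> \<le> A powr (2 - p) * \<bar>x\<bar> powr p"
    using False assms by (intro mult_right_mono powr_mono2') auto
  finally show ?thesis using False by simp
qed auto

text \<open>Continuity at \<open>a\<close> from the right. It is meant for \<open>a = 0\<close>,
  where the truncation level chosen below would be infinite.\<close>

lemma le_mult_powr_zero_limit:
  fixes x K r :: real
  assumes "0 < r" "0 \<le> a" and "\<And>t. a < t \<Longrightarrow> t \<le> 1 \<Longrightarrow> x \<le> K * t powr r" and a1: "a < 1"
  shows "x \<le> K * a powr r"
proof (rule tendsto_lowerbound)
  have "continuous_on {0..} (\<lambda>t. K * t powr r)"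
    using assms by (intro continuous_on_mult continuous_on_powr' continuous_intros) auto
  then have "((\<lambda>t. K * t powr r) \<longlongrightarrow> K * a powr r) (at a within {0..})"
    using assms unfolding continuous_on_def by auto
  then show "((\<lambda>t. K * t powr r) \<longlongrightarrow> K * a powr r) (at_right a)"
    by (rule tendsto_within_subset) (use assms in auto)
  show "\<forall>\<^sub>F t in at_right a. x \<le> K * t powr r"
    unfolding eventually_at_right_field using assms by (intro exI[of _ 1]) auto
qed auto

context prob_space
begin

text \<open>A Davydov-type covariance inequality. Both variables are cut at a common level: the
  bounded parts are controlled by \<open>cov\<close>, the tails by the p-th moments. In the
  constant, 2 comes from the bounded parts, 2 Q from the truncated product and 2 Q^2 from the
  product of means. The argument is run with a positive t >= a, and t then decreases to a.\<close>

lemma cov_le_truncation: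
  fixes X Y :: "'a \<Rightarrow> real" and p Q a :: real
  assumes [measurable]: "X \<in> borel_measurable M" "Y \<in> borel_measurable M"
    and p: "2 < p" and a: "0 \<le> a" "a \<le> 1"
    and Xi: "integrable M X" and Yi: "integrable M Y" and XYi: "integrable M (\<lambda>x. X x * Y x)"
    and Xp: "integrable M (\<lambda>x. \<bar>X x\<bar> powr p)" and Yp: "integrable M (\<lambda>x. \<bar>Y x\<bar> powr p)"
    and Q: "(\<integral>x. \<bar>X x\<bar> powr p \<partial>M) \<le> Q" "(\<integral>x. \<bar>Y x\<bar> powr p \<partial>M) \<le> Q"
      "(\<integral>x. \<bar>X x\<bar> \<partial>M) \<le> Q" "(\<integral>x. \<bar>Y x\<bar> \<partial>M) \<le> Q"
    and cov: "\<And>A. 0 < A \<Longrightarrow>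
      \<bar>(\<integral>x. (if \<bar>X x\<bar> \<le> A then X x else 0) * (if \<bar>Y x\<bar> \<le> A then Y x else 0) \<partial>M)
        - (\<integral>x. (if \<bar>X x\<bar> \<le> A then X x else 0) \<partial>M) * (\<integral>x. (if \<bar>Y x\<bar> \<le> A then Y x else 0) \<partial>M)\<bar> \<le> 2 * A\<^sup>2 * a"
  shows "\<bar>(\<integral>x. X x * Y x \<partial>M) - (\<integral>x. X x \<partial>M) * (\<integral>x. Y x \<partial>M)\<bar> \<le> (2 + 2 * Q + 2 * Q\<^sup>2) * a powr (1 - 2 / p)"
proof -
  have Q0: "0 \<le> Q" using Q(3) by (rule order_trans[rotated]) simp
  have main: "\<bar>(\<integral>x. X x * Y x \<partial>M) - (\<integral>x. X x \<partial>M) * (\<integral>x. Y x \<partial>M)\<bar> \<le> (2 + 2 * Q + 2 * Q\<^sup>2) * t powr (1 - 2 / p)"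
    if t: "0 < t" "t \<le> 1" "a \<le> t" for t
  proof -
    \<comment> \<open>This level balances the errors: \<open>A^2 * t\<close> for the bounded parts
      and \<open>A powr (2 - p)\<close> for the tails both equal
      \<open>t powr (1 - 2 / p)\<close>.\<close>
    define A where "A = t powr (- 1 / p)"
    have A1: "1 \<le> A" unfolding A_def using t p powr_mono2'[of "-1/p" t 1] by simp
    define T where "T z = (if \<bar>z\<bar> \<le> A then z else 0)" for z :: real
    have [measurable]: "T \<in> borel_measurable borel" unfolding T_def by measurable
    have Tb: "\<bar>T z\<bar> \<le> A" "\<bar>T z\<bar> \<le> \<bar>z\<bar>" for z unfolding T_def using A1 by auto
    define e where "e = A powr (2 - p)"
    have e0: "0 \<le> e" unfolding e_def by simp
    have ee: "e = t powr (1 - 2 / p)" unfolding e_def A_def powr_powr using p by (simp add: diff_divide_distrib algebra_simps)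
    have Ae: "A\<^sup>2 * t = e"
    proof -
      have "A\<^sup>2 = t powr (- 2 / p)" unfolding A_def using t by (simp add: power2_eq_square flip: powr_add)
      then have "A\<^sup>2 * t = t powr (- 2 / p) * t powr 1" using t by simp
      also have "\<dots> = t powr (- 2 / p + 1)" by (rule powr_add[symmetric])
      also have "\<dots> = e" unfolding ee by simp
      finally show ?thesis .
    qed
    have TX: "integrable M (\<lambda>x. T (X x))" and TY: "integrable M (\<lambda>x. T (Y x))"
      by (rule integrable_const_bound[of _ A], use Tb in auto)+
    have TXY: "integrable M (\<lambda>x. T (X x) * T (Y x))"
      by (rule integrable_const_bound[of _ "A * A"]) (use Tb A1 in \<open>auto simp: abs_mult intro!: mult_mono\<close>)
    have b1: "\<bar>(\<integral>x. X x * Y x \<partial>M) - (\<integral>x. T (X x) * T (Y x) \<partial>M)\<bar> \<le> 2 * Q * e"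
    proof -
      have "\<bar>(\<integral>x. X x * Y x \<partial>M) - (\<integral>x. T (X x) * T (Y x) \<partial>M)\<bar> = \<bar>\<integral>x. X x * Y x - T (X x) * T (Y x) \<partial>M\<bar>"
        using XYi TXY by simp
      also have "\<dots> \<le> (\<integral>x. \<bar>X x * Y x - T (X x) * T (Y x)\<bar> \<partial>M)" by (rule integral_abs_bound)
      also have "\<dots> \<le> (\<integral>x. e * (\<bar>X x\<bar> powr p + \<bar>Y x\<bar> powr p) \<partial>M)"
        using XYi TXY Xp Yp unfolding T_def e_def
        by (intro integral_mono integrable_abs Bochner_Integration.integrable_diff mult_truncation_error p A1) auto
      also have "\<dots> \<le> e * (Q + Q)" using Xp Yp Q e0 by (auto intro!: mult_left_mono add_mono)
      finally show ?thesis by (simp add: mult_ac)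
    qed
    have b2: "\<bar>(\<integral>x. Z x \<partial>M) - (\<integral>x. T (Z x) \<partial>M)\<bar> \<le> Q * e"
      if Zi: "integrable M Z" "integrable M (\<lambda>x. T (Z x))" "integrable M (\<lambda>x. \<bar>Z x\<bar> powr p)" "(\<integral>x. \<bar>Z x\<bar> powr p \<partial>M) \<le> Q" for Z
    proof -
      have "\<bar>(\<integral>x. Z x \<partial>M) - (\<integral>x. T (Z x) \<partial>M)\<bar> = \<bar>\<integral>x. Z x - T (Z x) \<partial>M\<bar>" using Zi by simp
      also have "\<dots> \<le> (\<integral>x. \<bar>Z x - T (Z x)\<bar> \<partial>M)" by (rule integral_abs_bound)
      also have "\<dots> \<le> (\<integral>x. e * \<bar>Z x\<bar> powr p \<partial>M)"
        using Zi unfolding T_def e_def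
        by (intro integral_mono integrable_abs Bochner_Integration.integrable_diff truncation_error p A1) auto
      also have "\<dots> \<le> Q * e" using mult_left_mono[OF Zi(4) e0] by (simp add: mult.commute)
      finally show ?thesis .
    qed
    have bX: "\<bar>\<integral>x. X x \<partial>M\<bar> \<le> Q" using integral_abs_bound[of M X] Q by linarith
    have bTY: "\<bar>\<integral>x. T (Y x) \<partial>M\<bar> \<le> Q"
    proof -
      have "\<bar>\<integral>x. T (Y x) \<partial>M\<bar> \<le> (\<integral>x. \<bar>T (Y x)\<bar> \<partial>M)" by (rule integral_abs_bound)
      also have "\<dots> \<le> (\<integral>x. \<bar>Y x\<bar> \<partial>M)" using TY Yi Tb by (intro integral_mono integrable_abs) auto
      finally show ?thesis using Q by simp
    qed
    have "(\<integral>x. X x \<partial>M) * (\<integral>x. Y x \<partial>M) - (\<integral>x. T (X x) \<partial>M) * (\<integral>x. T (Y x) \<partial>M)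
      = (\<integral>x. X x \<partial>M) * ((\<integral>x. Y x \<partial>M) - (\<integral>x. T (Y x) \<partial>M)) + ((\<integral>x. X x \<partial>M) - (\<integral>x. T (X x) \<partial>M)) * (\<integral>x. T (Y x) \<partial>M)"
      by (simp add: algebra_simps)
    also have "\<bar>\<dots>\<bar> \<le> Q * (Q * e) + (Q * e) * Q"
      unfolding abs_mult
      by (intro order_trans[OF abs_triangle_ineq] add_mono, unfold abs_mult)
         (intro mult_mono bX bTY b2 Xi Yi TX TY Xp Yp Q; simp add: Q0 e0)+
    finally have b3: "\<bar>(\<integral>x. X x \<partial>M) * (\<integral>x. Y x \<partial>M) - (\<integral>x. T (X x) \<partial>M) * (\<integral>x. T (Y x) \<partial>M)\<bar> \<le> 2 * Q\<^sup>2 * e"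
      by (simp add: power2_eq_square)
    have b4: "\<bar>(\<integral>x. T (X x) * T (Y x) \<partial>M) - (\<integral>x. T (X x) \<partial>M) * (\<integral>x. T (Y x) \<partial>M)\<bar> \<le> 2 * e"
    proof -
      have "\<bar>(\<integral>x. T (X x) * T (Y x) \<partial>M) - (\<integral>x. T (X x) \<partial>M) * (\<integral>x. T (Y x) \<partial>M)\<bar> \<le> 2 * A\<^sup>2 * a"
        unfolding T_def by (rule cov) (use A1 in simp)
      also have "\<dots> \<le> 2 * A\<^sup>2 * t" using t by (intro mult_left_mono) auto
      finally show ?thesis using Ae by simp
    qed
    have "\<bar>(\<integral>x. X x * Y x \<partial>M) - (\<integral>x. X x \<partial>M) * (\<integral>x. Y x \<partial>M)\<bar> \<le> 2 * e + 2 * Q * e + 2 * Q\<^sup>2 * e"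
      using b1 b3 b4 by linarith
    then show ?thesis unfolding ee by (simp add: algebra_simps)
  qed
  show ?thesis
  proof (cases "a = 1")
    case True then show ?thesis using main[of 1] by simp
  next
    case False
    show ?thesis
      by (rule le_mult_powr_zero_limit) (use main a False p in auto)
  qed
qed

end

section \<open>Covariance bounds for a stationary absolutely regular process\<close>

locale stationary_mixing = prob_space M for M :: "'a measure" +
  fixes Y :: "nat \<Rightarrow> 'a \<Rightarrow> real" and theta :: real
  assumes Y_measurable [measurable]: "\<And>i. Y i \<in> borel_measurable M"
    and stationary: "strictly_stationary M Y"
    and theta_pos: "0 < theta"
    and Y_moment: "integrable M (\<lambda>x. \<bar>Y 1 x\<bar> powr (4 + 2 * theta))"
    and summable_betaY: "summable (\<lambda>k. betaY M Y (Suc k) powr (theta / (2 + theta)))"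
begin

text \<open>The running minimum makes the mixing rate monotone without having to show that betaY is.\<close>

definition alpha :: "nat \<Rightarrow> real" where
  "alpha k = Min (insert 1 (betaY M Y ` {..k}))"

lemma betaY_nonneg: "0 \<le> betaY M Y k"
  unfolding betaY_def by simp

lemma alpha_nonneg: "0 \<le> alpha k" and alpha_le_1: "alpha k \<le> 1" and alpha_le_betaY: "alpha k \<le> betaY M Y k"
  unfolding alpha_def by (auto simp: betaY_nonneg simp del: Min_insert)

lemma alpha_antimono: "j \<le> k \<Longrightarrow> alpha k \<le> alpha j"
  unfolding alpha_def by (rule Min_antimono) auto

lemma subalgebra_Y: "subalgebra M (gen_sigma M Y I)"
  by (rule subalgebra_gen_sigma) simp

lemma beta_coeff_le_betaY:
  assumes "1 \<le> m"
  shows "beta_coeff M (gen_sigma M Y {1..m}) (gen_sigma M Y {k+m..}) \<le> ennreal (betaY M Y k)"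
proof -
  let ?S = "SUP m\<in>{1..}. beta_coeff M (gen_sigma M Y {1..m}) (gen_sigma M Y {k+m..})"
  have "?S \<le> 1" by (intro SUP_least beta_coeff_le_1 subalgebra_Y)
  then have "?S < \<infinity>" using ennreal_one_less_top le_less_trans by fastforce
  then have "ennreal (betaY M Y k) = ?S" unfolding betaY_def by simp
  then show ?thesis using assms by (auto intro: SUP_upper)
qed

text \<open>As \<open>alpha k\<close> is a minimum, the bound is checked against each of its
  members. For a smaller gap j the function \<open>g\<close> is still measurable with respect to the
  larger future starting at j + m; for the member 1 the trivial bound 2 suffices. The factor 2
  arises from rescaling \<open>f\<close> from [-1, 1] to [0, 1].\<close>

lemma cov_le_alpha:
  fixes f g :: "'a \<Rightarrow> real"
  assumes m: "1 \<le> m"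
    and f: "f \<in> borel_measurable (gen_sigma M Y {1..m})" and fb: "\<And>x. x \<in> space M \<Longrightarrow> \<bar>f x\<bar> \<le> 1"
    and g: "g \<in> borel_measurable (gen_sigma M Y {k+m..})" and gb: "\<And>x. x \<in> space M \<Longrightarrow> \<bar>g x\<bar> \<le> 1"
  shows "\<bar>(\<integral>x. f x * g x \<partial>M) - (\<integral>x. f x \<partial>M) * (\<integral>x. g x \<partial>M)\<bar> \<le> 2 * alpha k"
proof -
  have fM [measurable]: "f \<in> borel_measurable M" using measurable_from_subalg[OF subalgebra_Y f] .
  have gM [measurable]: "g \<in> borel_measurable M" using measurable_from_subalg[OF subalgebra_Y g] .
  have fi: "integrable M f" and gi: "integrable M g" and fgi: "integrable M (\<lambda>x. f x * g x)"
    using bounded_factors_integrable[OF fM gM] fb gb by auto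
  let ?c = "(\<integral>x. f x * g x \<partial>M) - (\<integral>x. f x \<partial>M) * (\<integral>x. g x \<partial>M)"
  have "\<bar>?c\<bar> \<le> 2 * betaY M Y j" if "j \<le> k" for j
  proof -
    have gj: "g \<in> borel_measurable (gen_sigma M Y {j+m..})"
    proof (rule measurable_from_subalg[OF _ g])
      have "{k + m..} \<subseteq> {j + m..}" using that by auto
      from sets_gen_sigma_mono[OF this, of M Y]
      show "subalgebra (gen_sigma M Y {j + m..}) (gen_sigma M Y {k + m..})"
        unfolding subalgebra_def by simp
    qed
    have fm: "(\<lambda>x. (f x + 1) / 2) \<in> borel_measurable (gen_sigma M Y {1..m})"
      using f by measurable
    have "\<bar>(\<integral>x. (f x + 1) / 2 * g x \<partial>M) - (\<integral>x. (f x + 1) / 2 \<partial>M) * (\<integral>x. g x \<partial>M)\<bar> \<le> betaY M Y j"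
    proof (rule cov_le_of_cov_indicator_le[OF subalgebra_Y fm _ gM gb])
      show "0 \<le> (f x + 1) / 2 \<and> (f x + 1) / 2 \<le> 1" if "x \<in> space M" for x
        using fb[OF that] by auto
      fix S assume S: "S \<in> sets (gen_sigma M Y {1..m})"
      have "ennreal \<bar>(\<integral>x. indicator S x * g x \<partial>M) - prob S * (\<integral>x. g x \<partial>M)\<bar> \<le> ennreal (betaY M Y j)"
        using cov_indicator_le_beta_coeff[OF subalgebra_Y subalgebra_Y S gj gb] beta_coeff_le_betaY[OF m, of j]
        by (rule order_trans)
      then show "\<bar>(\<integral>x. indicator S x * g x \<partial>M) - prob S * (\<integral>x. g x \<partial>M)\<bar> \<le> betaY M Y j"
        using betaY_nonneg[of j] by (subst (asm) ennreal_le_iff) auto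
    qed
    moreover have "(\<integral>x. (f x + 1) / 2 * g x \<partial>M) - (\<integral>x. (f x + 1) / 2 \<partial>M) * (\<integral>x. g x \<partial>M) = ?c / 2"
    proof -
      have "(\<integral>x. (f x + 1) / 2 * g x \<partial>M) = (\<integral>x. (f x * g x + g x) / 2 \<partial>M)"
        by (simp add: field_simps)
      then show ?thesis using fi gi fgi by (simp add: prob_space field_simps)
    qed
    ultimately show ?thesis by (simp add: abs_le_iff)
  qed
  moreover have "\<bar>?c\<bar> \<le> 2"
  proof -
    have "\<bar>\<integral>x. f x * g x \<partial>M\<bar> \<le> (\<integral>x. 1 \<partial>M)"
      by (rule order_trans[OF integral_abs_bound integral_mono])
         (use fb gb in \<open>auto simp: abs_mult intro!: mult_le_one integrable_abs[OF fgi, unfolded abs_mult]\<close>)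
    moreover have "\<bar>\<integral>x. f x \<partial>M\<bar> \<le> (\<integral>x. 1 \<partial>M)"
      by (rule order_trans[OF integral_abs_bound integral_mono]) (use fi fb in auto)
    moreover have "\<bar>\<integral>x. g x \<partial>M\<bar> \<le> (\<integral>x. 1 \<partial>M)"
      by (rule order_trans[OF integral_abs_bound integral_mono]) (use gi gb in auto)
    ultimately have "\<bar>\<integral>x. f x * g x \<partial>M\<bar> \<le> 1" "\<bar>(\<integral>x. f x \<partial>M) * (\<integral>x. g x \<partial>M)\<bar> \<le> 1"
      by (auto simp: prob_space abs_mult intro!: mult_le_one)
    then show ?thesis by linarith
  qed
  ultimately have "\<bar>?c\<bar> / 2 \<le> alpha k"
    unfolding alpha_def by (intro Min.boundedI) (auto simp: mult.commute)
  then show ?thesis by simp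
qed

text \<open>The real and the imaginary part are each a combination of two real covariances, hence 4
  times \<open>2 * alpha k\<close>.\<close>

lemma cov_complex_le_alpha:
  fixes f g :: "'a \<Rightarrow> complex"
  assumes m: "1 \<le> m"
    and f: "f \<in> borel_measurable (gen_sigma M Y {1..m})" and fb: "\<And>x. x \<in> space M \<Longrightarrow> cmod (f x) \<le> 1"
    and g: "g \<in> borel_measurable (gen_sigma M Y {k+m..})" and gb: "\<And>x. x \<in> space M \<Longrightarrow> cmod (g x) \<le> 1"
  shows "cmod ((\<integral>x. f x * g x \<partial>M) - (\<integral>x. f x \<partial>M) * (\<integral>x. g x \<partial>M)) \<le> 8 * alpha k"
proof -
  have fM [measurable]: "f \<in> borel_measurable M" using measurable_from_subalg[OF subalgebra_Y f] .
  have gM [measurable]: "g \<in> borel_measurable M" using measurable_from_subalg[OF subalgebra_Y g] .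
  have fi: "integrable M f" and gi: "integrable M g" and fgi: "integrable M (\<lambda>x. f x * g x)"
    using bounded_factors_integrable[OF fM gM] fb gb by auto
  have ii: "integrable M (\<lambda>x. u x * v x)" if "\<And>x. x \<in> space M \<Longrightarrow> \<bar>u x\<bar> \<le> 1" "\<And>x. x \<in> space M \<Longrightarrow> \<bar>v x\<bar> \<le> 1"
    "u \<in> borel_measurable M" "v \<in> borel_measurable M" for u v :: "'a \<Rightarrow> real"
    by (rule integrable_const_bound[of _ 1]) (use that in \<open>auto simp: abs_mult intro!: mult_le_one\<close>)
  have b: "\<bar>Re (f x)\<bar> \<le> 1" "\<bar>Im (f x)\<bar> \<le> 1" "\<bar>Re (g x)\<bar> \<le> 1" "\<bar>Im (g x)\<bar> \<le> 1" if "x \<in> space M" for x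
    using fb[OF that] gb[OF that] abs_Re_le_cmod abs_Im_le_cmod order_trans by blast+
  define c where "c u v = (\<integral>x. u x * v x \<partial>M) - (\<integral>x. u x \<partial>M) * (\<integral>x. v x \<partial>M)" for u v :: "'a \<Rightarrow> real"
  have c: "\<bar>c (\<lambda>x. Re (f x)) (\<lambda>x. Re (g x))\<bar> \<le> 2 * alpha k" "\<bar>c (\<lambda>x. Re (f x)) (\<lambda>x. Im (g x))\<bar> \<le> 2 * alpha k"
    "\<bar>c (\<lambda>x. Im (f x)) (\<lambda>x. Re (g x))\<bar> \<le> 2 * alpha k" "\<bar>c (\<lambda>x. Im (f x)) (\<lambda>x. Im (g x))\<bar> \<le> 2 * alpha k"
    unfolding c_def by (rule cov_le_alpha[OF m]; use f g b in measurable)+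
  let ?c = "(\<integral>x. f x * g x \<partial>M) - (\<integral>x. f x \<partial>M) * (\<integral>x. g x \<partial>M)"
  have "Re ?c = c (\<lambda>x. Re (f x)) (\<lambda>x. Re (g x)) - c (\<lambda>x. Im (f x)) (\<lambda>x. Im (g x))"
    unfolding c_def using fi gi fgi b by (simp add: ii flip: integral_Re integral_Im)
  moreover have "Im ?c = c (\<lambda>x. Re (f x)) (\<lambda>x. Im (g x)) + c (\<lambda>x. Im (f x)) (\<lambda>x. Re (g x))"
    unfolding c_def using fi gi fgi b by (simp add: ii flip: integral_Re integral_Im)
  ultimately show ?thesis using c cmod_le[of ?c] by linarith
qed

end

section \<open>Stationarity and second moments\<close>

lemma (in prob_space) integrable_mult_of_squares:
  fixes X Y :: "'a \<Rightarrow> real"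
  assumes [measurable]: "X \<in> borel_measurable M" "Y \<in> borel_measurable M"
    and "integrable M (\<lambda>x. (X x)\<^sup>2)" "integrable M (\<lambda>x. (Y x)\<^sup>2)"
  shows "integrable M (\<lambda>x. X x * Y x)"
proof (rule Bochner_Integration.integrable_bound[OF Bochner_Integration.integrable_add[OF assms(3,4)]])
  have "\<bar>x\<bar> * \<bar>y\<bar> \<le> x\<^sup>2 + y\<^sup>2" for x y :: real
  proof -
    have "2 * (\<bar>x\<bar> * \<bar>y\<bar>) \<le> x\<^sup>2 + y\<^sup>2" using sum_squares_bound[of "\<bar>x\<bar>" "\<bar>y\<bar>"] by (simp add: mult.assoc)
    moreover have "0 \<le> \<bar>x\<bar> * \<bar>y\<bar>" by simp
    ultimately show ?thesis by linarith
  qed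
  then show "AE x in M. norm (X x * Y x) \<le> norm ((X x)\<^sup>2 + (Y x)\<^sup>2)"
    by (auto simp: abs_mult)
qed simp

lemma (in prob_space) integrable_of_square:
  fixes X :: "'a \<Rightarrow> real"
  assumes "X \<in> borel_measurable M" "integrable M (\<lambda>x. (X x)\<^sup>2)"
  shows "integrable M X"
  using integrable_mult_of_squares[of X "\<lambda>_. 1"] assms by simp

lemma (in prob_space) expectation_abs_le_sqrt:
  fixes X :: "'a \<Rightarrow> real"
  assumes [measurable]: "X \<in> borel_measurable M" and i: "integrable M (\<lambda>x. (X x)\<^sup>2)"
  shows "(\<integral>x. \<bar>X x\<bar> \<partial>M) \<le> sqrt (\<integral>x. (X x)\<^sup>2 \<partial>M)"
proof (rule real_le_rsqrt)
  have iX: "integrable M (\<lambda>x. \<bar>X x\<bar>)" using integrable_of_square[OF _ i] by auto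
  have "0 \<le> (\<integral>x. (\<bar>X x\<bar> - (\<integral>x. \<bar>X x\<bar> \<partial>M))\<^sup>2 \<partial>M)" by simp
  also have "\<dots> = (\<integral>x. (X x)\<^sup>2 - 2 * (\<integral>x. \<bar>X x\<bar> \<partial>M) * \<bar>X x\<bar> + (\<integral>x. \<bar>X x\<bar> \<partial>M)\<^sup>2 \<partial>M)"
    by (intro Bochner_Integration.integral_cong refl) (simp add: power2_diff)
  also have "\<dots> = (\<integral>x. (X x)\<^sup>2 \<partial>M) - (\<integral>x. \<bar>X x\<bar> \<partial>M)\<^sup>2"
    using i iX by (simp add: prob_space power2_eq_square)
  finally show "(\<integral>x. \<bar>X x\<bar> \<partial>M)\<^sup>2 \<le> (\<integral>x. (X x)\<^sup>2 \<partial>M)" by simp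
qed

text \<open>With truncated subtraction on the naturals, \<open>(i - j) + (j - i)\<close> is the
  distance |i - j|. Each distance occurs at most once on either side of i, which gives the factor
  2.\<close>

lemma sum_distance_le_suminf:
  fixes c :: "nat \<Rightarrow> real"
  assumes c0: "\<And>k. 0 \<le> c k" and cs: "summable c" and I: "finite I"
  shows "(\<Sum>j\<in>I. c ((i - j) + (j - i))) \<le> 2 * suminf c"
proof -
  have "(\<Sum>j\<in>I. c ((i - j) + (j - i))) = (\<Sum>j\<in>(I \<inter> {..i}) \<union> (I \<inter> {i<..}). c ((i - j) + (j - i)))"
    by (rule sum.cong) auto
  also have "\<dots> = (\<Sum>j\<in>I \<inter> {..i}. c ((i - j) + (j - i))) + (\<Sum>j\<in>I \<inter> {i<..}. c ((i - j) + (j - i)))"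
    using I by (intro sum.union_disjoint) auto
  also have "\<dots> = (\<Sum>j\<in>I \<inter> {..i}. c (i - j)) + (\<Sum>j\<in>I \<inter> {i<..}. c (j - i))"
    by (intro arg_cong2[where f="(+)"] sum.cong) auto
  also have "(\<Sum>j\<in>I \<inter> {..i}. c (i - j)) = sum c ((\<lambda>j. i - j) ` (I \<inter> {..i}))"
    by (subst sum.reindex) (auto simp: inj_on_def)
  also have "\<dots> \<le> suminf c" using I by (intro sum_le_suminf cs) (auto simp: c0)
  also have "(\<Sum>j\<in>I \<inter> {i<..}. c (j - i)) = sum c ((\<lambda>j. j - i) ` (I \<inter> {i<..}))"
    by (subst sum.reindex) (auto simp: inj_on_def)
  also have "\<dots> \<le> suminf c" using I by (intro sum_le_suminf cs) (auto simp: c0)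
  finally show ?thesis by simp
qed

text \<open>A common envelope for the functions of \<open>Y\<close> that occur: the identity, the
  square and their truncations. Fixing the envelope makes all later moment and variance constants
  independent of \<open>g\<close>.\<close>

definition quad_bounded :: "(real \<Rightarrow> real) \<Rightarrow> bool" where
  "quad_bounded g \<longleftrightarrow> g \<in> borel_measurable borel \<and> (\<forall>y. \<bar>g y\<bar> \<le> 1 + y\<^sup>2)"

lemma quad_bounded_id: "quad_bounded (\<lambda>y. y)"
proof -
  have "\<bar>y\<bar> \<le> 1 + y\<^sup>2" for y :: real
    using sum_squares_bound[of "\<bar>y\<bar>" 1] by simp
  then show ?thesis unfolding quad_bounded_def by simp
qed

lemma quad_bounded_square: "quad_bounded (\<lambda>y. y\<^sup>2)"
  unfolding quad_bounded_def by simp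

section \<open>Consequences of stationarity and uniform moments\<close>

context stationary_mixing
begin

lemma measurable_window: "(\<lambda>x. \<lambda>i\<in>{..<n}. Y (Suc i + h) x) \<in> M \<rightarrow>\<^sub>M (PiM {..<n} (\<lambda>_. borel))"
  by (rule measurable_restrict) simp

lemma stationary_integral:
  fixes F :: "(nat \<Rightarrow> real) \<Rightarrow> 'c::{banach, second_countable_topology}"
  assumes F: "F \<in> borel_measurable (PiM {..<n} (\<lambda>_. borel))"
  shows "(\<integral>x. F (\<lambda>i\<in>{..<n}. Y (Suc i + h) x) \<partial>M) = (\<integral>x. F (\<lambda>i\<in>{..<n}. Y (Suc i) x) \<partial>M)"
    and "integrable M (\<lambda>x. F (\<lambda>i\<in>{..<n}. Y (Suc i + h) x)) \<longleftrightarrow> integrable M (\<lambda>x. F (\<lambda>i\<in>{..<n}. Y (Suc i) x))"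
proof -
  have d: "distr M (PiM {..<n} (\<lambda>_. borel)) (\<lambda>x. \<lambda>i\<in>{..<n}. Y (Suc i + h) x)
     = distr M (PiM {..<n} (\<lambda>_. borel)) (\<lambda>x. \<lambda>i\<in>{..<n}. Y (Suc i) x)"
    using stationary unfolding strictly_stationary_def by blast
  show "(\<integral>x. F (\<lambda>i\<in>{..<n}. Y (Suc i + h) x) \<partial>M) = (\<integral>x. F (\<lambda>i\<in>{..<n}. Y (Suc i) x) \<partial>M)"
    using integral_distr[OF measurable_window F, of h] integral_distr[OF measurable_window F, of 0] d by simp
  show "integrable M (\<lambda>x. F (\<lambda>i\<in>{..<n}. Y (Suc i + h) x)) \<longleftrightarrow> integrable M (\<lambda>x. F (\<lambda>i\<in>{..<n}. Y (Suc i) x))"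
    using integrable_distr_eq[OF measurable_window F, of h] integrable_distr_eq[OF measurable_window F, of 0] d by simp
qed

lemma stationary_pair:
  fixes f :: "real \<times> real \<Rightarrow> real"
  assumes [measurable]: "f \<in> borel_measurable (borel \<Otimes>\<^sub>M borel)" and ab: "1 \<le> a" "1 \<le> b"
  shows "(\<integral>x. f (Y (a + h) x, Y (b + h) x) \<partial>M) = (\<integral>x. f (Y a x, Y b x) \<partial>M)"
    and "integrable M (\<lambda>x. f (Y (a + h) x, Y (b + h) x)) \<longleftrightarrow> integrable M (\<lambda>x. f (Y a x, Y b x))"
proof -
  \<comment> \<open>Window coordinates start at 0 and the process at 1, so \<open>Y a\<close> sits
    in coordinate a - 1 of a window of length max a b.\<close>
  define n where "n = max a b"
  define F where "F x = f (x (a - 1), x (b - 1))" for x :: "nat \<Rightarrow> real"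
  have n: "a - 1 \<in> {..<n}" "b - 1 \<in> {..<n}" using ab unfolding n_def by auto
  have comp: "(\<lambda>x. x (a - 1)) \<in> borel_measurable (PiM {..<n} (\<lambda>_. borel :: real measure))"
    "(\<lambda>x. x (b - 1)) \<in> borel_measurable (PiM {..<n} (\<lambda>_. borel :: real measure))"
    using n by (auto intro: measurable_component_singleton)
  have F: "F \<in> borel_measurable (PiM {..<n} (\<lambda>_. borel))"
    unfolding F_def by (rule measurable_compose[OF measurable_Pair[OF comp] assms(1)])
  have e: "F (\<lambda>i\<in>{..<n}. Y (Suc i + h) x) = f (Y (a + h) x, Y (b + h) x)" for h x
    using n ab unfolding F_def by simp
  show "(\<integral>x. f (Y (a + h) x, Y (b + h) x) \<partial>M) = (\<integral>x. f (Y a x, Y b x) \<partial>M)"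
    using stationary_integral(1)[OF F, of h] e[of h] e[of 0] by simp
  show "integrable M (\<lambda>x. f (Y (a + h) x, Y (b + h) x)) \<longleftrightarrow> integrable M (\<lambda>x. f (Y a x, Y b x))"
    using stationary_integral(2)[OF F, of h] e[of h] e[of 0] by simp
qed

lemma stationary_single:
  fixes f :: "real \<Rightarrow> real"
  assumes [measurable]: "f \<in> borel_measurable borel" and i: "1 \<le> i"
  shows "(\<integral>x. f (Y i x) \<partial>M) = (\<integral>x. f (Y 1 x) \<partial>M)"
    and "integrable M (\<lambda>x. f (Y i x)) \<longleftrightarrow> integrable M (\<lambda>x. f (Y 1 x))"
  using stationary_pair[of "\<lambda>(x, y). f x" 1 1 "i - 1"] i by auto

lemma stationary_sum:
  fixes \<psi> :: "real \<Rightarrow> 'c::{banach, second_countable_topology}"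
  assumes [measurable]: "\<psi> \<in> borel_measurable borel" "g \<in> borel_measurable borel"
  shows "(\<integral>x. \<psi> (\<Sum>i\<in>{h+1..h+p}. g (Y i x)) \<partial>M) = (\<integral>x. \<psi> (\<Sum>i\<in>{1..p}. g (Y i x)) \<partial>M)"
proof -
  define F where "F x = \<psi> (\<Sum>i\<in>{..<p}. g (x i))" for x :: "nat \<Rightarrow> real"
  have "F \<in> borel_measurable (PiM {..<p} (\<lambda>_. borel))"
    unfolding F_def by measurable
  from stationary_integral(1)[OF this, of h]
  have "(\<integral>x. \<psi> (\<Sum>i\<in>{..<p}. g (Y (Suc i + h) x)) \<partial>M) = (\<integral>x. \<psi> (\<Sum>i\<in>{..<p}. g (Y (Suc i) x)) \<partial>M)"
    unfolding F_def by simp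
  moreover have "(\<Sum>i\<in>{..<p}. g (Y (Suc i + h) x)) = (\<Sum>i\<in>{h+1..h+p}. g (Y i x))" for h and x :: 'a
    by (rule sum.reindex_bij_witness[of _ "\<lambda>i. i - Suc h" "\<lambda>i. Suc i + h"]) auto
  from this[of h] this[of 0] have "(\<Sum>i\<in>{..<p}. g (Y (Suc i + h) x)) = (\<Sum>i\<in>{h+1..h+p}. g (Y i x))"
    "(\<Sum>i\<in>{..<p}. g (Y (Suc i) x)) = (\<Sum>i\<in>{1..p}. g (Y i x))" for x by auto
  ultimately show ?thesis by simp
qed

definition Qmom :: real where "Qmom = (\<integral>x. (1 + (Y 1 x)\<^sup>2) powr (2 + theta) \<partial>M)"

lemma integrable_envelope:
  assumes i: "1 \<le> i"
  shows "integrable M (\<lambda>x. (1 + (Y i x)\<^sup>2) powr (2 + theta))"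
    and "(\<integral>x. (1 + (Y i x)\<^sup>2) powr (2 + theta) \<partial>M) = Qmom"
proof -
  have "(1 + y\<^sup>2) powr (2 + theta) \<le> 2 powr (2 + theta) * (1 + \<bar>y\<bar> powr (4 + 2 * theta))" for y :: real
  proof (cases "\<bar>y\<bar> \<le> 1")
    case True
    then have "y\<^sup>2 \<le> 1" by (simp add: abs_square_le_1)
    then have "(1 + y\<^sup>2) powr (2 + theta) \<le> 2 powr (2 + theta)"
      using theta_pos by (intro powr_mono2) auto
    then show ?thesis by (simp add: algebra_simps add_increasing2)
  next
    case False
    then have y: "1 \<le> y\<^sup>2" by (metis abs_square_le_1 linear)
    then have "(1 + y\<^sup>2) powr (2 + theta) \<le> (2 * \<bar>y\<bar>\<^sup>2) powr (2 + theta)"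
      using theta_pos by (intro powr_mono2) auto
    also have "\<dots> = 2 powr (2 + theta) * (\<bar>y\<bar> powr 2) powr (2 + theta)"
      using False by (subst powr_mult) (auto simp: powr_numeral)
    also have "(\<bar>y\<bar> powr 2) powr (2 + theta) = \<bar>y\<bar> powr (4 + 2 * theta)"
      unfolding powr_powr by (simp add: algebra_simps)
    finally show ?thesis by (simp add: algebra_simps add_increasing)
  qed
  note envelope_le = this
  have "integrable M (\<lambda>x. 2 powr (2 + theta) * (1 + \<bar>Y 1 x\<bar> powr (4 + 2 * theta)))"
    using Y_moment by simp
  then have "integrable M (\<lambda>x. (1 + (Y 1 x)\<^sup>2) powr (2 + theta))"
    by (rule Bochner_Integration.integrable_bound) (use envelope_le in auto)
  then show "integrable M (\<lambda>x. (1 + (Y i x)\<^sup>2) powr (2 + theta))"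
    using stationary_single(2)[of "\<lambda>y. (1 + y\<^sup>2) powr (2 + theta)", OF _ i] by simp
  show "(\<integral>x. (1 + (Y i x)\<^sup>2) powr (2 + theta) \<partial>M) = Qmom"
    unfolding Qmom_def using stationary_single(1)[of "\<lambda>y. (1 + y\<^sup>2) powr (2 + theta)", OF _ i] by simp
qed

text \<open>The envelope \<open>1 + y^2\<close> is at least 1, so its power 2 + theta dominates its
  lower powers as well. Hence one constant bounds the moments of orders 1, 2 and 2 + theta for every
  \<open>g\<close> in the class.\<close>

lemma quad_bounded_moments:
  assumes g: "quad_bounded g" and i: "1 \<le> i"
  shows "(\<lambda>x. g (Y i x)) \<in> borel_measurable M"
    and "integrable M (\<lambda>x. g (Y i x))" and "(\<integral>x. \<bar>g (Y i x)\<bar> \<partial>M) \<le> Qmom"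
    and "integrable M (\<lambda>x. (g (Y i x))\<^sup>2)" and "(\<integral>x. (g (Y i x))\<^sup>2 \<partial>M) \<le> Qmom"
    and "integrable M (\<lambda>x. \<bar>g (Y i x)\<bar> powr (2 + theta))" and "(\<integral>x. \<bar>g (Y i x)\<bar> powr (2 + theta) \<partial>M) \<le> Qmom"
proof -
  have [measurable]: "g \<in> borel_measurable borel" and gb: "\<And>y. \<bar>g y\<bar> \<le> 1 + y\<^sup>2"
    using g unfolding quad_bounded_def by auto
  show gm [measurable]: "(\<lambda>x. g (Y i x)) \<in> borel_measurable M" by measurable
  note env = integrable_envelope[OF i]
  have 1: "\<bar>g y\<bar> \<le> (1 + y\<^sup>2) powr (2 + theta)" for y
  proof -
    have "\<bar>g y\<bar> \<le> (1 + y\<^sup>2) powr 1" using gb[of y] by (simp add: add_nonneg_nonneg)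
    also have "\<dots> \<le> (1 + y\<^sup>2) powr (2 + theta)" using theta_pos by (intro powr_mono) auto
    finally show ?thesis .
  qed
  have 2: "(g y)\<^sup>2 \<le> (1 + y\<^sup>2) powr (2 + theta)" for y
  proof -
    have "(g y)\<^sup>2 = \<bar>g y\<bar>\<^sup>2" by simp
    also have "\<dots> \<le> (1 + y\<^sup>2)\<^sup>2" by (intro power_mono gb) auto
    also have "\<dots> = (1 + y\<^sup>2) powr 2" by (simp add: powr_numeral add_pos_nonneg)
    also have "\<dots> \<le> (1 + y\<^sup>2) powr (2 + theta)" using theta_pos by (intro powr_mono) auto
    finally show ?thesis .
  qed
  have 3: "\<bar>g y\<bar> powr (2 + theta) \<le> (1 + y\<^sup>2) powr (2 + theta)" for y
    using gb[of y] theta_pos by (intro powr_mono2) auto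
  show i1: "integrable M (\<lambda>x. g (Y i x))"
    by (rule Bochner_Integration.integrable_bound[OF env(1)]) (use 1 in auto)
  show i2: "integrable M (\<lambda>x. (g (Y i x))\<^sup>2)"
    by (rule Bochner_Integration.integrable_bound[OF env(1)]) (use 2 in auto)
  show i3: "integrable M (\<lambda>x. \<bar>g (Y i x)\<bar> powr (2 + theta))"
    by (rule Bochner_Integration.integrable_bound[OF env(1)]) (use 3 in auto)
  show "(\<integral>x. \<bar>g (Y i x)\<bar> \<partial>M) \<le> Qmom" "(\<integral>x. (g (Y i x))\<^sup>2 \<partial>M) \<le> Qmom"
    "(\<integral>x. \<bar>g (Y i x)\<bar> powr (2 + theta) \<partial>M) \<le> Qmom"
    unfolding env(2)[symmetric] by (intro integral_mono integrable_abs i1 i2 i3 env(1) 1 2 3)+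
qed

section \<open>Autocovariances and variances of weighted sums\<close>

definition centred :: "(real \<Rightarrow> real) \<Rightarrow> nat \<Rightarrow> 'a \<Rightarrow> real" where
  "centred g i x = g (Y i x) - (\<integral>x. g (Y 1 x) \<partial>M)"

definition acov :: "(real \<Rightarrow> real) \<Rightarrow> nat \<Rightarrow> real" where
  "acov g k = (\<integral>x. centred g 1 x * centred g (Suc k) x \<partial>M)"

text \<open>The exponent is 1 - 2 / p for p = 2 + theta, as in the covariance inequality. At lag 0
  there is no gap to exploit, and the value 1 lets the variance obey the same bound.\<close>

definition mixrate :: "nat \<Rightarrow> real" where
  "mixrate k = (if k = 0 then 1 else alpha k powr (theta / (2 + theta)))"

text \<open>The constant of \<open>cov_le_truncation\<close> for \<open>Q = Qmom\<close>.\<close>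

definition Kcov :: real where "Kcov = 2 + 2 * Qmom + 2 * Qmom\<^sup>2"

lemma Qmom_nonneg: "0 \<le> Qmom" unfolding Qmom_def by simp

lemma Kcov_nonneg: "0 \<le> Kcov" unfolding Kcov_def using Qmom_nonneg by simp

lemma mixrate_nonneg: "0 \<le> mixrate k" unfolding mixrate_def by simp

lemma summable_mixrate: "summable mixrate"
proof -
  have "summable (\<lambda>k. mixrate (Suc k))"
  proof (rule summable_comparison_test'[OF summable_betaY])
    fix n
    show "norm (mixrate (Suc n)) \<le> betaY M Y (Suc n) powr (theta / (2 + theta))"
      unfolding mixrate_def using theta_pos alpha_nonneg[of "Suc n"] alpha_le_betaY[of "Suc n"]
      by (simp add: powr_mono2)
  qed
  then show ?thesis by (simp only: summable_Suc_iff)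
qed

lemma centred_props:
  assumes g: "quad_bounded g" and i: "1 \<le> i"
  shows centred_measurable: "centred g i \<in> borel_measurable M"
    and centred_integrable: "integrable M (centred g i)"
    and centred_mean: "(\<integral>x. centred g i x \<partial>M) = 0"
    and centred_square_integrable: "integrable M (\<lambda>x. (centred g i x)\<^sup>2)"
proof -
  note q = quad_bounded_moments[OF g i]
  have [measurable]: "g \<in> borel_measurable borel" using g unfolding quad_bounded_def by auto
  show [measurable]: "centred g i \<in> borel_measurable M" unfolding centred_def by measurable
  show "integrable M (centred g i)" unfolding centred_def using q by simp
  show "(\<integral>x. centred g i x \<partial>M) = 0" unfolding centred_def using q stationary_single(1)[of g, OF _ i]
    by (simp add: prob_space)
  show "integrable M (\<lambda>x. (centred g i x)\<^sup>2)"
    unfolding centred_def power2_diff using q by simp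
qed

lemma centred_mult_integrable:
  assumes "quad_bounded g" "1 \<le> i" "1 \<le> j"
  shows "integrable M (\<lambda>x. centred g i x * centred g j x)"
  by (intro integrable_mult_of_squares centred_props assms)

lemma centred_cov:
  assumes g: "quad_bounded g" and ij: "1 \<le> i" "1 \<le> j"
  shows "(\<integral>x. centred g i x * centred g j x \<partial>M) = acov g ((i - j) + (j - i))"
proof -
  have [measurable]: "g \<in> borel_measurable borel" using g unfolding quad_bounded_def by auto
  have *: "(\<integral>x. centred g i x * centred g j x \<partial>M) = acov g (j - i)" if "1 \<le> i" "i \<le> j" for i j
    unfolding acov_def centred_def
    using stationary_pair(1)[of "\<lambda>(x, y). (g x - (\<integral>x. g (Y 1 x) \<partial>M)) * (g y - (\<integral>x. g (Y 1 x) \<partial>M))" 1 "Suc (j - i)" "i - 1"] that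
    by simp
  show ?thesis
  proof (cases "i \<le> j")
    case True
    then show ?thesis using *[OF ij(1) True] by simp
  next
    case False
    then show ?thesis using *[of j i] ij by (simp add: mult.commute)
  qed
qed

lemma acov_0_nonneg: "0 \<le> acov g 0" unfolding acov_def by simp

lemma abs_acov_le_acov_0:
  assumes g: "quad_bounded g"
  shows "\<bar>acov g k\<bar> \<le> acov g 0"
proof -
  have s: "(\<integral>x. (centred g i x)\<^sup>2 \<partial>M) = acov g 0" if "1 \<le> i" for i
    using centred_cov[OF g that that] by (simp add: power2_eq_square)
  have "\<bar>acov g k\<bar> \<le> (\<integral>x. \<bar>centred g 1 x * centred g (Suc k) x\<bar> \<partial>M)"
    unfolding acov_def by (rule integral_abs_bound)
  also have "\<dots> \<le> (\<integral>x. ((centred g 1 x)\<^sup>2 + (centred g (Suc k) x)\<^sup>2) / 2 \<partial>M)"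
  proof (rule integral_mono)
    fix x
    show "\<bar>centred g 1 x * centred g (Suc k) x\<bar> \<le> ((centred g 1 x)\<^sup>2 + (centred g (Suc k) x)\<^sup>2) / 2"
      using sum_squares_bound[of "\<bar>centred g 1 x\<bar>" "\<bar>centred g (Suc k) x\<bar>"] by (simp add: abs_mult)
  qed (use centred_square_integrable[OF g] centred_mult_integrable[OF g] in auto)
  also have "\<dots> = acov g 0" using centred_square_integrable[OF g] s by simp
  finally show ?thesis .
qed

lemma acov_0_le_second_moment:
  assumes f: "quad_bounded f"
  shows "acov f 0 \<le> (\<integral>x. (f (Y 1 x))\<^sup>2 \<partial>M)"
proof -
  let ?m = "\<integral>x. f (Y 1 x) \<partial>M"
  note q = quad_bounded_moments[OF f order_refl]
  have "acov f 0 = (\<integral>x. (f (Y 1 x))\<^sup>2 - 2 * ?m * f (Y 1 x) + ?m\<^sup>2 \<partial>M)"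
    unfolding acov_def centred_def by (intro Bochner_Integration.integral_cong refl) (simp add: power2_eq_square algebra_simps)
  also have "\<dots> = (\<integral>x. (f (Y 1 x))\<^sup>2 \<partial>M) - ?m\<^sup>2"
    using q by (simp add: prob_space power2_eq_square)
  finally show ?thesis using zero_le_power2[of ?m] by linarith
qed

text \<open>The covariance inequality with p = 2 + theta; dividing the truncated variables by the
  level \<open>A\<close> makes \<open>cov_le_alpha\<close> applicable and produces the factor
  \<open>A^2\<close> that inequality expects. That the right-hand side does not depend on
  \<open>g\<close> is what later permits exchanging a limit of functions with the sum over
  lags.\<close>

lemma abs_acov_le_mixrate:
  assumes g: "quad_bounded g"
  shows "\<bar>acov g k\<bar> \<le> Kcov * mixrate k"
proof (cases "k = 0")
  case True
  have "acov g 0 \<le> Qmom"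
    using acov_0_le_second_moment[OF g] quad_bounded_moments(5)[OF g order_refl] by simp
  also have "\<dots> \<le> Kcov" unfolding Kcov_def using Qmom_nonneg by simp
  finally show ?thesis using True acov_0_nonneg[of g] by (simp add: mixrate_def)
next
  case False
  have gm [measurable]: "g \<in> borel_measurable borel" using g unfolding quad_bounded_def by auto
  let ?m = "\<integral>x. g (Y 1 x) \<partial>M"
  have k1: "1 \<le> Suc k" by simp
  note q = quad_bounded_moments[OF g order_refl] and r = quad_bounded_moments[OF g k1]
  have XY: "integrable M (\<lambda>x. g (Y 1 x) * g (Y (Suc k) x))"
    by (intro integrable_mult_of_squares q r)
  have e: "acov g k = (\<integral>x. g (Y 1 x) * g (Y (Suc k) x) \<partial>M) - ?m * (\<integral>x. g (Y (Suc k) x) \<partial>M)"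
  proof -
    have "acov g k = (\<integral>x. g (Y 1 x) * g (Y (Suc k) x) - ?m * g (Y 1 x) - ?m * g (Y (Suc k) x) + ?m * ?m \<partial>M)"
      unfolding acov_def centred_def by (intro Bochner_Integration.integral_cong refl) (simp add: algebra_simps)
    then show ?thesis using q r XY by (simp add: prob_space)
  qed
  have Ym: "Y i \<in> borel_measurable (gen_sigma M Y I)" if "i \<in> I" for i I
    by (rule measurable_gen_sigma[OF that])
  have "\<bar>acov g k\<bar> \<le> (2 + 2 * Qmom + 2 * Qmom\<^sup>2) * alpha k powr (1 - 2 / (2 + theta))"
    unfolding e
  proof (rule cov_le_truncation)
    fix A :: real assume A: "0 < A"
    define T where "T z = (if \<bar>z\<bar> \<le> A then z else 0)" for z :: real
    have [measurable]: "T \<in> borel_measurable borel" unfolding T_def by measurable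
    have Tb: "\<bar>T z / A\<bar> \<le> 1" for z unfolding T_def using A by auto
    \<comment> \<open>With m = 1 the past is {1..1} and the future starts at k + 1, so the gap is
      exactly the lag k.\<close>
    have m1: "(\<lambda>x. T (g (Y 1 x)) / A) \<in> borel_measurable (gen_sigma M Y {1..1})"
      by (rule measurable_compose[OF Ym]) auto
    have m2: "(\<lambda>x. T (g (Y (Suc k) x)) / A) \<in> borel_measurable (gen_sigma M Y {k+1..})"
      by (rule measurable_compose[OF Ym]) auto
    have "\<bar>(\<integral>x. T (g (Y 1 x)) / A * (T (g (Y (Suc k) x)) / A) \<partial>M)
       - (\<integral>x. T (g (Y 1 x)) / A \<partial>M) * (\<integral>x. T (g (Y (Suc k) x)) / A \<partial>M)\<bar> \<le> 2 * alpha k"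
      by (rule cov_le_alpha[OF order_refl m1 Tb m2 Tb])
    moreover have "(\<integral>x. T (g (Y 1 x)) / A * (T (g (Y (Suc k) x)) / A) \<partial>M)
        = (\<integral>x. T (g (Y 1 x)) * T (g (Y (Suc k) x)) \<partial>M) / A\<^sup>2"
      by (simp add: power2_eq_square)
    ultimately have "\<bar>((\<integral>x. T (g (Y 1 x)) * T (g (Y (Suc k) x)) \<partial>M)
       - (\<integral>x. T (g (Y 1 x)) \<partial>M) * (\<integral>x. T (g (Y (Suc k) x)) \<partial>M)) / A\<^sup>2\<bar> \<le> 2 * alpha k"
      by (simp add: power2_eq_square diff_divide_distrib)
    then have "\<bar>(\<integral>x. T (g (Y 1 x)) * T (g (Y (Suc k) x)) \<partial>M)
       - (\<integral>x. T (g (Y 1 x)) \<partial>M) * (\<integral>x. T (g (Y (Suc k) x)) \<partial>M)\<bar> \<le> 2 * alpha k * A\<^sup>2"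
      using A by (simp add: abs_divide divide_le_eq)
    then show "\<bar>(\<integral>x. (if \<bar>g (Y 1 x)\<bar> \<le> A then g (Y 1 x) else 0) * (if \<bar>g (Y (Suc k) x)\<bar> \<le> A then g (Y (Suc k) x) else 0) \<partial>M)
      - (\<integral>x. (if \<bar>g (Y 1 x)\<bar> \<le> A then g (Y 1 x) else 0) \<partial>M) * (\<integral>x. (if \<bar>g (Y (Suc k) x)\<bar> \<le> A then g (Y (Suc k) x) else 0) \<partial>M)\<bar>
      \<le> 2 * A\<^sup>2 * alpha k"
      unfolding T_def by (simp add: mult_ac)
  qed (use q r XY alpha_nonneg alpha_le_1 theta_pos in auto)
  moreover have "1 - 2 / (2 + theta) = theta / (2 + theta)" using theta_pos by (simp add: field_simps)
  ultimately show ?thesis using False unfolding Kcov_def mixrate_def by simp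
qed

lemma summable_abs_acov:
  assumes g: "quad_bounded g"
  shows "summable (\<lambda>k. \<bar>acov g k\<bar>)"
  by (rule summable_comparison_test'[OF summable_mult[OF summable_mixrate, of Kcov]])
     (use abs_acov_le_mixrate[OF g] in auto)

text \<open>A bound for the variance of a sum per summand. The factor 2 covers both directions of a
  lag and counts lag 0 twice.\<close>

definition varbound :: "(real \<Rightarrow> real) \<Rightarrow> real" where
  "varbound g = 2 * (\<Sum>k. \<bar>acov g k\<bar>)"

lemma varbound_nonneg: "0 \<le> varbound g" if "quad_bounded g"
  unfolding varbound_def using suminf_nonneg[OF summable_abs_acov[OF that]] by simp

text \<open>Every row of the covariance matrix has absolute sum at most \<open>varbound g\<close>,
  whatever the index set. Arbitrary finite \<open>I\<close> and weights are allowed because the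
  bound is applied to indices left over between blocks and to sums weighted by the drift.\<close>

lemma sum_centred_square:
  assumes g: "quad_bounded g" and I: "finite I" "\<And>i. i \<in> I \<Longrightarrow> 1 \<le> i" and c: "\<And>i. i \<in> I \<Longrightarrow> \<bar>c i\<bar> \<le> C"
  shows sum_centred_square_integrable: "integrable M (\<lambda>x. (\<Sum>i\<in>I. c i * centred g i x)\<^sup>2)"
    and sum_centred_square_le: "(\<integral>x. (\<Sum>i\<in>I. c i * centred g i x)\<^sup>2 \<partial>M) \<le> C\<^sup>2 * card I * varbound g"
proof -
  have e: "(\<Sum>i\<in>I. c i * centred g i x)\<^sup>2 = (\<Sum>i\<in>I. \<Sum>j\<in>I. (c i * c j) * (centred g i x * centred g j x))" for x
    by (simp add: power2_eq_square sum_product mult_ac)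
  note i = centred_mult_integrable[OF g I(2) I(2)]
  show "integrable M (\<lambda>x. (\<Sum>i\<in>I. c i * centred g i x)\<^sup>2)" unfolding e using i by simp
  have "(\<integral>x. (\<Sum>i\<in>I. c i * centred g i x)\<^sup>2 \<partial>M) = (\<Sum>i\<in>I. \<Sum>j\<in>I. (c i * c j) * acov g ((i - j) + (j - i)))"
    unfolding e using i centred_cov[OF g I(2) I(2)] by simp
  also have "\<dots> \<le> (\<Sum>i\<in>I. \<Sum>j\<in>I. C\<^sup>2 * \<bar>acov g ((i - j) + (j - i))\<bar>)"
  proof (intro sum_mono)
    fix i j assume ij: "i \<in> I" "j \<in> I"
    have "(c i * c j) * acov g ((i - j) + (j - i)) \<le> \<bar>c i\<bar> * \<bar>c j\<bar> * \<bar>acov g ((i - j) + (j - i))\<bar>"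
      by (metis abs_ge_self abs_mult)
    also have "\<dots> \<le> C * C * \<bar>acov g ((i - j) + (j - i))\<bar>"
      using c[OF ij(1)] c[OF ij(2)] by (intro mult_mono) auto
    finally show "(c i * c j) * acov g ((i - j) + (j - i)) \<le> C\<^sup>2 * \<bar>acov g ((i - j) + (j - i))\<bar>"
      by (simp add: power2_eq_square)
  qed
  also have "\<dots> = C\<^sup>2 * (\<Sum>i\<in>I. \<Sum>j\<in>I. \<bar>acov g ((i - j) + (j - i))\<bar>)" by (simp add: sum_distrib_left)
  also have "\<dots> \<le> C\<^sup>2 * (\<Sum>i\<in>I. varbound g)"
  proof (intro mult_left_mono sum_mono)
    fix i
    show "(\<Sum>j\<in>I. \<bar>acov g ((i - j) + (j - i))\<bar>) \<le> varbound g"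
      unfolding varbound_def
      using sum_distance_le_suminf[of "\<lambda>k. \<bar>acov g k\<bar>", OF _ summable_abs_acov[OF g] I(1)] by simp
  qed simp
  finally show "(\<integral>x. (\<Sum>i\<in>I. c i * centred g i x)\<^sup>2 \<partial>M) \<le> C\<^sup>2 * card I * varbound g" by simp
qed

end

section \<open>A central limit theorem under mixing\<close>

lemma cesaro_mean:
  fixes d :: "nat \<Rightarrow> real"
  assumes d: "d \<longlonglongrightarrow> L"
  shows "(\<lambda>n. (\<Sum>m<n. d m) / real n) \<longlonglongrightarrow> L"
proof (rule LIMSEQ_I)
  fix e :: real assume e: "0 < e"
  obtain M where M: "\<And>m. M \<le> m \<Longrightarrow> \<bar>d m - L\<bar> < e / 2"
    using LIMSEQ_D[OF d, of "e / 2"] e by auto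
  define C where "C = (\<Sum>m<M. \<bar>d m - L\<bar>)"
  have C0: "0 \<le> C" unfolding C_def by (intro sum_nonneg) auto
  obtain N where N: "C / (e / 2) < real N" using reals_Archimedean2 by blast
  have "norm ((\<Sum>m<n. d m) / real n - L) < e" if n: "max (Suc N) 1 \<le> n" for n
  proof -
    have npos: "0 < real n" using n by auto
    have "(\<Sum>m<n. d m) / real n - L = (\<Sum>m<n. d m - L) / real n"
      using npos by (simp add: sum_subtractf field_simps)
    then have "norm ((\<Sum>m<n. d m) / real n - L) \<le> (\<Sum>m<n. \<bar>d m - L\<bar>) / real n"
      using npos by (simp add: abs_divide divide_right_mono)
    also have "(\<Sum>m<n. \<bar>d m - L\<bar>) \<le> (\<Sum>m<n. (if m < M then \<bar>d m - L\<bar> else 0) + e / 2)"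
      using M e by (intro sum_mono) (auto simp: not_less intro: less_imp_le)
    also have "\<dots> = (\<Sum>m<n. (if m < M then \<bar>d m - L\<bar> else 0)) + real n * (e / 2)"
      by (simp add: sum.distrib)
    also have "(\<Sum>m<n. (if m < M then \<bar>d m - L\<bar> else 0)) \<le> C"
      unfolding C_def by (subst sum.If_cases) (auto intro!: sum_mono2)
    finally have "norm ((\<Sum>m<n. d m) / real n - L) \<le> (C + real n * (e / 2)) / real n"
      using npos by (simp add: divide_right_mono)
    also have "\<dots> = C / real n + e / 2" using npos by (simp add: field_simps)
    also have "C / real n < e / 2"
    proof -
      have "C < real N * (e / 2)" using N e by (simp add: field_simps)
      also have "\<dots> \<le> real n * (e / 2)" using n e by (intro mult_right_mono) auto
      finally show ?thesis using npos by (simp add: field_simps)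
    qed
    finally show ?thesis by simp
  qed
  then show "\<exists>no. \<forall>n\<ge>no. norm ((\<Sum>m<n. d m) / real n - L) < e" by blast
qed

text \<open>The Taylor remainder is bounded both by |x|^3 / 6 and by x^2. The cubic bound is taken
  when the part \<open>u\<close> dominates, the quadratic one when \<open>v\<close> does, so that
  \<open>v\<close> is required to have a second moment only.\<close>

lemma iexp_second_order_split:
  fixes u v :: real
  defines "x \<equiv> u + v"
  shows "cmod (iexp x - (1 + \<i> * x - x\<^sup>2 / 2)) \<le> 8 * \<bar>u\<bar> ^ 3 + 4 * v\<^sup>2"
proof -
  have s: "(\<Sum>k\<le>2. (\<i> * x) ^ k / fact k) = 1 + \<i> * x - x\<^sup>2 / 2"
  proof -
    have "(\<i> * complex_of_real x)\<^sup>2 = - (x\<^sup>2)" by (simp add: power_mult_distrib)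
    then show ?thesis by (simp add: atMost_Suc numeral_2_eq_2)
  qed
  have 1: "cmod (iexp x - (1 + \<i> * x - x\<^sup>2 / 2)) \<le> \<bar>x\<bar> ^ 3 / 6"
    using iexp_approx1[of x 2] unfolding s by (simp add: numeral_3_eq_3 fact_numeral)
  have 2: "cmod (iexp x - (1 + \<i> * x - x\<^sup>2 / 2)) \<le> x\<^sup>2"
    using iexp_approx2[of x 2] unfolding s by simp
  show ?thesis
  proof (cases "\<bar>v\<bar> \<le> \<bar>u\<bar>")
    case True
    then have "\<bar>x\<bar> \<le> 2 * \<bar>u\<bar>" unfolding x_def by linarith
    then have "\<bar>x\<bar> ^ 3 \<le> (2 * \<bar>u\<bar>) ^ 3" by (intro power_mono) auto
    then have "\<bar>x\<bar> ^ 3 \<le> 8 * \<bar>u\<bar> ^ 3" by (simp add: power_mult_distrib)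
    moreover have "0 \<le> \<bar>x\<bar> ^ 3" "0 \<le> 4 * v\<^sup>2" by auto
    ultimately show ?thesis using 1 by linarith
  next
    case False
    then have "\<bar>x\<bar> \<le> 2 * \<bar>v\<bar>" unfolding x_def by linarith
    then have "\<bar>x\<bar>\<^sup>2 \<le> (2 * \<bar>v\<bar>)\<^sup>2" by (intro power_mono) auto
    then have "x\<^sup>2 \<le> 4 * v\<^sup>2" by (simp add: power_mult_distrib)
    moreover have "0 \<le> 8 * \<bar>u\<bar> ^ 3" by auto
    ultimately show ?thesis using 2 by linarith
  qed
qed

lemma exp_minus_first_order:
  fixes u :: real
  assumes "0 \<le> u"
  shows "\<bar>exp (- u) - (1 - u)\<bar> \<le> u\<^sup>2"
proof -
  have "exp (- u) = 1 / exp u" by (simp add: exp_minus field_simps)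
  also have "\<dots> \<le> 1 / (1 + u)" using assms exp_ge_add_one_self[of u] by (intro divide_left_mono) auto
  also have "\<dots> \<le> 1 - u + u\<^sup>2"
  proof -
    have "1 \<le> (1 - u + u\<^sup>2) * (1 + u)" using assms by (simp add: algebra_simps power2_eq_square)
    then show ?thesis using assms by (simp add: divide_le_eq)
  qed
  finally show ?thesis using exp_ge_add_one_self[of "- u"] by auto
qed

section \<open>Variance growth, truncation and the expansion of one block\<close>

context stationary_mixing
begin

text \<open>The long-run variance of g(Y_i); for the square it is \<open>kappa_sq\<close>.\<close>

definition lrv :: "(real \<Rightarrow> real) \<Rightarrow> real" where
  "lrv g = acov g 0 + 2 * (\<Sum>k. acov g (Suc k))"

definition psum :: "(real \<Rightarrow> real) \<Rightarrow> nat \<Rightarrow> nat \<Rightarrow> 'a \<Rightarrow> real" where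
  "psum g h p x = (\<Sum>i\<in>{h+1..h+p}. centred g i x)"

lemma psum_measurable [measurable]: "quad_bounded g \<Longrightarrow> psum g h p \<in> borel_measurable M"
  unfolding psum_def by (intro borel_measurable_sum centred_measurable) auto

lemma psum_square:
  assumes g: "quad_bounded g"
  shows psum_square_integrable: "integrable M (\<lambda>x. (psum g h p x)\<^sup>2)"
    and psum_square_le: "(\<integral>x. (psum g h p x)\<^sup>2 \<partial>M) \<le> real p * varbound g"
  using sum_centred_square[OF g, of "{h+1..h+p}" "\<lambda>_. 1" 1] unfolding psum_def by auto

lemma psum_mean: "quad_bounded g \<Longrightarrow> (\<integral>x. psum g h p x \<partial>M) = 0"
  unfolding psum_def by (subst Bochner_Integration.integral_sum) (auto intro: centred_integrable simp: centred_mean)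

text \<open>The increment of the variance from p to p + 1 summands is a partial sum
  \<open>d p\<close> of the series for \<open>lrv g\<close>. The variance divided by p is therefore
  a Cesaro mean of a convergent sequence.\<close>

lemma variance_growth:
  assumes g: "quad_bounded g"
  shows "(\<lambda>p. (\<integral>x. (psum g 0 p x)\<^sup>2 \<partial>M) / real p) \<longlonglongrightarrow> lrv g"
proof -
  define d where "d m = acov g 0 + 2 * (\<Sum>k<m. acov g (Suc k))" for m
  have v: "(\<integral>x. (psum g 0 p x)\<^sup>2 \<partial>M) = (\<Sum>m<p. d m)" for p
  proof (induction p)
    case 0
    then show ?case by (simp add: psum_def)
  next
    case (Suc p)
    have i1: "integrable M (\<lambda>x. centred g i x * centred g (Suc p) x)" if "i \<in> {1..p}" for i
      using that by (intro centred_mult_integrable g) auto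
    have e: "(psum g 0 (Suc p) x)\<^sup>2 = (psum g 0 p x)\<^sup>2
        + 2 * (\<Sum>i\<in>{1..p}. centred g i x * centred g (Suc p) x) + centred g (Suc p) x * centred g (Suc p) x" for x
      unfolding psum_def by (simp add: power2_eq_square algebra_simps sum_distrib_left sum_distrib_right)
    have "(\<integral>x. (psum g 0 (Suc p) x)\<^sup>2 \<partial>M)
        = (\<integral>x. (psum g 0 p x)\<^sup>2 \<partial>M) + 2 * (\<Sum>i\<in>{1..p}. acov g (Suc p - i)) + acov g 0"
    proof -
      have "(\<integral>x. (\<Sum>i\<in>{1..p}. centred g i x * centred g (Suc p) x) \<partial>M) = (\<Sum>i\<in>{1..p}. acov g (Suc p - i))"
        using i1 by (subst Bochner_Integration.integral_sum) (auto intro!: sum.cong simp: centred_cov[OF g])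
      moreover have "(\<integral>x. centred g (Suc p) x * centred g (Suc p) x \<partial>M) = acov g 0"
        by (simp add: centred_cov[OF g])
      moreover have "integrable M (\<lambda>x. \<Sum>i\<in>{1..p}. centred g i x * centred g (Suc p) x)"
        using i1 by (intro Bochner_Integration.integrable_sum) auto
      moreover have "integrable M (\<lambda>x. centred g (Suc p) x * centred g (Suc p) x)"
        by (intro centred_mult_integrable g) auto
      ultimately show ?thesis unfolding e using psum_square_integrable[OF g, of 0 p] by simp
    qed
    also have "(\<Sum>i\<in>{1..p}. acov g (Suc p - i)) = (\<Sum>k<p. acov g (Suc k))"
      by (rule sum.reindex_bij_witness[of _ "\<lambda>k. p - k" "\<lambda>i. p - i"]) (auto simp: Suc_diff_le)
    finally show ?case using Suc by (simp add: d_def)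
  qed
  have "summable (\<lambda>k. acov g (Suc k))"
    using summable_rabs_cancel[OF summable_abs_acov[OF g]] by (simp only: summable_Suc_iff)
  then have "(\<lambda>m. \<Sum>k<m. acov g (Suc k)) \<longlonglongrightarrow> (\<Sum>k. acov g (Suc k))" by (rule summable_LIMSEQ)
  then have "d \<longlonglongrightarrow> lrv g" unfolding d_def lrv_def by (intro tendsto_intros)
  then show ?thesis unfolding v by (rule cesaro_mean)
qed

lemma lrv_nonneg: "quad_bounded g \<Longrightarrow> 0 \<le> lrv g"
  by (rule tendsto_lowerbound[OF variance_growth]) (auto intro!: always_eventually divide_nonneg_nonneg)

definition trunc :: "(real \<Rightarrow> real) \<Rightarrow> nat \<Rightarrow> real \<Rightarrow> real" where
  "trunc g N y = (if \<bar>g y\<bar> \<le> real N then g y else 0)"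

definition remainder :: "(real \<Rightarrow> real) \<Rightarrow> nat \<Rightarrow> real \<Rightarrow> real" where
  "remainder g N y = (if \<bar>g y\<bar> \<le> real N then 0 else g y)"

text \<open>Both parts keep the envelope, so all uniform constants apply to them for every
  N.\<close>

lemma quad_bounded_trunc: "quad_bounded g \<Longrightarrow> quad_bounded (trunc g N)"
  and quad_bounded_remainder: "quad_bounded g \<Longrightarrow> quad_bounded (remainder g N)"
  unfolding quad_bounded_def trunc_def remainder_def by auto

lemma centred_split:
  assumes g: "quad_bounded g"
  shows "centred g i x = centred (trunc g N) i x + centred (remainder g N) i x"
proof -
  have e: "g y = trunc g N y + remainder g N y" for y unfolding trunc_def remainder_def by auto
  have "(\<integral>x. g (Y 1 x) \<partial>M) = (\<integral>x. trunc g N (Y 1 x) + remainder g N (Y 1 x) \<partial>M)"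
    by (simp flip: e)
  also have "\<dots> = (\<integral>x. trunc g N (Y 1 x) \<partial>M) + (\<integral>x. remainder g N (Y 1 x) \<partial>M)"
    using quad_bounded_moments(2)[OF quad_bounded_trunc[OF g]] quad_bounded_moments(2)[OF quad_bounded_remainder[OF g]]
    by (intro Bochner_Integration.integral_add) auto
  finally show ?thesis unfolding centred_def using e[of "Y i x"] by linarith
qed

lemma psum_split:
  "quad_bounded g \<Longrightarrow> psum g h p x = psum (trunc g N) h p x + psum (remainder g N) h p x"
  unfolding psum_def by (subst centred_split[of g _ _ N]) (auto simp: sum.distrib)

lemma psum_trunc_le:
  assumes g: "quad_bounded g"
  shows "\<bar>psum (trunc g N) h p x\<bar> \<le> 2 * real N * real p"
proof -
  have b: "\<bar>trunc g N y\<bar> \<le> real N" for y unfolding trunc_def by auto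
  have "\<bar>\<integral>x. trunc g N (Y 1 x) \<partial>M\<bar> \<le> (\<integral>x. \<bar>trunc g N (Y 1 x)\<bar> \<partial>M)" by (rule integral_abs_bound)
  also have "\<dots> \<le> (\<integral>x. real N \<partial>M)"
    using quad_bounded_moments(2)[OF quad_bounded_trunc[OF g]] b by (intro integral_mono integrable_abs) auto
  finally have "\<bar>\<integral>x. trunc g N (Y 1 x) \<partial>M\<bar> \<le> real N" by (simp add: prob_space)
  then have "\<bar>centred (trunc g N) i x\<bar> \<le> 2 * real N" for i
    unfolding centred_def using b[of "Y i x"] by linarith
  then have "\<bar>psum (trunc g N) h p x\<bar> \<le> (\<Sum>i\<in>{h+1..h+p}. 2 * real N)"
    unfolding psum_def by (intro order_trans[OF sum_abs] sum_mono)
  then show ?thesis by (simp add: mult_ac)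
qed

text \<open>Each autocovariance of the tail is at most its variance, which vanishes by dominated
  convergence. The majorant \<open>Kcov * mixrate k\<close> is uniform in N and summable, so
  Tannery's theorem carries the limit through the sum over lags.\<close>

lemma varbound_remainder_tendsto:
  assumes g: "quad_bounded g"
  shows "(\<lambda>N. varbound (remainder g N)) \<longlonglongrightarrow> 0"
proof -
  have [measurable]: "g \<in> borel_measurable borel" using g unfolding quad_bounded_def by auto
  note rq = quad_bounded_remainder[OF g]
  have [measurable]: "remainder g N \<in> borel_measurable borel" for N using rq unfolding quad_bounded_def by auto
  have l0: "(\<lambda>N. \<integral>x. (remainder g N (Y 1 x))\<^sup>2 \<partial>M) \<longlonglongrightarrow> (\<integral>x. 0 \<partial>M)"
  proof (rule integral_dominated_convergence[where w="\<lambda>x. (g (Y 1 x))\<^sup>2"])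
    show "integrable M (\<lambda>x. (g (Y 1 x))\<^sup>2)" using quad_bounded_moments(4)[OF g] by simp
    show "AE x in M. (\<lambda>N. (remainder g N (Y 1 x))\<^sup>2) \<longlonglongrightarrow> 0"
    proof (rule AE_I2, rule tendsto_eventually)
      fix x
      obtain N0 where "\<bar>g (Y 1 x)\<bar> \<le> real N0" using real_arch_simple by blast
      then show "\<forall>\<^sub>F N in sequentially. (remainder g N (Y 1 x))\<^sup>2 = 0"
        unfolding remainder_def by (intro eventually_mono[OF eventually_ge_at_top[of N0]]) auto
    qed
  qed (auto simp: remainder_def)
  have a0: "(\<lambda>N. acov (remainder g N) 0) \<longlonglongrightarrow> 0"
  proof (rule tendsto_sandwich[OF _ _ tendsto_const])
    show "\<forall>\<^sub>F N in sequentially. 0 \<le> acov (remainder g N) 0" using acov_0_nonneg by simp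
    show "\<forall>\<^sub>F N in sequentially. acov (remainder g N) 0 \<le> (\<integral>x. (remainder g N (Y 1 x))\<^sup>2 \<partial>M)"
      using acov_0_le_second_moment[OF rq] by simp
    show "(\<lambda>N. \<integral>x. (remainder g N (Y 1 x))\<^sup>2 \<partial>M) \<longlonglongrightarrow> 0" using l0 by simp
  qed
  have ak: "(\<lambda>N. \<bar>acov (remainder g N) k\<bar>) \<longlonglongrightarrow> 0" for k
    by (rule tendsto_sandwich[OF _ _ tendsto_const a0]) (use abs_acov_le_acov_0[OF rq] in auto)
  have "(\<lambda>N. \<Sum>k. \<bar>acov (remainder g N) k\<bar>) \<longlonglongrightarrow> (\<Sum>k. 0)"
  proof -
    have "\<forall>\<^sub>F (k, N) in sequentially \<times>\<^sub>F sequentially. norm \<bar>acov (remainder g N) k\<bar> \<le> Kcov * mixrate k"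
      by (rule always_eventually) (use abs_acov_le_mixrate[OF rq] in auto)
    from tannerys_theorem[OF ak this summable_mult[OF summable_mixrate]] show ?thesis by simp
  qed
  then show ?thesis unfolding varbound_def by (auto intro: tendsto_eq_intros)
qed

text \<open>A variance bound per summand that serves all functions in \<open>quad_bounded\<close> at
  once.\<close>

definition Gam :: real where "Gam = 2 * (Kcov * suminf mixrate)"

lemma Gam_nonneg: "0 \<le> Gam"
  unfolding Gam_def using Kcov_nonneg suminf_nonneg[OF summable_mixrate mixrate_nonneg] by simp

lemma varbound_le_Gam:
  assumes g: "quad_bounded g"
  shows "varbound g \<le> Gam"
  unfolding varbound_def Gam_def
  using suminf_le[OF abs_acov_le_mixrate[OF g] summable_abs_acov[OF g] summable_mult[OF summable_mixrate, of Kcov]]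
    suminf_mult[OF summable_mixrate, of Kcov] by simp

text \<open>Takes the place of a Lindeberg condition. The truncated sum satisfies |U| <= 2 N p,
  hence |U|^3 <= 2 N p U^2, so its cubic error is paid for by second moments; the tail sum enters
  through its variance. With tau of order 1 / sqrt n and p small against sqrt n, the cubic error
  summed over about n / p blocks vanishes for fixed N, and the tail error vanishes as N
  grows.\<close>

lemma block_char_expansion:
  assumes g: "quad_bounded g"
  shows "cmod ((\<integral>x. iexp (\<tau> * psum g 0 p x) \<partial>M) - (1 - \<tau>\<^sup>2 * (\<integral>x. (psum g 0 p x)\<^sup>2 \<partial>M) / 2))
    \<le> 16 * \<bar>\<tau>\<bar> ^ 3 * real N * (real p)\<^sup>2 * Gam + 4 * \<tau>\<^sup>2 * real p * varbound (remainder g N)"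
proof -
  let ?S = "psum g 0 p" and ?U = "psum (trunc g N) 0 p" and ?V = "psum (remainder g N) 0 p"
  let ?Q = "\<lambda>x. 1 + \<i> * complex_of_real (\<tau> * ?S x) - complex_of_real ((\<tau> * ?S x)\<^sup>2) / 2"
  note tq = quad_bounded_trunc[OF g, of N] and rq = quad_bounded_remainder[OF g, of N]
  note [measurable] = psum_measurable[OF g] psum_measurable[OF tq] psum_measurable[OF rq]
  have ie: "complex_integrable M (\<lambda>x. iexp (\<tau> * ?S x))"
    by (rule integrable_const_bound[of _ 1]) auto
  have iS: "integrable M ?S" by (rule integrable_of_square) (auto intro: psum_square_integrable g)
  have iq: "complex_integrable M (?Q)"
    using iS psum_square_integrable[OF g, of 0 p]
    by (intro Bochner_Integration.integrable_diff Bochner_Integration.integrable_add integrable_divide integrable_mult_right integrable_of_real)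
       (auto simp: power_mult_distrib)
  have q: "(\<integral>x. ?Q x \<partial>M)
     = 1 - \<tau>\<^sup>2 * (\<integral>x. (?S x)\<^sup>2 \<partial>M) / 2"
  proof -
    have i1: "complex_integrable M (\<lambda>x. \<i> * complex_of_real (\<tau> * ?S x))"
      using iS by (intro integrable_mult_right integrable_of_real) auto
    have i2: "complex_integrable M (\<lambda>x. complex_of_real ((\<tau> * ?S x)\<^sup>2) / 2)"
      using psum_square_integrable[OF g, of 0 p] by (intro integrable_divide integrable_of_real) (auto simp: power_mult_distrib)
    have e1: "(\<integral>x. \<i> * complex_of_real (\<tau> * ?S x) \<partial>M) = 0"
      using psum_mean[OF g, of 0 p] by (simp only: integral_mult_right_zero integral_complex_of_real of_real_0 mult_zero_right)
    have e2: "(\<integral>x. complex_of_real ((\<tau> * ?S x)\<^sup>2) / 2 \<partial>M) = complex_of_real (\<tau>\<^sup>2 * (\<integral>x. (?S x)\<^sup>2 \<partial>M) / 2)"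
      by (simp only: integral_divide_zero integral_complex_of_real power_mult_distrib integral_mult_right_zero) simp
    have "(\<integral>x. ?Q x \<partial>M)
      = (\<integral>x. 1 \<partial>M) + 0 - complex_of_real (\<tau>\<^sup>2 * (\<integral>x. (?S x)\<^sup>2 \<partial>M) / 2)"
      unfolding e1[symmetric] e2[symmetric] using i1 i2
      by (subst Bochner_Integration.integral_diff, simp, simp, subst Bochner_Integration.integral_add, simp_all)
    then show ?thesis by (simp add: prob_space)
  qed
  have iU: "integrable M (\<lambda>x. (?U x)\<^sup>2)" and iV: "integrable M (\<lambda>x. (?V x)\<^sup>2)"
    by (intro psum_square_integrable tq rq)+
  have pw: "cmod (iexp (\<tau> * ?S x) - ?Q x)
      \<le> 16 * \<bar>\<tau>\<bar> ^ 3 * real N * real p * (?U x)\<^sup>2 + 4 * \<tau>\<^sup>2 * (?V x)\<^sup>2" for x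
  proof -
    have "\<tau> * ?S x = \<tau> * ?U x + \<tau> * ?V x" using psum_split[OF g, of 0 p x N] by (simp add: algebra_simps)
    then have "cmod (iexp (\<tau> * ?S x) - ?Q x)
        \<le> 8 * \<bar>\<tau> * ?U x\<bar> ^ 3 + 4 * (\<tau> * ?V x)\<^sup>2"
      using iexp_second_order_split[of "\<tau> * ?U x" "\<tau> * ?V x"] by simp
    also have "8 * \<bar>\<tau> * ?U x\<bar> ^ 3 = 8 * \<bar>\<tau>\<bar> ^ 3 * (\<bar>?U x\<bar> * (?U x)\<^sup>2)"
    proof -
      have "\<bar>x\<bar> ^ 3 = \<bar>x\<bar> * \<bar>x\<bar>\<^sup>2" for x :: real by (simp only: power_Suc numeral_3_eq_3 numeral_2_eq_2)
      then have "\<bar>?U x\<bar> ^ 3 = \<bar>?U x\<bar> * (?U x)\<^sup>2" by (simp only: power2_abs)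
      then show ?thesis by (simp add: abs_mult power_mult_distrib)
    qed
    also have "\<dots> \<le> 8 * \<bar>\<tau>\<bar> ^ 3 * (2 * real N * real p * (?U x)\<^sup>2)"
      using psum_trunc_le[OF g, of N 0 p x] by (intro mult_left_mono mult_right_mono) auto
    finally show ?thesis by (simp add: power_mult_distrib mult_ac)
  qed
  have "cmod ((\<integral>x. iexp (\<tau> * ?S x) \<partial>M) - (1 - \<tau>\<^sup>2 * (\<integral>x. (?S x)\<^sup>2 \<partial>M) / 2))
     = cmod (\<integral>x. iexp (\<tau> * ?S x) - ?Q x \<partial>M)"
    unfolding Bochner_Integration.integral_diff[OF ie iq] q by simp
  also have "\<dots> \<le> (\<integral>x. cmod (iexp (\<tau> * ?S x) - ?Q x) \<partial>M)"
    by (rule integral_norm_bound)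
  also have "\<dots> \<le> (\<integral>x. 16 * \<bar>\<tau>\<bar> ^ 3 * real N * real p * (?U x)\<^sup>2 + 4 * \<tau>\<^sup>2 * (?V x)\<^sup>2 \<partial>M)"
    using iU iV by (intro integral_mono pw integrable_norm Bochner_Integration.integrable_diff ie iq) auto
  also have "\<dots> = 16 * \<bar>\<tau>\<bar> ^ 3 * real N * real p * (\<integral>x. (?U x)\<^sup>2 \<partial>M) + 4 * \<tau>\<^sup>2 * (\<integral>x. (?V x)\<^sup>2 \<partial>M)"
    using iU iV by simp
  also have "\<dots> \<le> 16 * \<bar>\<tau>\<bar> ^ 3 * real N * real p * (real p * Gam) + 4 * \<tau>\<^sup>2 * (real p * varbound (remainder g N))"
    using psum_square_le[OF tq, of 0 p] psum_square_le[OF rq, of 0 p] mult_left_mono[OF varbound_le_Gam[OF tq], of "real p"]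
    by (intro add_mono mult_left_mono) auto
  finally show ?thesis by (simp add: power2_eq_square mult_ac)
qed

text \<open>Induction peeling off the last block: the gap of length q costs one covariance bound
  \<open>8 * alpha q\<close>, and the error inherited from the earlier blocks is multiplied by a
  number of modulus at most 1.\<close>

lemma block_product_decoupling:
  assumes g: "quad_bounded g"
  shows "cmod ((\<integral>x. (\<Prod>j<k. iexp (\<tau> * psum g (j * (p + q)) p x)) \<partial>M) - (\<integral>x. iexp (\<tau> * psum g 0 p x) \<partial>M) ^ k)
    \<le> real k * (8 * alpha q)"
proof (induction k)
  case 0
  then show ?case by (simp add: prob_space)
next
  case (Suc k)
  have gm [measurable]: "g \<in> borel_measurable borel" using g unfolding quad_bounded_def by auto
  define e where "e j x = iexp (\<tau> * psum g (j * (p + q)) p x)" for j x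
  have em [measurable]: "e j \<in> borel_measurable (gen_sigma M Y I)" if "{j * (p + q) + 1..j * (p + q) + p} \<subseteq> I" for j I
  proof -
    have "(\<lambda>x. g (Y i x)) \<in> borel_measurable (gen_sigma M Y I)" if "i \<in> {j * (p + q) + 1..j * (p + q) + p}" for i
      by (rule measurable_compose[OF measurable_gen_sigma gm]) (use that \<open>_ \<subseteq> I\<close> in blast)
    then have "psum g (j * (p + q)) p \<in> borel_measurable (gen_sigma M Y I)"
      unfolding psum_def centred_def by (intro borel_measurable_sum borel_measurable_diff) auto
    then show ?thesis unfolding e_def by measurable
  qed
  have en: "cmod (e j x) \<le> 1" for j x unfolding e_def by simp
  have pn: "cmod (\<Prod>j<k. e j x) \<le> 1" for x
    unfolding prod_norm[symmetric] by (intro prod_le_1) (auto simp: en)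
  let ?z = "\<integral>x. iexp (\<tau> * psum g 0 p x) \<partial>M"
  have z: "cmod ?z \<le> 1"
  proof -
    have "cmod ?z \<le> (\<integral>x. cmod (iexp (\<tau> * psum g 0 p x)) \<partial>M)" by (rule integral_norm_bound)
    then show ?thesis by (simp add: prob_space)
  qed
  have ek: "(\<integral>x. e k x \<partial>M) = ?z"
    unfolding e_def psum_def centred_def
    using stationary_sum[of "\<lambda>s. iexp (\<tau> * s)" "\<lambda>y. g y - (\<integral>x. g (Y 1 x) \<partial>M)" "k * (p + q)" p] by simp
  have step: "cmod ((\<integral>x. (\<Prod>j<k. e j x) * e k x \<partial>M) - (\<integral>x. (\<Prod>j<k. e j x) \<partial>M) * (\<integral>x. e k x \<partial>M)) \<le> 8 * alpha q"
  \<comment> \<open>In these cases the past has no indices, whereas the covariance bound is stated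
    for a past {1..m} with m >= 1; one factor is constant and the covariance is 0.\<close>
  proof (cases "k = 0 \<or> p = 0")
    case True
    then show ?thesis
    proof
      assume "k = 0" then show ?thesis using alpha_nonneg[of q] by (simp add: prob_space)
    next
      assume "p = 0" then show ?thesis using alpha_nonneg[of q] by (simp add: prob_space e_def psum_def)
    qed
  next
    case False
    \<comment> \<open>The last index of the preceding block. The next block starts at k (p + q) + 1
      = m + q + 1, inside the future {q + m..}.\<close>
    define m where "m = (k - 1) * (p + q) + p"
    have km: "k * (p + q) = m + q" using False unfolding m_def by (cases k) auto
    have m1: "1 \<le> m" using False unfolding m_def by auto
    show ?thesis
    proof (rule cov_complex_le_alpha[OF m1 _ pn _ en])
      have "{j * (p + q) + 1..j * (p + q) + p} \<subseteq> {1..m}" if "j < k" for j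
      proof -
        have "j * (p + q) \<le> (k - 1) * (p + q)" using that by (intro mult_right_mono) auto
        then show ?thesis unfolding m_def by auto
      qed
      then show "(\<lambda>x. \<Prod>j<k. e j x) \<in> borel_measurable (gen_sigma M Y {1..m})"
        by (intro borel_measurable_prod em) auto
      show "e k \<in> borel_measurable (gen_sigma M Y {q + m..})"
        by (rule em) (use km in auto)
    qed
  qed
  have "(\<integral>x. (\<Prod>j<Suc k. e j x) \<partial>M) - ?z ^ Suc k
     = ((\<integral>x. (\<Prod>j<k. e j x) * e k x \<partial>M) - (\<integral>x. (\<Prod>j<k. e j x) \<partial>M) * (\<integral>x. e k x \<partial>M))
       + ((\<integral>x. (\<Prod>j<k. e j x) \<partial>M) - ?z ^ k) * ?z"
    unfolding ek by (simp add: algebra_simps)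
  also have "cmod \<dots> \<le> 8 * alpha q + real k * (8 * alpha q) * 1"
  proof (rule order_trans[OF norm_triangle_ineq add_mono[OF step]])
    show "cmod (((\<integral>x. (\<Prod>j<k. e j x) \<partial>M) - ?z ^ k) * ?z) \<le> real k * (8 * alpha q) * 1"
      unfolding norm_mult using Suc z alpha_nonneg[of q] unfolding e_def[symmetric]
      by (intro mult_mono) auto
  qed
  finally show ?case unfolding e_def[symmetric] by (simp add: algebra_simps)
qed

end

lemma cmod_iexp_diff_le: "cmod (iexp a - iexp b) \<le> \<bar>a - b\<bar>"
proof -
  have "iexp a - iexp b = iexp b * (iexp (a - b) - 1)"
    by (simp add: algebra_simps flip: exp_add)
  then have "cmod (iexp a - iexp b) = cmod (iexp (a - b) - 1)" by (simp add: norm_mult)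
  also have "\<dots> \<le> \<bar>a - b\<bar>" using iexp_approx1[of "a - b" 0] by simp
  finally show ?thesis .
qed

section \<open>Decay of the mixing rate, Bernstein blocks and the central limit theorem\<close>

context stationary_mixing
begin

text \<open>For a decreasing sequence, q times the q-th term of the powered series is at most its
  partial sum, hence at most the full sum. Solving for \<open>alpha q\<close> inverts the exponent
  theta / (2 + theta).\<close>

lemma alpha_le_powr: "1 \<le> q \<Longrightarrow> alpha q \<le> (suminf mixrate / real q) powr ((2 + theta) / theta)"
proof -
  assume q: "1 \<le> q"
  define r where "r = theta / (2 + theta)"
  have r: "0 < r" unfolding r_def using theta_pos by simp
  have "real q * alpha q powr r = (\<Sum>k\<in>{1..q}. alpha q powr r)" by simp
  also have "\<dots> \<le> (\<Sum>k\<in>{1..q}. mixrate k)"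
    using r alpha_nonneg by (intro sum_mono) (auto simp: mixrate_def r_def[symmetric] intro!: powr_mono2 alpha_antimono)
  also have "\<dots> \<le> suminf mixrate" by (intro sum_le_suminf summable_mixrate) (auto simp: mixrate_nonneg)
  finally have "alpha q powr r \<le> suminf mixrate / real q" using q by (simp add: field_simps)
  then have "(alpha q powr r) powr (1 / r) \<le> (suminf mixrate / real q) powr (1 / r)"
    using r by (intro powr_mono2) auto
  moreover have "(alpha q powr r) powr (1 / r) = alpha q"
    using r alpha_nonneg[of q] by (simp add: powr_powr)
  moreover have "1 / r = (2 + theta) / theta" unfolding r_def by simp
  ultimately show ?thesis by simp
qed

lemma alpha_tendsto: "alpha \<longlonglongrightarrow> 0"
proof (rule tendsto_sandwich[OF _ _ tendsto_const])
  have "0 < (2 + theta) / theta" using theta_pos by simp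
  then show "(\<lambda>q. (suminf mixrate / real q) powr ((2 + theta) / theta)) \<longlonglongrightarrow> 0"
  proof -
    define c where "c = (2 + theta) / theta"
    define S where "S = suminf mixrate"
    have "(\<lambda>q. S / real q) \<longlonglongrightarrow> 0" by real_asymp
    then have "(\<lambda>q. (S / real q) powr c) \<longlonglongrightarrow> 0 powr c"
      using theta_pos suminf_nonneg[OF summable_mixrate mixrate_nonneg]
      by (intro tendsto_powr2) (auto simp: c_def S_def)
    then show ?thesis by (simp add: c_def S_def)
  qed
qed (use alpha_nonneg alpha_le_powr in \<open>auto intro: eventually_mono[OF eventually_ge_at_top[of 1]]\<close>)

text \<open>Summability of alpha ^ (theta / (2 + theta)) makes alpha decay faster than 1 / q by a power,
  which leaves room to take the big blocks of size below sqrt n.\<close>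

lemma bernstein_block_sizes:
  obtains p q :: "nat \<Rightarrow> nat"
  where "filterlim p at_top sequentially"
    and "(\<lambda>n. real (q n) / real (p n)) \<longlonglongrightarrow> 0"
    and "(\<lambda>n. real (p n) / sqrt (real n)) \<longlonglongrightarrow> 0"
    and "(\<lambda>n. real n / real (p n) * alpha (q n)) \<longlonglongrightarrow> 0"
proof -
  define c where "c = (2 + theta) / theta"
  have c1: "1 < c" unfolding c_def using theta_pos by (simp add: field_simps)
  \<comment> \<open>With gaps n^x and big blocks n^y, x = 1/2 - 2e and y = 1/2 - e, the decoupling
    error vanishes if 1 - y < x c, that is, if e (1 + 2c) < (c - 1) / 2. The choice makes the left
    side half of the right side.\<close>
  define e where "e = (c - 1) / (4 * (1 + 2 * c))"
  have e: "0 < e" "e < 1 / 8" using c1 unfolding e_def by (auto simp: field_simps)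
  have e2: "1 / 2 + e < (1 / 2 - 2 * e) * c"
  proof -
    have "e * (1 + 2 * c) = (c - 1) / 4" using c1 unfolding e_def by (simp add: field_simps)
    then show ?thesis using c1 by (simp add: algebra_simps)
  qed
  define x where "x = 1 / 2 - 2 * e"
  define y where "y = 1 / 2 - e"
  have xy: "0 < x" "x < y" "y < 1 / 2" "1 - y - x * c < 0" "0 < c"
    using e e2 c1 unfolding x_def y_def by auto
  define p where "p n = nat \<lfloor>real n powr y\<rfloor>" for n
  define q where "q n = nat \<lfloor>real n powr x\<rfloor>" for n
  define S where "S = suminf mixrate"
  have S: "0 \<le> S" unfolding S_def by (rule suminf_nonneg[OF summable_mixrate mixrate_nonneg])
  show ?thesis
  proof (rule that[of p q])
    show "filterlim p at_top sequentially" unfolding p_def using xy by real_asymp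
    show "(\<lambda>n. real (q n) / real (p n)) \<longlonglongrightarrow> 0" unfolding p_def q_def using xy by real_asymp
    show "(\<lambda>n. real (p n) / sqrt (real n)) \<longlonglongrightarrow> 0" unfolding p_def using xy by real_asymp
    have "(\<lambda>n. real n / real (p n) * real (q n) powr (- c)) \<longlonglongrightarrow> 0"
      unfolding p_def q_def using xy by real_asymp
    then have l: "(\<lambda>n. (real n / real (p n) * real (q n) powr (- c)) * S powr c) \<longlonglongrightarrow> 0"
      by (rule tendsto_mult_left_zero)
    have q1: "eventually (\<lambda>n. 1 \<le> q n) sequentially"
    proof -
      have "filterlim q at_top sequentially" unfolding q_def using xy by real_asymp
      then show ?thesis unfolding filterlim_at_top by blast
    qed
    show "(\<lambda>n. real n / real (p n) * alpha (q n)) \<longlonglongrightarrow> 0"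
    proof (rule tendsto_sandwich[OF _ _ tendsto_const l])
      show "\<forall>\<^sub>F n in sequentially. 0 \<le> real n / real (p n) * alpha (q n)"
        by (intro always_eventually allI mult_nonneg_nonneg alpha_nonneg) auto
      show "\<forall>\<^sub>F n in sequentially. real n / real (p n) * alpha (q n) \<le> real n / real (p n) * real (q n) powr (- c) * S powr c"
        using q1
      proof eventually_elim
        case (elim n)
        have "alpha (q n) \<le> (S / real (q n)) powr c" using alpha_le_powr[OF elim] by (simp add: S_def c_def)
        also have "\<dots> = real (q n) powr (- c) * S powr c"
          using S by (simp add: powr_minus divide_inverse powr_mult inverse_powr mult.commute)
        finally have "real n / real (p n) * alpha (q n) \<le> real n / real (p n) * (real (q n) powr (- c) * S powr c)"
          by (intro mult_left_mono) auto
        then show ?case by (simp add: mult.assoc)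
      qed
    qed
  qed
qed

text \<open>Dropping the indices outside the big blocks costs the expected absolute value of their
  sum, since the exponential is Lipschitz; this is bounded through its variance. What remains is a
  product over blocks and is decoupled. The dropped set consists of the gaps and the end piece, so
  it is not an interval.\<close>

lemma char_block_approx:
  assumes g: "quad_bounded g" and kn: "k * (p + q) \<le> n"
  shows "cmod ((\<integral>x. iexp (\<tau> * psum g 0 n x) \<partial>M) - (\<integral>x. iexp (\<tau> * psum g 0 p x) \<partial>M) ^ k)
    \<le> \<bar>\<tau>\<bar> * sqrt ((real n - real k * real p) * Gam) + real k * (8 * alpha q)"
proof -
  define B where "B j = {j * (p + q) + 1..j * (p + q) + p}" for j
  define R where "R = {1..n} - (\<Union>j<k. B j)"
  have Bfin: "finite (B j)" for j unfolding B_def by simp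
  have Bsub: "B j \<subseteq> {1..n}" if "j < k" for j
  proof -
    have "Suc j * (p + q) \<le> k * (p + q)" using that by (intro mult_right_mono) auto
    then show ?thesis using kn unfolding B_def by auto
  qed
  have Bdisj: "B i \<inter> B j = {}" if "i \<noteq> j" for i j
  proof -
    have "B i \<inter> B j = {}" if "i < j" for i j
    proof -
      have "Suc i * (p + q) \<le> j * (p + q)" using that by (intro mult_right_mono) auto
      then show ?thesis unfolding B_def by auto
    qed
    then show ?thesis using that by (metis Int_commute linorder_neqE_nat)
  qed
  have Bsum: "(\<Sum>i\<in>(\<Union>j<k. B j). f i) = (\<Sum>j<k. \<Sum>i\<in>B j. f i)" for f :: "nat \<Rightarrow> 'b::comm_monoid_add"
    using Bfin Bdisj by (intro sum.UNION_disjoint) auto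
  have Usub: "(\<Union>j<k. B j) \<subseteq> {1..n}" using Bsub by auto
  have cardR: "real (card R) = real n - real k * real p"
  proof -
    have "card (\<Union>j<k. B j) = (\<Sum>j<k. p)" using Bsum[of "\<lambda>_. 1::nat"] by (simp add: B_def)
    moreover have "card R = n - card (\<Union>j<k. B j)" "card (\<Union>j<k. B j) \<le> n"
      using Usub finite_subset[OF Usub] card_mono[OF _ Usub] unfolding R_def by (auto simp: card_Diff_subset)
    ultimately show ?thesis by (simp add: of_nat_diff)
  qed
  have split: "psum g 0 n x = (\<Sum>j<k. psum g (j * (p + q)) p x) + (\<Sum>i\<in>R. 1 * centred g i x)" for x
  proof -
    have "psum g 0 n x = (\<Sum>i\<in>R. centred g i x) + (\<Sum>i\<in>(\<Union>j<k. B j). centred g i x)"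
      unfolding psum_def R_def using sum.subset_diff[OF Usub, of "\<lambda>i. centred g i x"] by simp
    then show ?thesis unfolding Bsum by (simp add: psum_def B_def)
  qed
  define W where "W x = (\<Sum>i\<in>R. 1 * centred g i x)" for x
  have R1: "finite R" "\<And>i. i \<in> R \<Longrightarrow> 1 \<le> i" unfolding R_def by auto
  have Wm [measurable]: "W \<in> borel_measurable M"
    unfolding W_def using R1 by (intro borel_measurable_sum borel_measurable_times centred_measurable g) auto
  have W2: "integrable M (\<lambda>x. (W x)\<^sup>2)" "(\<integral>x. (W x)\<^sup>2 \<partial>M) \<le> real (card R) * Gam"
    using sum_centred_square[OF g R1, of "\<lambda>_. 1" 1] mult_left_mono[OF varbound_le_Gam[OF g], of "real (card R)"]
    unfolding W_def by auto
  have W1: "integrable M W" by (rule integrable_of_square[OF Wm W2(1)])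
  have "(\<integral>x. \<bar>W x\<bar> \<partial>M) \<le> sqrt (\<integral>x. (W x)\<^sup>2 \<partial>M)" by (rule expectation_abs_le_sqrt[OF Wm W2(1)])
  also have "\<dots> \<le> sqrt ((real n - real k * real p) * Gam)" using W2(2) cardR by simp
  finally have Wabs: "(\<integral>x. \<bar>W x\<bar> \<partial>M) \<le> sqrt ((real n - real k * real p) * Gam)" .
  let ?P = "\<lambda>x. \<Prod>j<k. iexp (\<tau> * psum g (j * (p + q)) p x)"
  have Peq: "?P x = iexp (\<tau> * (\<Sum>j<k. psum g (j * (p + q)) p x))" for x
    by (simp add: exp_sum sum_distrib_left)
  note [measurable] = psum_measurable[OF g]
  have i1: "complex_integrable M (\<lambda>x. iexp (\<tau> * psum g 0 n x))" by (rule integrable_const_bound[of _ 1]) auto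
  have i2: "complex_integrable M ?P"
    unfolding Peq by (rule integrable_const_bound[of _ 1]) auto
  have "cmod ((\<integral>x. iexp (\<tau> * psum g 0 n x) \<partial>M) - (\<integral>x. ?P x \<partial>M))
      = cmod (\<integral>x. iexp (\<tau> * psum g 0 n x) - ?P x \<partial>M)"
    using i1 i2 by simp
  also have "\<dots> \<le> (\<integral>x. cmod (iexp (\<tau> * psum g 0 n x) - ?P x) \<partial>M)" by (rule integral_norm_bound)
  also have "\<dots> \<le> (\<integral>x. \<bar>\<tau>\<bar> * \<bar>W x\<bar> \<partial>M)"
  proof (rule integral_mono)
    fix x
    show "cmod (iexp (\<tau> * psum g 0 n x) - ?P x) \<le> \<bar>\<tau>\<bar> * \<bar>W x\<bar>"
      unfolding Peq by (rule order_trans[OF cmod_iexp_diff_le]) (simp add: split W_def algebra_simps flip: abs_mult)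
  qed (use i1 i2 W1 in auto)
  also have "\<dots> \<le> \<bar>\<tau>\<bar> * sqrt ((real n - real k * real p) * Gam)"
    using Wabs by (simp add: mult_left_mono)
  finally have 1: "cmod ((\<integral>x. iexp (\<tau> * psum g 0 n x) \<partial>M) - (\<integral>x. ?P x \<partial>M)) \<le> \<bar>\<tau>\<bar> * sqrt ((real n - real k * real p) * Gam)" .
  show ?thesis
    by (rule order_trans[OF norm_triangle_sub[of _ "(\<integral>x. ?P x \<partial>M) - (\<integral>x. iexp (\<tau> * psum g 0 p x) \<partial>M) ^ k"]])
       (use 1 block_product_decoupling[OF g, where k=k and p=p and q=q and \<tau>=\<tau>] in simp)
qed

text \<open>Here \<open>x\<close> is the share of indices lying in big blocks. In order, the terms
  account for the dropped indices, the decoupling, the cubic Taylor error, the truncation tail, the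
  deviation of the block variance from its limit, the linearisation of the exponential, and
  \<open>x\<close> differing from 1.\<close>

definition char_error :: "(real \<Rightarrow> real) \<Rightarrow> real \<Rightarrow> nat \<Rightarrow> nat \<Rightarrow> nat \<Rightarrow> nat \<Rightarrow> nat \<Rightarrow> real" where
  "char_error g t N k p q n = (let L = lrv g; x = real k * real p / real n in
    \<bar>t\<bar> * sqrt ((1 - x) * Gam) + 8 * (real k * alpha q)
      + (16 * \<bar>t\<bar> ^ 3 * real N * Gam * (real p / sqrt (real n)) + 4 * t\<^sup>2 * varbound (remainder g N)
         + t\<^sup>2 / 2 * \<bar>(\<integral>x. (psum g 0 p x)\<^sup>2 \<partial>M) / real p - L\<bar> + (t\<^sup>2 * L / 2)\<^sup>2 * (real p / real n))
      + \<bar>exp (- (t\<^sup>2 * L / 2 * x)) - exp (- (t\<^sup>2 * L / 2))\<bar>)"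

text \<open>The characteristic function \<open>z\<close> of one block is compared with the Gaussian
  factor \<open>w\<close> of one block, and the two are then raised to the power k.\<close>

lemma char_bound:
  assumes g: "quad_bounded g" and kn: "k * (p + q) \<le> n" and p: "1 \<le> p" and n: "0 < n"
  shows "cmod ((\<integral>x. iexp (t / sqrt (real n) * psum g 0 n x) \<partial>M) - exp (- (t\<^sup>2 * lrv g / 2))) \<le> char_error g t N k p q n"
proof -
  define L where "L = lrv g"
  define x where "x = real k * real p / real n"
  define \<tau> where "\<tau> = t / sqrt (real n)"
  define z where "z = (\<integral>x. iexp (\<tau> * psum g 0 p x) \<partial>M)"
  define v where "v = (\<integral>x. (psum g 0 p x)\<^sup>2 \<partial>M)"
  \<comment> \<open>The part of the limiting exponent carried by one block: k times \<open>u\<close>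
    is the full exponent times \<open>x\<close>.\<close>
  define u where "u = \<tau>\<^sup>2 * real p * L / 2"
  define w where "w = exp (- u)"
  let ?E = "16 * \<bar>t\<bar> ^ 3 * real N * Gam * (real p / sqrt (real n)) + 4 * t\<^sup>2 * varbound (remainder g N)
         + t\<^sup>2 / 2 * \<bar>v / real p - L\<bar> + (t\<^sup>2 * L / 2)\<^sup>2 * (real p / real n)"
  let ?Z = "16 * \<bar>\<tau>\<bar> ^ 3 * real N * (real p)\<^sup>2 * Gam + 4 * \<tau>\<^sup>2 * real p * varbound (remainder g N)
      + \<tau>\<^sup>2 / 2 * \<bar>v - real p * L\<bar> + u\<^sup>2"
  have L0: "0 \<le> L" unfolding L_def by (rule lrv_nonneg[OF g])
  have u0: "0 \<le> u" unfolding u_def using L0 by simp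
  have npos: "0 < real n" using n by simp
  have kpn: "real k * real p \<le> real n"
  proof -
    have "k * p \<le> n" using kn by (simp add: algebra_simps)
    then show ?thesis by (metis of_nat_le_iff of_nat_mult)
  qed
  have x: "0 \<le> x" "x \<le> 1" unfolding x_def using kpn npos by auto
  have t2: "\<tau>\<^sup>2 = t\<^sup>2 / real n" unfolding \<tau>_def by (simp add: power_divide)
  have t3: "\<bar>\<tau>\<bar> ^ 3 = \<bar>t\<bar> ^ 3 / (real n * sqrt (real n))"
    unfolding \<tau>_def by (simp add: power_divide abs_divide power3_eq_cube)
  have b1: "cmod ((\<integral>x. iexp (\<tau> * psum g 0 n x) \<partial>M) - z ^ k) \<le> \<bar>t\<bar> * sqrt ((1 - x) * Gam) + 8 * (real k * alpha q)"
  proof -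
    have "\<bar>\<tau>\<bar> * sqrt ((real n - real k * real p) * Gam) = \<bar>t\<bar> * sqrt ((real n - real k * real p) / real n * Gam)"
      unfolding \<tau>_def by (simp add: abs_divide real_sqrt_divide real_sqrt_mult)
    also have "(real n - real k * real p) / real n = 1 - x" using npos by (simp add: x_def diff_divide_distrib)
    finally show ?thesis using char_block_approx[OF g kn, of \<tau>] by (simp add: z_def)
  qed
  have zn: "cmod z \<le> 1"
  proof -
    have "cmod z \<le> (\<integral>x. cmod (iexp (\<tau> * psum g 0 p x)) \<partial>M)" unfolding z_def by (rule integral_norm_bound)
    then show ?thesis by (simp add: prob_space)
  qed
  have wn: "cmod (complex_of_real w) \<le> 1" unfolding w_def using u0 by simp
  have zw: "cmod (z - w) \<le> ?Z"
  proof -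
    have "z - w = (z - (1 - \<tau>\<^sup>2 * v / 2)) + complex_of_real ((real p * L - v) * \<tau>\<^sup>2 / 2) + complex_of_real ((1 - u) - w)"
      unfolding u_def by (simp add: algebra_simps diff_divide_distrib)
    also have "cmod \<dots> \<le> cmod (z - (1 - \<tau>\<^sup>2 * v / 2)) + cmod (complex_of_real ((real p * L - v) * \<tau>\<^sup>2 / 2)) + cmod (complex_of_real ((1 - u) - w))"
      by (intro order_trans[OF norm_triangle_ineq] add_mono norm_triangle_ineq order_refl)
    also have "cmod (complex_of_real ((real p * L - v) * \<tau>\<^sup>2 / 2)) = \<tau>\<^sup>2 / 2 * \<bar>v - real p * L\<bar>"
      unfolding norm_of_real by (simp add: abs_mult abs_minus_commute)
    also have "cmod (complex_of_real ((1 - u) - w)) \<le> u\<^sup>2"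
      unfolding norm_of_real w_def using exp_minus_first_order[OF u0] by (simp add: abs_minus_commute)
    also have "cmod (z - (1 - \<tau>\<^sup>2 * v / 2)) \<le> 16 * \<bar>\<tau>\<bar> ^ 3 * real N * (real p)\<^sup>2 * Gam + 4 * \<tau>\<^sup>2 * real p * varbound (remainder g N)"
      unfolding z_def v_def by (rule block_char_expansion[OF g])
    finally show ?thesis by simp
  qed
  \<comment> \<open>Inside the unit disc, k-th powers differ by at most k times the difference of
    the bases; the factor k p / n = x <= 1 absorbs this k.\<close>
  have "cmod (z ^ k - complex_of_real w ^ k) \<le> real k * cmod (z - w)" by (rule norm_power_diff[OF zn wn])
  also have "\<dots> \<le> real k * ?Z" by (intro mult_left_mono zw) auto
  also have "\<dots> = x * ?E"
  proof -
    have "\<bar>v - real p * L\<bar> = real p * \<bar>v / real p - L\<bar>"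
    proof -
      have "v - real p * L = real p * (v / real p - L)" using p by (simp add: field_simps)
      then show ?thesis by (simp add: abs_mult)
    qed
    then show ?thesis
      unfolding u_def t2 t3 x_def by (simp add: power2_eq_square algebra_simps add_divide_distrib)
  qed
  also have "\<dots> \<le> 1 * ?E"
    using x Gam_nonneg varbound_nonneg[OF quad_bounded_remainder[OF g, of N]]
    by (intro mult_right_mono add_nonneg_nonneg mult_nonneg_nonneg) auto
  finally have b2: "cmod (z ^ k - complex_of_real w ^ k) \<le> ?E" by simp
  have b3: "complex_of_real w ^ k = complex_of_real (exp (- (t\<^sup>2 * L / 2 * x)))"
  proof -
    have "w ^ k = exp (real k * (- u))" unfolding w_def by (rule exp_of_nat_mult[symmetric])
    also have "real k * (- u) = - (t\<^sup>2 * L / 2 * x)" unfolding u_def t2 x_def by (simp add: mult_ac)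
    finally show ?thesis by (metis of_real_power)
  qed
  have b4: "cmod (complex_of_real w ^ k - exp (- (t\<^sup>2 * L / 2))) \<le> \<bar>exp (- (t\<^sup>2 * L / 2 * x)) - exp (- (t\<^sup>2 * L / 2))\<bar>"
    unfolding b3 of_real_diff[symmetric] norm_of_real by simp
  have "(\<integral>x. iexp (\<tau> * psum g 0 n x) \<partial>M) - complex_of_real (exp (- (t\<^sup>2 * L / 2)))
     = ((\<integral>x. iexp (\<tau> * psum g 0 n x) \<partial>M) - z ^ k) + (z ^ k - complex_of_real w ^ k) + (complex_of_real w ^ k - complex_of_real (exp (- (t\<^sup>2 * L / 2))))"
    by simp
  also have "cmod \<dots> \<le> cmod ((\<integral>x. iexp (\<tau> * psum g 0 n x) \<partial>M) - z ^ k) + cmod (z ^ k - complex_of_real w ^ k) + cmod (complex_of_real w ^ k - complex_of_real (exp (- (t\<^sup>2 * L / 2))))"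
    by (intro order_trans[OF norm_triangle_ineq] add_mono norm_triangle_ineq order_refl)
  finally show ?thesis using b1 b2 b4 unfolding char_error_def Let_def L_def[symmetric] x_def[symmetric] v_def \<tau>_def[symmetric] by linarith
qed

text \<open>For fixed N every term of \<open>char_error\<close> but the truncation tail tends to 0
  along Bernstein block sizes. The level N is therefore fixed first, making the tail smaller than
  the tolerance, and n is taken large afterwards.\<close>

theorem mixing_clt:
  assumes g: "quad_bounded g"
  shows "(\<lambda>n. \<integral>x. iexp (t / sqrt (real n) * psum g 0 n x) \<partial>M) \<longlonglongrightarrow> complex_of_real (exp (- (t\<^sup>2 * lrv g / 2)))"
proof -
  obtain p q where p_inf: "filterlim p at_top sequentially"
    and qp: "(\<lambda>n. real (q n) / real (p n)) \<longlonglongrightarrow> 0"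
    and pn: "(\<lambda>n. real (p n) / sqrt (real n)) \<longlonglongrightarrow> 0"
    and na: "(\<lambda>n. real n / real (p n) * alpha (q n)) \<longlonglongrightarrow> 0"
    by (rule bernstein_block_sizes)
  define k where "k n = n div (p n + q n)" for n
  define x where "x n = real (k n) * real (p n) / real n" for n
  have p1: "eventually (\<lambda>n. 1 \<le> p n) sequentially" using p_inf unfolding filterlim_at_top by blast
  have pn': "(\<lambda>n. real (p n) / real n) \<longlonglongrightarrow> 0"
  proof (rule tendsto_sandwich[OF _ _ tendsto_const pn])
    show "\<forall>\<^sub>F n in sequentially. real (p n) / real n \<le> real (p n) / sqrt (real n)"
      using eventually_ge_at_top[of 1]
    proof eventually_elim
      case (elim n)
      have "sqrt (real n) * 1 \<le> sqrt (real n) * sqrt (real n)" using elim by (intro mult_left_mono) auto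
      then show ?case using elim by (intro divide_left_mono) auto
    qed
  qed auto
  have kn: "k n * (p n + q n) \<le> n" for n unfolding k_def by (rule div_times_less_eq_dividend)
  have kp: "real (k n) * real (p n) \<le> real n" for n
  proof -
    have "k n * p n \<le> n" using kn[of n] by (simp add: algebra_simps)
    then show ?thesis by (metis of_nat_le_iff of_nat_mult)
  qed
  have x1: "x \<longlonglongrightarrow> 1"
  proof (rule tendsto_sandwich[OF _ _ _ tendsto_const])
    \<comment> \<open>The lower bound for \<open>x n\<close> comes from k + 1 > n / (p + q): the
      gaps cost a ratio q / p and the incomplete last block a share p / n.\<close>
    have "(\<lambda>n. 1 / (1 + real (q n) / real (p n)) - real (p n) / real n) \<longlonglongrightarrow> 1 / (1 + 0) - 0"
      by (intro tendsto_intros qp pn') auto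
    then show "(\<lambda>n. 1 / (1 + real (q n) / real (p n)) - real (p n) / real n) \<longlonglongrightarrow> 1" by simp
    show "\<forall>\<^sub>F n in sequentially. x n \<le> 1"
      unfolding x_def using kp by (auto simp: divide_le_eq_1 intro!: always_eventually)
    show "\<forall>\<^sub>F n in sequentially. 1 / (1 + real (q n) / real (p n)) - real (p n) / real n \<le> x n"
      using p1 eventually_gt_at_top[of 0]
    proof eventually_elim
      case (elim n)
      have s: "0 < real (p n) + real (q n)" using elim by simp
      have "n < (k n + 1) * (p n + q n)"
        unfolding k_def using elim by (metis add.commute dividend_less_times_div mult.commute add_gr_0 less_le_trans zero_less_one Suc_eq_plus1 mult_Suc)
      then have "real n < (real (k n) + 1) * (real (p n) + real (q n))"
        by (metis of_nat_less_iff of_nat_mult of_nat_add of_nat_1)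
      then have "real n / (real (p n) + real (q n)) - 1 \<le> real (k n)" using s by (simp add: field_simps)
      then have "(real n / (real (p n) + real (q n)) - 1) * (real (p n) / real n) \<le> real (k n) * (real (p n) / real n)"
        by (intro mult_right_mono) auto
      moreover have "(real n / (real (p n) + real (q n)) - 1) * (real (p n) / real n) = 1 / (1 + real (q n) / real (p n)) - real (p n) / real n"
        using elim s by (simp add: field_simps)
      ultimately show ?case unfolding x_def by simp
    qed
  qed
  have ka: "(\<lambda>n. real (k n) * alpha (q n)) \<longlonglongrightarrow> 0"
  proof (rule tendsto_sandwich[OF _ _ tendsto_const na])
    show "\<forall>\<^sub>F n in sequentially. 0 \<le> real (k n) * alpha (q n)"
      by (intro always_eventually allI mult_nonneg_nonneg alpha_nonneg) auto
    show "\<forall>\<^sub>F n in sequentially. real (k n) * alpha (q n) \<le> real n / real (p n) * alpha (q n)"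
      using p1
    proof eventually_elim
      case (elim n)
      then have "real (k n) \<le> real n / real (p n)" using kp[of n] by (simp add: field_simps)
      then show ?case by (intro mult_right_mono alpha_nonneg)
    qed
  qed
  have vp: "(\<lambda>n. \<bar>(\<integral>x. (psum g 0 (p n) x)\<^sup>2 \<partial>M) / real (p n) - lrv g\<bar>) \<longlonglongrightarrow> 0"
    using filterlim_compose[OF variance_growth[OF g] p_inf] by (intro tendsto_rabs_zero) (simp add: LIM_zero)
  have T: "(\<lambda>n. char_error g t N (k n) (p n) (q n) n) \<longlonglongrightarrow> 4 * t\<^sup>2 * varbound (remainder g N)" for N
  proof -
    have "(\<lambda>n. char_error g t N (k n) (p n) (q n) n) \<longlonglongrightarrow> \<bar>t\<bar> * sqrt ((1 - 1) * Gam) + 8 * 0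
      + (16 * \<bar>t\<bar> ^ 3 * real N * Gam * 0 + 4 * t\<^sup>2 * varbound (remainder g N) + t\<^sup>2 / 2 * 0 + (t\<^sup>2 * lrv g / 2)\<^sup>2 * 0)
      + \<bar>exp (- (t\<^sup>2 * lrv g / 2 * 1)) - exp (- (t\<^sup>2 * lrv g / 2))\<bar>"
      unfolding char_error_def Let_def x_def[symmetric] by (intro tendsto_intros x1 ka pn pn' vp)
    then show ?thesis by simp
  qed
  show ?thesis
  proof (rule tendstoI)
    fix e :: real assume e: "0 < e"
    have "(\<lambda>N. 4 * t\<^sup>2 * varbound (remainder g N)) \<longlonglongrightarrow> 4 * t\<^sup>2 * 0"
      by (intro tendsto_intros varbound_remainder_tendsto g)
    then have "eventually (\<lambda>N. 4 * t\<^sup>2 * varbound (remainder g N) < e) sequentially"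
      using e by (intro order_tendstoD(2)[of _ 0]) auto
    then obtain N where N: "4 * t\<^sup>2 * varbound (remainder g N) < e" unfolding eventually_sequentially by blast
    note order_tendstoD(2)[OF T N]
    then show "\<forall>\<^sub>F n in sequentially. dist (\<integral>x. iexp (t / sqrt (real n) * psum g 0 n x) \<partial>M) (complex_of_real (exp (- (t\<^sup>2 * lrv g / 2)))) < e"
      using p1 eventually_gt_at_top[of 0]
    proof eventually_elim
      case (elim n)
      then show ?case
        using char_bound[OF g kn[of n] elim(2,3), of t N] unfolding dist_norm by linarith
    qed
  qed
qed

end

section \<open>Convergence of the mean absolute difference\<close>

lemma emp_char_measurable [measurable]:
  assumes [measurable]: "f \<in> borel_measurable N" "\<And>j. W j \<in> borel_measurable N"
  shows "(\<lambda>x. emp_char b (\<lambda>j. W j x) (f x)) \<in> borel_measurable N"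
  unfolding emp_char_def by measurable

lemma cmod_square_diff_le:
  fixes z :: complex and c :: real
  assumes "cmod z \<le> 1" "0 \<le> c" "c \<le> 1"
  shows "\<bar>(cmod z)\<^sup>2 - c\<^sup>2\<bar> \<le> 2 * cmod (z - c)"
proof -
  have "\<bar>cmod z - c\<bar> \<le> cmod (z - c)" using norm_triangle_ineq3[of z "complex_of_real c"] assms by simp
  moreover have "(cmod z)\<^sup>2 - c\<^sup>2 = (cmod z - c) * (cmod z + c)" by (simp add: power2_eq_square algebra_simps)
  then have "\<bar>(cmod z)\<^sup>2 - c\<^sup>2\<bar> = \<bar>cmod z - c\<bar> * (cmod z + c)" using assms by (simp add: abs_mult)
  ultimately show ?thesis
    using mult_mono[of "\<bar>cmod z - c\<bar>" "cmod (z - c)" "cmod z + c" 2] assms by (simp add: mult.commute)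
qed

context prob_space
begin

text \<open>Three bounds with three tasks: the first makes the integral against
  \<open>1 / t^2\<close> converge at 0, the second at infinity, and the third gives pointwise
  convergence. The first uses that \<open>1 - cos\<close> is at most half a square, so uniform
  second moments of the \<open>W j\<close> suffice.\<close>

lemma emp_char_deviation_le:
  fixes W :: "nat \<Rightarrow> 'a \<Rightarrow> real"
  assumes [measurable]: "\<And>j. W j \<in> borel_measurable M" and b: "0 < b"
    and w: "\<And>j. j \<in> {1..b} \<Longrightarrow> integrable M (\<lambda>x. (W j x)\<^sup>2)" "\<And>j. j \<in> {1..b} \<Longrightarrow> (\<integral>x. (W j x)\<^sup>2 \<partial>M) \<le> w"
  defines "D t \<equiv> \<integral>x. \<bar>(cmod (emp_char b (\<lambda>j. W j x) t))\<^sup>2 - exp (- t\<^sup>2)\<bar> \<partial>M"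
  shows "\<bar>D t\<bar> \<le> (1 + 2 * w) * t\<^sup>2" and "\<bar>D t\<bar> \<le> 1"
    and "\<bar>D t\<bar> \<le> 2 * (\<integral>x. cmod (emp_char b (\<lambda>j. W j x) t - exp (- t\<^sup>2 / 2)) \<partial>M)"
proof -
  let ?F = "\<lambda>x. emp_char b (\<lambda>j. W j x) t"
  have D0: "0 \<le> D t" unfolding D_def by simp
  have F1: "cmod (?F x) \<le> 1" for x by (rule emp_char_norm_le_1)
  have F2: "(cmod (?F x))\<^sup>2 \<le> 1" for x using F1 by (simp add: abs_square_le_1)
  have iF: "integrable M (\<lambda>x. (cmod (?F x))\<^sup>2)"
    by (rule integrable_const_bound[of _ 1]) (use F2 in auto)
  have iD: "integrable M (\<lambda>x. \<bar>(cmod (?F x))\<^sup>2 - exp (- t\<^sup>2)\<bar>)" using iF by simp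
  have e1: "exp (- t\<^sup>2) \<le> 1" "0 \<le> exp (- t\<^sup>2)" "1 - exp (- t\<^sup>2) \<le> t\<^sup>2"
    using exp_ge_add_one_self[of "- t\<^sup>2"] by auto
  have ab: "\<bar>a - c\<bar> \<le> 1" if "0 \<le> a" "a \<le> 1" "0 \<le> c" "c \<le> 1" for a c :: real using that by linarith
  have "D t \<le> (\<integral>x. 1 \<partial>M)"
    unfolding D_def by (intro integral_mono iD ab F2 e1) auto
  then show "\<bar>D t\<bar> \<le> 1" using D0 by (simp add: prob_space)
  have ic: "integrable M (\<lambda>x. cmod (?F x - exp (- t\<^sup>2 / 2)))"
    by (intro integrable_norm Bochner_Integration.integrable_diff integrable_const_bound[of ?F 1]) (use F1 in auto)
  have ee: "exp (- t\<^sup>2) = (exp (- t\<^sup>2 / 2))\<^sup>2" by (simp flip: exp_of_nat_mult exp_double)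
  have "D t \<le> (\<integral>x. 2 * cmod (?F x - exp (- t\<^sup>2 / 2)) \<partial>M)"
    unfolding D_def
  proof (intro integral_mono iD)
    show "\<bar>(cmod (?F x))\<^sup>2 - exp (- t\<^sup>2)\<bar> \<le> 2 * cmod (?F x - exp (- t\<^sup>2 / 2))" for x
      unfolding ee by (rule cmod_square_diff_le[OF F1]) auto
  qed (use ic in simp)
  then show "\<bar>D t\<bar> \<le> 2 * (\<integral>x. cmod (?F x - exp (- t\<^sup>2 / 2)) \<partial>M)" using D0 by simp
  have jk: "integrable M (\<lambda>x. cos (t * (W j x - W k x)))" for j k
    by (rule integrable_const_bound[of _ 1]) auto
  have djk: "(\<integral>x. 1 - cos (t * (W j x - W k x)) \<partial>M) \<le> 2 * w * t\<^sup>2" if "j \<in> {1..b}" "k \<in> {1..b}" for j k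
  proof -
    have "(\<integral>x. 1 - cos (t * (W j x - W k x)) \<partial>M) \<le> (\<integral>x. t\<^sup>2 * ((W j x)\<^sup>2 + (W k x)\<^sup>2) \<partial>M)"
    proof (rule integral_mono)
      fix x
      have "1 - cos (t * (W j x - W k x)) \<le> t\<^sup>2 * (W j x - W k x)\<^sup>2 / 2"
        using one_minus_cos_bounds(3)[of "t * (W j x - W k x)"] by (simp add: power_mult_distrib)
      also have "\<dots> \<le> t\<^sup>2 * ((W j x)\<^sup>2 + (W k x)\<^sup>2)"
      proof -
        have "(W j x - W k x)\<^sup>2 \<le> 2 * ((W j x)\<^sup>2 + (W k x)\<^sup>2)"
          using sum_squares_bound[of "W j x" "- W k x"] by (simp add: power2_diff)
        then have "t\<^sup>2 * (W j x - W k x)\<^sup>2 \<le> t\<^sup>2 * (2 * ((W j x)\<^sup>2 + (W k x)\<^sup>2))"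
          by (intro mult_left_mono) auto
        then show ?thesis by (simp add: algebra_simps)
      qed
      finally show "1 - cos (t * (W j x - W k x)) \<le> t\<^sup>2 * ((W j x)\<^sup>2 + (W k x)\<^sup>2)" .
    qed (use jk w(1) that in auto)
    also have "\<dots> = t\<^sup>2 * ((\<integral>x. (W j x)\<^sup>2 \<partial>M) + (\<integral>x. (W k x)\<^sup>2 \<partial>M))" using w(1) that by simp
    also have "\<dots> \<le> t\<^sup>2 * (w + w)" using w(2) that by (intro mult_left_mono add_mono) auto
    finally show ?thesis by (simp add: algebra_simps)
  qed
  have "(\<integral>x. 1 - (cmod (?F x))\<^sup>2 \<partial>M) = (\<integral>x. (\<Sum>j\<in>{1..b}. \<Sum>k\<in>{1..b}. 1 - cos (t * (W j x - W k x))) / (real b)\<^sup>2 \<partial>M)"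
    unfolding emp_char_norm_square[OF b] ..
  also have "\<dots> = (\<Sum>j\<in>{1..b}. \<Sum>k\<in>{1..b}. \<integral>x. 1 - cos (t * (W j x - W k x)) \<partial>M) / (real b)\<^sup>2"
    unfolding integral_divide_zero using jk
    by (subst Bochner_Integration.integral_sum) (auto intro!: sum.cong Bochner_Integration.integral_sum Bochner_Integration.integrable_sum)
  also have "\<dots> \<le> (\<Sum>j\<in>{1..b}. \<Sum>k\<in>{1..b}. 2 * w * t\<^sup>2) / (real b)\<^sup>2"
    by (intro divide_right_mono sum_mono djk) auto
  also have "\<dots> = 2 * w * t\<^sup>2" using b by (simp add: power2_eq_square)
  finally have 1: "(\<integral>x. 1 - (cmod (?F x))\<^sup>2 \<partial>M) \<le> 2 * w * t\<^sup>2" .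
  have "D t \<le> (\<integral>x. (1 - (cmod (?F x))\<^sup>2) + t\<^sup>2 \<partial>M)"
    unfolding D_def
  proof (intro integral_mono iD)
    show "\<bar>(cmod (?F x))\<^sup>2 - exp (- t\<^sup>2)\<bar> \<le> (1 - (cmod (?F x))\<^sup>2) + t\<^sup>2" for x
      using F2[of x] e1 by linarith
  qed (use iF in simp)
  also have "\<dots> = (\<integral>x. 1 - (cmod (?F x))\<^sup>2 \<partial>M) + t\<^sup>2" using iF by (simp add: prob_space)
  finally show "\<bar>D t\<bar> \<le> (1 + 2 * w) * t\<^sup>2" using 1 D0 by (simp add: algebra_simps)
qed

text \<open>Subtracting the Fourier representation of the Gini difference from that of its Gaussian
  limit gives one integral over t; the absolute value moves inside and the expectation is exchanged
  with the t-integral.\<close>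

lemma gini_deviation_le:
  fixes W :: "nat \<Rightarrow> 'a \<Rightarrow> real"
  assumes [measurable]: "\<And>j. W j \<in> borel_measurable M" and b: "0 < b"
    and w: "\<And>j. j \<in> {1..b} \<Longrightarrow> integrable M (\<lambda>x. (W j x)\<^sup>2)" "\<And>j. j \<in> {1..b} \<Longrightarrow> (\<integral>x. (W j x)\<^sup>2 \<partial>M) \<le> w"
  defines "D t \<equiv> \<integral>x. \<bar>(cmod (emp_char b (\<lambda>j. W j x) t))\<^sup>2 - exp (- t\<^sup>2)\<bar> \<partial>M"
  shows "D \<in> borel_measurable borel"
    and "integrable M (\<lambda>x. gini b (\<lambda>j. W j x))"
    and "abs_const * (\<integral>x. \<bar>gini b (\<lambda>j. W j x) - 2 / sqrt pi\<bar> \<partial>M)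
      \<le> (\<integral>t. half_kernel t (D t) \<partial>lborel)"
proof -
  define V where "V x = gini b (\<lambda>j. W j x)" for x
  define G where "G t x = (cmod (emp_char b (\<lambda>j. W j x) t))\<^sup>2 - exp (- t\<^sup>2)" for t x
  have jm: "(\<lambda>x. emp_char b (\<lambda>j. W j (snd x)) (fst x)) \<in> borel_measurable (lborel \<Otimes>\<^sub>M M)"
    by measurable
  then have Gm [measurable]: "(\<lambda>x. G (fst x) (snd x)) \<in> borel_measurable (lborel \<Otimes>\<^sub>M M)"
    unfolding G_def by measurable
  have Gx: "(\<lambda>t. G t x) \<in> borel_measurable borel" for x unfolding G_def by measurable
  have Gt [measurable]: "G t \<in> borel_measurable M" for t unfolding G_def by measurable
  have "(\<lambda>t. \<integral>x. \<bar>G t x\<bar> \<partial>M) \<in> borel_measurable lborel"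
    by (rule borel_measurable_lebesgue_integral) (simp add: split_beta)
  then show Dm [measurable]: "D \<in> borel_measurable borel" unfolding D_def G_def by simp
  have iW: "integrable M (W j)" if "j \<in> {1..b}" for j
    by (rule integrable_of_square) (use w that in auto)
  have iV: "integrable M V" unfolding V_def gini_def
    by (intro integrable_divide Bochner_Integration.integrable_sum integrable_abs Bochner_Integration.integrable_diff iW)
  then show "integrable M (\<lambda>x. gini b (\<lambda>j. W j x))"
    unfolding V_def .
  note Db = emp_char_deviation_le[of W b w, OF _ b w, folded D_def]
  have iD: "integrable lborel (\<lambda>t. half_kernel t (D t))"
    by (rule half_kernel_integrable[OF Dm]) (use Db in auto)
  have pt: "abs_const * \<bar>V x - 2 / sqrt pi\<bar> \<le> (\<integral>t. half_kernel t \<bar>G t x\<bar> \<partial>lborel)"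
    and iG: "integrable lborel (\<lambda>t. half_kernel t \<bar>G t x\<bar>)" for x
  proof -
    note i1 = half_kernel_gauss_integrable and i2 = emp_char_half_kernel(1)[OF b, of "\<lambda>j. W j x"]
    have e: "half_kernel t (G t x) = half_kernel t (1 - exp (- t\<^sup>2)) - half_kernel t (1 - (cmod (emp_char b (\<lambda>j. W j x) t))\<^sup>2)" for t
      unfolding half_kernel_def G_def by (simp add: right_diff_distrib diff_divide_distrib)
    have "abs_const * \<bar>V x - 2 / sqrt pi\<bar> = \<bar>abs_const * (2 / sqrt pi) - abs_const * V x\<bar>"
      using abs_const_pos by (simp only: right_diff_distrib[symmetric] abs_mult abs_of_pos abs_minus_commute)
    also have "\<dots> = \<bar>\<integral>t. half_kernel t (G t x) \<partial>lborel\<bar>"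
      unfolding e Bochner_Integration.integral_diff[OF i1 i2] half_kernel_gauss_integral emp_char_half_kernel(2)[OF b] V_def ..
    also have "\<dots> \<le> (\<integral>t. \<bar>half_kernel t (G t x)\<bar> \<partial>lborel)" by (rule integral_abs_bound)
    finally show "abs_const * \<bar>V x - 2 / sqrt pi\<bar> \<le> (\<integral>t. half_kernel t \<bar>G t x\<bar> \<partial>lborel)"
      unfolding half_kernel_abs .
    show "integrable lborel (\<lambda>t. half_kernel t \<bar>G t x\<bar>)"
      unfolding half_kernel_abs[symmetric] e using i1 i2 by (intro integrable_abs Bochner_Integration.integrable_diff)
  qed
  interpret P: pair_sigma_finite lborel M
    by (intro pair_sigma_finite.intro lborel.sigma_finite_measure_axioms sigma_finite_measure_axioms)
  \<comment> \<open>The chain is carried out with nonnegative integrals so that the exchange is an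
    instance of Tonelli's theorem; it returns to Bochner integrals at the end, where
    \<open>iD\<close> ensures finiteness.\<close>
  have "ennreal (abs_const * (\<integral>x. \<bar>V x - 2 / sqrt pi\<bar> \<partial>M)) = ennreal (\<integral>x. abs_const * \<bar>V x - 2 / sqrt pi\<bar> \<partial>M)"
    by simp
  also have "\<dots> = (\<integral>\<^sup>+x. abs_const * \<bar>V x - 2 / sqrt pi\<bar> \<partial>M)"
    using iV abs_const_pos by (intro nn_integral_eq_integral[symmetric]) auto
  also have "\<dots> \<le> (\<integral>\<^sup>+x. (\<integral>\<^sup>+t. half_kernel t \<bar>G t x\<bar> \<partial>lborel) \<partial>M)"
  proof (rule nn_integral_mono)
    fix x
    have "(\<integral>\<^sup>+t. half_kernel t \<bar>G t x\<bar> \<partial>lborel) = ennreal (\<integral>t. half_kernel t \<bar>G t x\<bar> \<partial>lborel)"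
      by (intro nn_integral_eq_integral iG AE_I2 half_kernel_nonneg) auto
    then show "ennreal (abs_const * \<bar>V x - 2 / sqrt pi\<bar>) \<le> (\<integral>\<^sup>+t. half_kernel t \<bar>G t x\<bar> \<partial>lborel)"
      using pt by (simp add: ennreal_leI)
  qed
  also have "\<dots> = (\<integral>\<^sup>+t. (\<integral>\<^sup>+x. half_kernel t \<bar>G t x\<bar> \<partial>M) \<partial>lborel)"
    by (rule P.Fubini') (simp add: split_beta)
  also have "\<dots> = (\<integral>\<^sup>+t. half_kernel t (D t) \<partial>lborel)"
  proof (rule nn_integral_cong)
    fix t :: real
    have "(cmod (emp_char b (\<lambda>j. W j x) t))\<^sup>2 \<le> 1" for x
      using emp_char_norm_le_1 by (simp add: abs_square_le_1)
    note F1 = this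
    have e1: "exp (- t\<^sup>2) \<le> 1" "0 \<le> exp (- t\<^sup>2)" by auto
    have "\<bar>G t x\<bar> \<le> 2" for x
      using F1[of x] e1 zero_le_power2[of "cmod (emp_char b (\<lambda>j. W j x) t)"] unfolding G_def by linarith
    then have "integrable M (\<lambda>x. \<bar>G t x\<bar>)" by (intro integrable_const_bound[of _ 2]) auto
    then have "(\<integral>\<^sup>+x. half_kernel t \<bar>G t x\<bar> \<partial>M) = ennreal (\<integral>x. half_kernel t \<bar>G t x\<bar> \<partial>M)"
      by (intro nn_integral_eq_integral AE_I2 half_kernel_nonneg) (auto simp: half_kernel_def)
    also have "(\<integral>x. half_kernel t \<bar>G t x\<bar> \<partial>M) = half_kernel t (D t)"
      unfolding half_kernel_def D_def G_def integral_mult_right_zero integral_divide_zero ..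
    finally show "(\<integral>\<^sup>+x. half_kernel t \<bar>G t x\<bar> \<partial>M) = ennreal (half_kernel t (D t))" .
  qed
  also have "\<dots> = ennreal (\<integral>t. half_kernel t (D t) \<partial>lborel)"
    using iD by (intro nn_integral_eq_integral) (auto intro!: half_kernel_nonneg simp: D_def)
  finally have "ennreal (abs_const * (\<integral>x. \<bar>V x - 2 / sqrt pi\<bar> \<partial>M)) \<le> ennreal (\<integral>t. half_kernel t (D t) \<partial>lborel)" .
  moreover have "0 \<le> (\<integral>t. half_kernel t (D t) \<partial>lborel)"
    by (intro integral_nonneg_AE AE_I2 half_kernel_nonneg) (simp add: D_def)
  ultimately show "abs_const * (\<integral>x. \<bar>gini b (\<lambda>j. W j x) - 2 / sqrt pi\<bar> \<partial>M)
      \<le> (\<integral>t. half_kernel t (D t) \<partial>lborel)"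
    unfolding V_def by simp
qed

theorem gini_mean_difference_limit:
  fixes W :: "nat \<Rightarrow> nat \<Rightarrow> 'a \<Rightarrow> real" and b :: "nat \<Rightarrow> nat"
  assumes Wm: "\<And>n j. W n j \<in> borel_measurable M" and b: "\<And>n. 0 < b n"
    and w: "\<And>n j. j \<in> {1..b n} \<Longrightarrow> integrable M (\<lambda>x. (W n j x)\<^sup>2)"
      "\<And>n j. j \<in> {1..b n} \<Longrightarrow> (\<integral>x. (W n j x)\<^sup>2 \<partial>M) \<le> w"
    and F: "\<And>t. (\<lambda>n. \<integral>x. cmod (emp_char (b n) (\<lambda>j. W n j x) t - exp (- t\<^sup>2 / 2)) \<partial>M) \<longlonglongrightarrow> 0"
  shows "(\<lambda>n. \<integral>x. \<bar>gini (b n) (\<lambda>j. W n j x) - 2 / sqrt pi\<bar> \<partial>M) \<longlonglongrightarrow> 0"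
    (is "?I \<longlonglongrightarrow> 0")
proof -
  define D where "D n t = (\<integral>x. \<bar>(cmod (emp_char (b n) (\<lambda>j. W n j x) t))\<^sup>2 - exp (- t\<^sup>2)\<bar> \<partial>M)" for n t
  note Db = emp_char_deviation_le[of "W n" "b n" w for n, OF Wm b w, folded D_def]
  note G = gini_deviation_le[of "W n" "b n" w for n, OF Wm b w, folded D_def]
  have Dm [measurable]: "D n \<in> borel_measurable borel" for n using G(1)[of n] unfolding D_def .
  have D0: "(\<lambda>n. D n t) \<longlonglongrightarrow> 0" for t
  proof (rule tendsto_rabs_zero_cancel, rule tendsto_sandwich[OF _ _ tendsto_const])
    show "\<forall>\<^sub>F n in sequentially. \<bar>D n t\<bar> \<le> 2 * (\<integral>x. cmod (emp_char (b n) (\<lambda>j. W n j x) t - exp (- t\<^sup>2 / 2)) \<partial>M)"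
      using Db(3) by simp
    show "(\<lambda>n. 2 * (\<integral>x. cmod (emp_char (b n) (\<lambda>j. W n j x) t - exp (- t\<^sup>2 / 2)) \<partial>M)) \<longlonglongrightarrow> 0"
      using tendsto_mult_right_zero[OF F] .
  qed simp
  have "(\<lambda>n. \<integral>t. half_kernel t (D n t) \<partial>lborel) \<longlonglongrightarrow> (\<integral>t. 0 \<partial>(lborel :: real measure))"
  \<comment> \<open>The majorant is that of \<open>half_kernel_le\<close> with C = 1 + 2 w and D =
    1; it does not depend on n because the second moments are bounded uniformly.\<close>
  proof (rule integral_dominated_convergence[where w="\<lambda>t. ((1 + 2 * w) + 1) * (indicator {0<..} t * (1 / (1 + t\<^sup>2)))"])
    show "integrable lborel (\<lambda>t::real. ((1 + 2 * w) + 1) * (indicator {0<..} t * (1 / (1 + t\<^sup>2))))"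
      by (intro integrable_mult_right integrable_half_line_inverse)
    show "AE t in lborel. (\<lambda>n. half_kernel t (D n t)) \<longlonglongrightarrow> 0"
    proof (rule AE_I2)
      fix t
      have "(\<lambda>n. half_kernel t (D n t)) \<longlonglongrightarrow> indicator {0<..} t * (0 / t\<^sup>2)"
        unfolding half_kernel_def divide_inverse by (intro tendsto_intros D0)
      then show "(\<lambda>n. half_kernel t (D n t)) \<longlonglongrightarrow> 0" by simp
    qed
    show "AE t in lborel. norm (half_kernel t (D n t)) \<le> ((1 + 2 * w) + 1) * (indicator {0<..} t * (1 / (1 + t\<^sup>2)))" for n
      using half_kernel_le[OF Db(1,2)] by (simp add: half_kernel_abs)
  qed (measurable)
  then have l: "(\<lambda>n. (\<integral>t. half_kernel t (D n t) \<partial>lborel) / abs_const) \<longlonglongrightarrow> 0"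
    using tendsto_divide_zero by fastforce
  show ?thesis
  proof (rule tendsto_sandwich[OF _ _ tendsto_const l])
    show "\<forall>\<^sub>F n in sequentially. 0 \<le> ?I n" by (intro always_eventually allI integral_nonneg_AE) auto
    show "\<forall>\<^sub>F n in sequentially. ?I n \<le> (\<integral>t. half_kernel t (D n t) \<partial>lborel) / abs_const"
      using G(3) abs_const_pos by (intro always_eventually allI) (simp add: pos_le_divide_eq mult.commute D_def)
  qed
qed

end

lemma cmod_square_sum:
  fixes X :: "nat \<Rightarrow> complex"
  shows "(cmod (\<Sum>j\<in>J. X j))\<^sup>2 = (\<Sum>j\<in>J. \<Sum>k\<in>J. Re (X j * cnj (X k)))"
proof -
  have "complex_of_real ((cmod (\<Sum>j\<in>J. X j))\<^sup>2) = (\<Sum>j\<in>J. X j) * cnj (\<Sum>j\<in>J. X j)"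
    by (rule complex_norm_square)
  then have "complex_of_real ((cmod (\<Sum>j\<in>J. X j))\<^sup>2) = (\<Sum>j\<in>J. \<Sum>k\<in>J. X j * cnj (X k))"
    by (simp add: sum_product)
  then have "Re (complex_of_real ((cmod (\<Sum>j\<in>J. X j))\<^sup>2)) = (\<Sum>j\<in>J. \<Sum>k\<in>J. Re (X j * cnj (X k)))"
    by simp
  then show ?thesis by simp
qed

section \<open>The empirical characteristic function of the blocks\<close>

context stationary_mixing
begin

lemma stationary_psum:
  fixes \<psi> :: "real \<Rightarrow> 'c::{banach, second_countable_topology}"
  assumes "quad_bounded g" "\<psi> \<in> borel_measurable borel"
  shows "(\<integral>x. \<psi> (psum g h p x) \<partial>M) = (\<integral>x. \<psi> (psum g 0 p x) \<partial>M)"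
proof -
  have [measurable]: "g \<in> borel_measurable borel" using assms(1) unfolding quad_bounded_def by simp
  have "(\<lambda>y. g y - (\<integral>x. g (Y 1 x) \<partial>M)) \<in> borel_measurable borel" by measurable
  from stationary_sum[OF assms(2) this, of h p] show ?thesis
    unfolding psum_def centred_def by simp
qed

text \<open>The variance of an average of b bounded terms. Each block has at most three partners
  that are adjacent or equal to it, with covariance at most 4, giving 12 / b. All other pairs are
  separated by a whole block and contribute at most \<open>8 * alpha l\<close> each.\<close>

lemma emp_char_block_variance:
  fixes t c :: real
  assumes g: "quad_bounded g" and b: "0 < b" and l: "1 \<le> l"
  defines "\<phi> \<equiv> \<integral>x. iexp (t * (c * psum g 0 l x)) \<partial>M"
  shows "(\<integral>x. (cmod (emp_char b (\<lambda>j. c * psum g ((j - 1) * l) l x) t - \<phi>))\<^sup>2 \<partial>M) \<le> 12 / real b + 8 * alpha l"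
proof -
  have gm [measurable]: "g \<in> borel_measurable borel" using g unfolding quad_bounded_def by auto
  note [measurable] = psum_measurable[OF g]
  have cm [measurable]: "cnj \<in> borel_measurable borel"
    by (intro borel_measurable_continuous_onI continuous_on_cnj continuous_on_id)
  define e where "e j x = iexp (t * (c * psum g ((j - 1) * l) l x))" for j x
  define X where "X j x = e j x - \<phi>" for j x
  have em [measurable]: "e j \<in> borel_measurable M" for j unfolding e_def by measurable
  have en: "cmod (e j x) \<le> 1" for j x unfolding e_def by simp
  have ei: "integrable M (e j)" for j by (rule integrable_const_bound[of _ 1]) (use en in auto)
  have ecn: "integrable M (\<lambda>x. cnj (e j x))" for j by (rule integrable_const_bound[of _ 1]) (use en in auto)
  have eei: "integrable M (\<lambda>x. e j x * cnj (e k x))" for j k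
    by (rule integrable_const_bound[of _ 1]) (use en in \<open>auto simp: norm_mult intro!: mult_le_one\<close>)
  have E: "(\<integral>x. e j x \<partial>M) = \<phi>" for j
    unfolding e_def \<phi>_def by (rule stationary_psum[OF g, of "\<lambda>s. iexp (t * (c * s))"]) simp
  have Ec: "(\<integral>x. cnj (e j x) \<partial>M) = cnj \<phi>" for j
    using integral_bounded_linear[OF bounded_linear_cnj ei[of j]] E[of j] by simp
  have \<phi>1: "cmod \<phi> \<le> 1"
  proof -
    have "cmod \<phi> \<le> (\<integral>x. cmod (iexp (t * (c * psum g 0 l x))) \<partial>M)" unfolding \<phi>_def by (rule integral_norm_bound)
    then show ?thesis by (simp add: prob_space)
  qed
  have Xn: "cmod (X j x) \<le> 2" for j x
    unfolding X_def using norm_triangle_ineq4[of "e j x" \<phi>] en[of j x] \<phi>1 by linarith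
  have Xe: "X j x * cnj (X k x) = e j x * cnj (e k x) - e j x * cnj \<phi> - \<phi> * cnj (e k x) + \<phi> * cnj \<phi>" for j k x
    unfolding X_def by (simp add: algebra_simps)
  have Xi: "integrable M (\<lambda>x. X j x * cnj (X k x))" for j k
    unfolding Xe using eei ei ecn by auto
  have XE: "(\<integral>x. X j x * cnj (X k x) \<partial>M) = (\<integral>x. e j x * cnj (e k x) \<partial>M) - \<phi> * cnj \<phi>" for j k
    unfolding Xe using eei[of j k] ei[of j] ecn[of k] E[of j] Ec[of k] by (simp add: prob_space)
  define C where "C j k = (\<integral>x. Re (X j x * cnj (X k x)) \<partial>M)" for j k
  have CRe: "C j k = Re (\<integral>x. X j x * cnj (X k x) \<partial>M)" for j k
    unfolding C_def by (rule integral_Re[OF Xi])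
  have Csym: "C j k = C k j" for j k
    unfolding C_def by (intro Bochner_Integration.integral_cong refl) (simp add: mult.commute)
  have C4: "C j k \<le> 4" for j k
  proof -
    have "C j k \<le> (\<integral>x. 4 \<partial>M)"
      unfolding C_def
    proof (rule integral_mono)
      fix x
      have "Re (X j x * cnj (X k x)) \<le> cmod (X j x) * cmod (X k x)"
        using complex_Re_le_cmod[of "X j x * cnj (X k x)"] by (simp add: norm_mult)
      also have "\<dots> \<le> 2 * 2" by (intro mult_mono Xn) auto
      finally show "Re (X j x * cnj (X k x)) \<le> 4" by simp
    qed (rule integrable_Re[OF Xi], simp)
    then show ?thesis by (simp add: prob_space)
  qed
  have Cfar: "C j k \<le> 8 * alpha l" if jk: "1 \<le> j" "j + 2 \<le> k" for j k
  proof -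
    have me: "e i \<in> borel_measurable (gen_sigma M Y I)" if "{(i - 1) * l + 1..(i - 1) * l + l} \<subseteq> I" for i I
    proof -
      have "(\<lambda>x. g (Y r x)) \<in> borel_measurable (gen_sigma M Y I)" if "r \<in> {(i - 1) * l + 1..(i - 1) * l + l}" for r
        by (rule measurable_compose[OF measurable_gen_sigma gm]) (use that \<open>_ \<subseteq> I\<close> in blast)
      then have "psum g ((i - 1) * l) l \<in> borel_measurable (gen_sigma M Y I)"
        unfolding psum_def centred_def by (intro borel_measurable_sum borel_measurable_diff) auto
      then show ?thesis unfolding e_def by measurable
    qed
    have m1: "1 \<le> j * l" using jk l by simp
    have "cmod ((\<integral>x. e j x * cnj (e k x) \<partial>M) - (\<integral>x. e j x \<partial>M) * (\<integral>x. cnj (e k x) \<partial>M)) \<le> 8 * alpha l"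
    proof (rule cov_complex_le_alpha[OF m1])
      have "(j - 1) * l + l = j * l" using jk by (cases j) auto
      then show "e j \<in> borel_measurable (gen_sigma M Y {1..j * l})" by (intro me) auto
      \<comment> \<open>Block k starts after index (k - 1) l >= (j + 1) l, while block j ends at j
        l: the block in between is the gap.\<close>
      have "(j + 1) * l \<le> (k - 1) * l" using jk by (intro mult_right_mono) auto
      then have "e k \<in> borel_measurable (gen_sigma M Y {l + j * l..})" by (intro me) auto
      then show "(\<lambda>x. cnj (e k x)) \<in> borel_measurable (gen_sigma M Y {l + j * l..})"
        by (rule measurable_compose[OF _ cm])
    qed (use en in auto)
    then have "cmod (\<integral>x. X j x * cnj (X k x) \<partial>M) \<le> 8 * alpha l" unfolding XE E Ec .
    then show ?thesis unfolding CRe using complex_Re_le_cmod order_trans by blast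
  qed
  have Cle: "C j k \<le> 8 * alpha l + (if k \<in> {j - 1..j + 1} then 4 else 0)" if "j \<in> {1..b}" "k \<in> {1..b}" for j k
  proof (cases "k \<in> {j - 1..j + 1}")
    case True then show ?thesis using C4[of j k] alpha_nonneg[of l] by simp
  next
    case False
    then have "j + 2 \<le> k \<or> k + 2 \<le> j" by auto
    then show ?thesis using Cfar[of j k] Cfar[of k j] Csym[of j k] that False by auto
  qed
  have "(\<integral>x. (cmod (emp_char b (\<lambda>j. c * psum g ((j - 1) * l) l x) t - \<phi>))\<^sup>2 \<partial>M)
      = (\<integral>x. (\<Sum>j\<in>{1..b}. \<Sum>k\<in>{1..b}. Re (X j x * cnj (X k x))) / (real b)\<^sup>2 \<partial>M)"
  proof (intro Bochner_Integration.integral_cong refl)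
    fix x
    have "emp_char b (\<lambda>j. c * psum g ((j - 1) * l) l x) t - \<phi> = (\<Sum>j\<in>{1..b}. X j x) / of_nat b"
      unfolding emp_char_def X_def e_def using b by (simp add: sum_subtractf diff_divide_distrib)
    then show "(cmod (emp_char b (\<lambda>j. c * psum g ((j - 1) * l) l x) t - \<phi>))\<^sup>2 = (\<Sum>j\<in>{1..b}. \<Sum>k\<in>{1..b}. Re (X j x * cnj (X k x))) / (real b)\<^sup>2"
      by (simp only: norm_divide power_divide cmod_square_sum norm_of_nat)
  qed
  also have "\<dots> = (\<Sum>j\<in>{1..b}. \<Sum>k\<in>{1..b}. C j k) / (real b)\<^sup>2"
  proof -
    have ri: "integrable M (\<lambda>x. Re (X j x * cnj (X k x)))" for j k using Xi by (rule integrable_Re)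
    have "(\<integral>x. (\<Sum>j\<in>{1..b}. \<Sum>k\<in>{1..b}. Re (X j x * cnj (X k x))) \<partial>M) = (\<Sum>j\<in>{1..b}. \<Sum>k\<in>{1..b}. C j k)"
      unfolding C_def using ri
      by (subst Bochner_Integration.integral_sum) (auto intro!: sum.cong Bochner_Integration.integral_sum)
    then show ?thesis by (simp only: integral_divide_zero)
  qed
  also have "\<dots> \<le> (\<Sum>j\<in>{1..b}. \<Sum>k\<in>{1..b}. 8 * alpha l + (if k \<in> {j - 1..j + 1} then 4 else 0)) / (real b)\<^sup>2"
    by (intro divide_right_mono sum_mono Cle) auto
  also have "\<dots> \<le> (\<Sum>j\<in>{1..b}. real b * (8 * alpha l) + 12) / (real b)\<^sup>2"
  proof (intro divide_right_mono sum_mono)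
    fix j assume "j \<in> {1..b}"
    have "card ({1..b} \<inter> {j - 1..j + 1}) \<le> card {j - 1..j + 1}" by (intro card_mono) auto
    also have "\<dots> \<le> 3" by simp
    finally have "real (card ({1..b} \<inter> {j - 1..j + 1})) \<le> 3" by simp
    then show "(\<Sum>k\<in>{1..b}. 8 * alpha l + (if k \<in> {j - 1..j + 1} then 4 else 0)) \<le> real b * (8 * alpha l) + 12"
      by (simp only: sum.distrib sum.inter_restrict[symmetric] finite_atLeastAtMost sum_constant card_atLeastAtMost) simp
  qed simp
  also have "\<dots> = 12 / real b + 8 * alpha l" using b by (simp add: power2_eq_square field_simps)
  finally show ?thesis .
qed

definition block_stat :: "(real \<Rightarrow> real) \<Rightarrow> nat \<Rightarrow> nat \<Rightarrow> 'a \<Rightarrow> real" where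
  "block_stat g l j x = 1 / (sqrt (lrv g) * sqrt (real l)) * psum g ((j - 1) * l) l x"

text \<open>The deviation splits into a fluctuation around the characteristic function of one block,
  controlled by the variance bound, and the distance of that function from the Gaussian one,
  controlled by the central limit theorem.\<close>

lemma emp_char_block_limit:
  fixes b l :: "nat \<Rightarrow> nat"
  assumes g: "quad_bounded g" and \<kappa>: "0 < lrv g"
    and b: "\<And>n. 0 < b n" "filterlim b at_top sequentially"
    and l: "\<And>n. 1 \<le> l n" "filterlim l at_top sequentially"
  shows "(\<lambda>n. \<integral>x. cmod (emp_char (b n) (\<lambda>j. block_stat g (l n) j x) t - exp (- t\<^sup>2 / 2)) \<partial>M) \<longlonglongrightarrow> 0"
proof -
  note [measurable] = psum_measurable[OF g]
  define c where "c n = 1 / (sqrt (lrv g) * sqrt (real (l n)))" for n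
  define \<phi> where "\<phi> n = (\<integral>x. iexp (t * (c n * psum g 0 (l n) x)) \<partial>M)" for n
  have "\<phi> \<longlonglongrightarrow> complex_of_real (exp (- ((t / sqrt (lrv g))\<^sup>2 * lrv g / 2)))"
    using filterlim_compose[OF mixing_clt[OF g, of "t / sqrt (lrv g)"] l(2)] unfolding \<phi>_def c_def by (simp add: field_simps)
  also have "(t / sqrt (lrv g))\<^sup>2 * lrv g / 2 = t\<^sup>2 / 2" using \<kappa> by (simp add: power_divide)
  finally have \<phi>: "\<phi> \<longlonglongrightarrow> complex_of_real (exp (- t\<^sup>2 / 2))" by simp
  have al: "(\<lambda>n. alpha (l n)) \<longlonglongrightarrow> 0" by (rule filterlim_compose[OF alpha_tendsto l(2)])
  have bi: "(\<lambda>n. 12 / real (b n)) \<longlonglongrightarrow> 0"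
    by (rule tendsto_divide_0[OF tendsto_const]) (rule filterlim_at_top_imp_at_infinity[OF filterlim_compose[OF filterlim_real_sequentially b(2)]])
  have lim: "(\<lambda>n. sqrt (12 / real (b n) + 8 * alpha (l n)) + cmod (\<phi> n - complex_of_real (exp (- t\<^sup>2 / 2)))) \<longlonglongrightarrow> sqrt (0 + 8 * 0) + 0"
    by (intro tendsto_intros bi al tendsto_norm_zero LIM_zero \<phi>)
  have Wm [measurable]: "block_stat g (l n) j \<in> borel_measurable M" for n j unfolding block_stat_def by measurable
  have bound: "(\<integral>x. cmod (emp_char (b n) (\<lambda>j. block_stat g (l n) j x) t - exp (- t\<^sup>2 / 2)) \<partial>M)
      \<le> sqrt (12 / real (b n) + 8 * alpha (l n)) + cmod (\<phi> n - complex_of_real (exp (- t\<^sup>2 / 2)))" for n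
  proof -
    let ?F = "\<lambda>x. emp_char (b n) (\<lambda>j. block_stat g (l n) j x) t"
    have Fm [measurable]: "?F \<in> borel_measurable M" by measurable
    have Fi: "integrable M (\<lambda>x. ?F x - z)" for z :: complex
      by (intro Bochner_Integration.integrable_diff integrable_const_bound[of ?F 1]) (use emp_char_norm_le_1 in auto)
    have F2: "integrable M (\<lambda>x. (cmod (?F x - \<phi> n))\<^sup>2)"
    proof (rule integrable_const_bound[of _ "(1 + cmod (\<phi> n))\<^sup>2"])
      show "AE x in M. norm ((cmod (?F x - \<phi> n))\<^sup>2) \<le> (1 + cmod (\<phi> n))\<^sup>2"
      proof (rule AE_I2)
        fix x
        have "cmod (?F x - \<phi> n) \<le> 1 + cmod (\<phi> n)"
          using norm_triangle_ineq4[of "?F x" "\<phi> n"] emp_char_norm_le_1[of "b n" "\<lambda>j. block_stat g (l n) j x" t] by linarith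
        then show "norm ((cmod (?F x - \<phi> n))\<^sup>2) \<le> (1 + cmod (\<phi> n))\<^sup>2" by (simp add: power_mono)
      qed
    qed measurable
    have "(\<integral>x. cmod (?F x - exp (- t\<^sup>2 / 2)) \<partial>M)
      \<le> (\<integral>x. \<bar>cmod (?F x - \<phi> n)\<bar> + cmod (\<phi> n - complex_of_real (exp (- t\<^sup>2 / 2))) \<partial>M)"
    proof (rule integral_mono)
      fix x
      show "cmod (?F x - exp (- t\<^sup>2 / 2)) \<le> \<bar>cmod (?F x - \<phi> n)\<bar> + cmod (\<phi> n - complex_of_real (exp (- t\<^sup>2 / 2)))"
        using norm_triangle_ineq[of "?F x - \<phi> n" "\<phi> n - complex_of_real (exp (- t\<^sup>2 / 2))"] by simp
    qed (use Fi in auto)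
    also have "\<dots> = (\<integral>x. \<bar>cmod (?F x - \<phi> n)\<bar> \<partial>M) + cmod (\<phi> n - complex_of_real (exp (- t\<^sup>2 / 2)))"
      using Fi by (simp add: prob_space)
    also have "(\<integral>x. \<bar>cmod (?F x - \<phi> n)\<bar> \<partial>M) \<le> sqrt (\<integral>x. (cmod (?F x - \<phi> n))\<^sup>2 \<partial>M)"
      by (rule expectation_abs_le_sqrt[OF _ F2]) measurable
    also have "\<dots> \<le> sqrt (12 / real (b n) + 8 * alpha (l n))"
      using emp_char_block_variance[OF g b(1)[of n] l(1)[of n], where t=t and c="c n"] unfolding \<phi>_def block_stat_def c_def by simp
    finally show ?thesis by simp
  qed
  show ?thesis
    by (rule tendsto_sandwich[OF _ _ tendsto_const])
       (use bound lim in \<open>auto intro!: always_eventually\<close>)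
qed

lemma block_second_moment:
  assumes g: "quad_bounded g"
  shows "(\<integral>x. (psum g h p x)\<^sup>2 \<partial>M) \<le> real p * Gam"
  using psum_square_le[OF g, of h p] mult_left_mono[OF varbound_le_Gam[OF g], of "real p"] by linarith

lemma block_gini_limit:
  fixes b l :: "nat \<Rightarrow> nat"
  assumes g: "quad_bounded g" and \<kappa>: "0 < lrv g"
    and b: "\<And>n. 0 < b n" "filterlim b at_top sequentially"
    and l: "\<And>n. 1 \<le> l n" "filterlim l at_top sequentially"
  shows "(\<lambda>n. \<integral>x. \<bar>gini (b n) (\<lambda>j. block_stat g (l n) j x) - 2 / sqrt pi\<bar> \<partial>M) \<longlonglongrightarrow> 0"
proof (rule gini_mean_difference_limit[where w="Gam / lrv g"])
  note [measurable] = psum_measurable[OF g]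
  show "block_stat g (l n) j \<in> borel_measurable M" for n j unfolding block_stat_def by measurable
  show "integrable M (\<lambda>x. (block_stat g (l n) j x)\<^sup>2)" for n j
    unfolding block_stat_def power_mult_distrib by (intro integrable_mult_right psum_square_integrable g)
  show "(\<integral>x. (block_stat g (l n) j x)\<^sup>2 \<partial>M) \<le> Gam / lrv g" for n j
  proof -
    have "(\<integral>x. (block_stat g (l n) j x)\<^sup>2 \<partial>M) = (1 / (sqrt (lrv g) * sqrt (real (l n))))\<^sup>2 * (\<integral>x. (psum g ((j - 1) * l n) (l n) x)\<^sup>2 \<partial>M)"
      unfolding block_stat_def power_mult_distrib by (rule integral_mult_right_zero)
    also have "\<dots> \<le> (1 / (sqrt (lrv g) * sqrt (real (l n))))\<^sup>2 * (real (l n) * Gam)"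
      by (intro mult_left_mono block_second_moment g) auto
    also have "\<dots> = Gam / lrv g" using \<kappa> l(1)[of n] by (simp add: power_divide power_mult_distrib)
    finally show ?thesis .
  qed
  show "(\<lambda>n. \<integral>x. cmod (emp_char (b n) (\<lambda>j. block_stat g (l n) j x) t - exp (- t\<^sup>2 / 2)) \<partial>M) \<longlonglongrightarrow> 0" for t
    by (rule emp_char_block_limit[OF g \<kappa> b l])
qed (rule b)

end

section \<open>Reduction of the test statistic to block sums\<close>

text \<open>Quadratic in \<open>a\<close> but linear in \<open>r\<close>, matching what is known of
  the two: \<open>a\<close> has a small second moment and \<open>r\<close> a small first absolute
  moment. The thresholds 1/4 keep the argument within 1/2 of 1.\<close>

lemma abs_ln_one_plus_add_le:
  fixes a r :: real
  assumes "\<bar>a\<bar> \<le> 1 / 4" "\<bar>r\<bar> \<le> 1 / 4"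
  shows "\<bar>ln (1 + (a + r)) - a\<bar> \<le> 4 * a\<^sup>2 + 2 * \<bar>r\<bar>"
proof -
  have "\<bar>a + r\<bar> \<le> 1 / 2" using assms by linarith
  then have "\<bar>ln (1 + (a + r)) - (a + r)\<bar> \<le> 2 * (a + r)\<^sup>2" by (rule abs_ln_one_plus_x_minus_x_bound)
  moreover have "(a + r)\<^sup>2 \<le> 2 * a\<^sup>2 + 2 * r\<^sup>2" using sum_squares_bound[of a r] by (simp add: power2_sum)
  moreover have "r\<^sup>2 \<le> 1 / 4 * \<bar>r\<bar>"
    using mult_right_mono[OF assms(2), of "\<bar>r\<bar>"] by (simp add: power2_eq_square)
  ultimately show ?thesis by linarith
qed

text \<open>Centring the drift as \<open>w\<close> makes its block sum vanish, so the mixed term of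
  the block mean of \<open>y\<close> and the drift drops out. The sum of squares of \<open>y\<close>
  is the leading term; the other three are remainders.\<close>

lemma block_var_affine:
  fixes y v X :: "nat \<Rightarrow> real"
  assumes l: "1 \<le> l" and j: "1 \<le> j"
  defines "I \<equiv> {(j - 1) * l + 1 .. (j - 1) * l + l}"
  assumes X: "\<And>i. i \<in> I \<Longrightarrow> X i = s * (y i + v i)"
  defines "w \<equiv> \<lambda>i. v i - (\<Sum>r\<in>I. v r) / real l"
  shows "block_var X l j = s\<^sup>2 * ((\<Sum>i\<in>I. (y i)\<^sup>2) / real l - ((\<Sum>i\<in>I. y i) / real l)\<^sup>2
    + 2 * ((\<Sum>i\<in>I. y i * w i) / real l) + (\<Sum>i\<in>I. (w i)\<^sup>2) / real l)"
proof -
  have I: "{(j - 1) * l + 1 .. j * l} = I" using j unfolding I_def by (cases j) auto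
  have c: "real (card I) = real l" unfolding I_def by simp
  have lpos: "0 < real l" using l by simp
  define yb where "yb = (\<Sum>i\<in>I. y i) / real l"
  define vb where "vb = (\<Sum>r\<in>I. v r) / real l"
  have Sy: "(\<Sum>i\<in>I. y i) = real l * yb" and Sv: "(\<Sum>i\<in>I. v i) = real l * vb" unfolding yb_def vb_def using lpos by auto
  have Sw: "(\<Sum>i\<in>I. w i) = 0" unfolding w_def vb_def[symmetric] by (simp add: sum_subtractf Sv c)
  have mean: "(\<Sum>i\<in>I. X i) / real l = s * (yb + vb)"
  proof -
    have "(\<Sum>i\<in>I. X i) = s * ((\<Sum>i\<in>I. y i) + (\<Sum>i\<in>I. v i))"
      unfolding sum.distrib[symmetric] sum_distrib_left by (rule sum.cong[OF refl X])
    then show ?thesis unfolding Sy Sv using lpos by (simp add: field_simps)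
  qed
  have "(\<Sum>i\<in>I. (X i - s * (yb + vb))\<^sup>2) = (\<Sum>i\<in>I. s\<^sup>2 * ((y i)\<^sup>2 + yb\<^sup>2 + 2 * (y i * w i) + (w i)\<^sup>2 - 2 * yb * y i - 2 * yb * w i))"
  proof (rule sum.cong[OF refl])
    fix i assume "i \<in> I"
    then have "X i - s * (yb + vb) = s * ((y i - yb) + w i)" unfolding X[OF \<open>i \<in> I\<close>] w_def vb_def by (simp add: algebra_simps)
    then show "(X i - s * (yb + vb))\<^sup>2 = s\<^sup>2 * ((y i)\<^sup>2 + yb\<^sup>2 + 2 * (y i * w i) + (w i)\<^sup>2 - 2 * yb * y i - 2 * yb * w i)"
      by (simp add: power2_eq_square algebra_simps)
  qed
  also have "\<dots> = s\<^sup>2 * ((\<Sum>i\<in>I. (y i)\<^sup>2) + real l * yb\<^sup>2 + 2 * (\<Sum>i\<in>I. y i * w i) + (\<Sum>i\<in>I. (w i)\<^sup>2) - 2 * yb * (real l * yb) - 2 * yb * 0)"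
    unfolding sum_distrib_left[symmetric] sum_subtractf sum.distrib Sy Sw by (simp add: c)
  also have "\<dots> = real l * (s\<^sup>2 * ((\<Sum>i\<in>I. (y i)\<^sup>2) / real l - yb\<^sup>2 + 2 * ((\<Sum>i\<in>I. y i * w i) / real l) + (\<Sum>i\<in>I. (w i)\<^sup>2) / real l))"
    using lpos by (simp add: power2_eq_square field_simps)
  finally show ?thesis
    unfolding block_var_def Let_def I mean yb_def[symmetric] using lpos by simp
qed

text \<open>The common centre \<open>c\<close> cancels in differences, and each error
  \<open>h j\<close> occurs in 2 (b - 1) ordered pairs. The factor b / (b - 1) converts the divisor
  \<open>b^2\<close> of \<open>gini\<close> into b (b - 1).\<close>

lemma pairwise_abs_diff_compare:
  fixes u a h :: "nat \<Rightarrow> real"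
  assumes b: "2 \<le> b" and h: "\<And>j. j \<in> {1..b} \<Longrightarrow> \<bar>u j - c - a j\<bar> \<le> h j"
  shows "\<bar>1 / (real b * (real b - 1)) * (\<Sum>j\<in>{1..b}. \<Sum>k\<in>{1..b} - {j}. \<bar>u j - u k\<bar>)
    - real b / (real b - 1) * gini b a\<bar> \<le> 2 / real b * (\<Sum>j\<in>{1..b}. h j)"
proof -
  have b1: "0 < real b" "0 < real b - 1" using b by auto
  have r: "(\<Sum>k\<in>{1..b}. \<bar>a j - a k\<bar>) = (\<Sum>k\<in>{1..b} - {j}. \<bar>a j - a k\<bar>)" if "j \<in> {1..b}" for j
    using that by (subst sum.remove[of _ j]) auto
  have e: "real b / (real b - 1) * (S / (real b)\<^sup>2) = 1 / (real b * (real b - 1)) * S" for S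
    using b1 by (simp add: power2_eq_square)
  have hs: "(\<Sum>k\<in>{1..b} - {j}. h k) = (\<Sum>k\<in>{1..b}. h k) - h j" if "j \<in> {1..b}" for j
    using that by (subst sum.remove[of "{1..b}" j]) auto
  have rr: "(\<Sum>j\<in>{1..b}. \<Sum>k\<in>{1..b}. \<bar>a j - a k\<bar>) = (\<Sum>j\<in>{1..b}. \<Sum>k\<in>{1..b} - {j}. \<bar>a j - a k\<bar>)"
    by (rule sum.cong[OF refl r])
  have "\<bar>(\<Sum>j\<in>{1..b}. \<Sum>k\<in>{1..b} - {j}. \<bar>u j - u k\<bar>) - (\<Sum>j\<in>{1..b}. \<Sum>k\<in>{1..b}. \<bar>a j - a k\<bar>)\<bar>
     = \<bar>\<Sum>j\<in>{1..b}. \<Sum>k\<in>{1..b} - {j}. \<bar>u j - u k\<bar> - \<bar>a j - a k\<bar>\<bar>"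
    unfolding sum_subtractf rr ..
  also have "\<dots> \<le> (\<Sum>j\<in>{1..b}. \<Sum>k\<in>{1..b} - {j}. h j + h k)"
  proof (intro order_trans[OF sum_abs] sum_mono)
    fix j k assume "j \<in> {1..b}" "k \<in> {1..b} - {j}"
    then show "\<bar>\<bar>u j - u k\<bar> - \<bar>a j - a k\<bar>\<bar> \<le> h j + h k" using h[of j] h[of k] by auto
  qed
  also have "\<dots> = (\<Sum>j\<in>{1..b}. (real b - 1) * h j + ((\<Sum>k\<in>{1..b}. h k) - h j))"
  proof (rule sum.cong[OF refl])
    fix j assume j: "j \<in> {1..b}"
    have "real (card ({1..b} - {j})) = real b - 1" using j b by (simp add: of_nat_diff)
    then show "(\<Sum>k\<in>{1..b} - {j}. h j + h k) = (real b - 1) * h j + ((\<Sum>k\<in>{1..b}. h k) - h j)"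
      by (simp only: sum.distrib sum_constant hs[OF j])
  qed
  also have "\<dots> = 2 * (real b - 1) * (\<Sum>j\<in>{1..b}. h j)"
    unfolding sum.distrib sum_subtractf sum_distrib_left[symmetric] by (simp add: algebra_simps)
  finally have "\<bar>(\<Sum>j\<in>{1..b}. \<Sum>k\<in>{1..b} - {j}. \<bar>u j - u k\<bar>) - (\<Sum>j\<in>{1..b}. \<Sum>k\<in>{1..b}. \<bar>a j - a k\<bar>)\<bar>
    \<le> 2 * (real b - 1) * (\<Sum>j\<in>{1..b}. h j)" .
  then have "1 / (real b * (real b - 1)) * \<bar>(\<Sum>j\<in>{1..b}. \<Sum>k\<in>{1..b} - {j}. \<bar>u j - u k\<bar>) - (\<Sum>j\<in>{1..b}. \<Sum>k\<in>{1..b}. \<bar>a j - a k\<bar>)\<bar>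
    \<le> 1 / (real b * (real b - 1)) * (2 * (real b - 1) * (\<Sum>j\<in>{1..b}. h j))"
    using b1 by (intro mult_left_mono) auto
  also have "\<dots> = 2 / real b * (\<Sum>j\<in>{1..b}. h j)"
  proof -
    have cancel: "1 / (x * y) * (2 * y * S) = 2 / x * S" if "y \<noteq> 0" for x y S :: real using that by simp
    show ?thesis by (rule cancel) (use b1 in simp)
  qed
  finally show ?thesis
    unfolding gini_def e right_diff_distrib[symmetric] abs_mult using b1 by simp
qed

section \<open>Remainder terms and the deviation bound for the statistic\<close>

context stationary_mixing
begin

text \<open>The three terms of the bound belong to the squared block mean, the cross term and the
  squared drift. The cross term is a sum of centred variables with weights at most L / n, so the
  variance bound for weighted sums gives its mean square; the drift oscillates by at most L l / n
  within a block.\<close>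

lemma block_remainder_bound:
  fixes v :: "nat \<Rightarrow> real" and L :: real
  assumes mean0: "(\<integral>x. Y 1 x \<partial>M) = 0" and l: "1 \<le> l" and n: "0 < n" and L: "0 \<le> L"
    and v: "\<And>i r. i \<in> {h+1..h+l} \<Longrightarrow> r \<in> {h+1..h+l} \<Longrightarrow> \<bar>v i - v r\<bar> \<le> L / real n * real l"
  defines "w \<equiv> \<lambda>i. v i - (\<Sum>r\<in>{h+1..h+l}. v r) / real l"
  defines "R \<equiv> \<lambda>x. 2 * ((\<Sum>i\<in>{h+1..h+l}. Y i x * w i) / real l) + (\<Sum>i\<in>{h+1..h+l}. (w i)\<^sup>2) / real l - ((\<Sum>i\<in>{h+1..h+l}. Y i x) / real l)\<^sup>2"
  shows "integrable M R"
    and "(\<integral>x. \<bar>R x\<bar> \<partial>M) \<le> Gam / real l + 2 * (L / real n * sqrt (real l * Gam)) + (L / real n * real l)\<^sup>2"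
proof -
  let ?I = "{h+1..h+l}"
  have lpos: "0 < real l" using l by simp
  have q: "quad_bounded (\<lambda>y. y)" by (rule quad_bounded_id)
  have cY: "centred (\<lambda>y. y) i x = Y i x" for i x unfolding centred_def using mean0 by simp
  have pY: "psum (\<lambda>y. y) h l x = (\<Sum>i\<in>?I. Y i x)" for x unfolding psum_def cY ..
  have wb: "\<bar>w i\<bar> \<le> L / real n * real l" if i: "i \<in> ?I" for i
  proof -
    have "w i = (\<Sum>r\<in>?I. v i - v r) / real l" unfolding w_def using lpos by (simp add: sum_subtractf field_simps)
    then have "\<bar>w i\<bar> = \<bar>\<Sum>r\<in>?I. v i - v r\<bar> / real l" using lpos by simp
    also have "\<dots> \<le> (\<Sum>r\<in>?I. L / real n * real l) / real l"
      by (intro divide_right_mono order_trans[OF sum_abs] sum_mono v i) auto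
    finally show ?thesis using lpos by simp
  qed
  define C where "C x = (\<Sum>i\<in>?I. (w i / real l) * centred (\<lambda>y. y) i x)" for x
  have Ce: "(\<Sum>i\<in>?I. Y i x * w i) / real l = C x" for x
    unfolding C_def cY by (simp add: sum_divide_distrib mult.commute)
  have wl: "\<bar>w i / real l\<bar> \<le> L / real n" if "i \<in> ?I" for i
    using wb[OF that] lpos by (simp add: abs_divide divide_le_eq)
  have fin: "finite ?I" and ge1: "\<And>i. i \<in> ?I \<Longrightarrow> 1 \<le> i" by auto
  have C2: "integrable M (\<lambda>x. (C x)\<^sup>2)" "(\<integral>x. (C x)\<^sup>2 \<partial>M) \<le> (L / real n)\<^sup>2 * (real l * Gam)"
  proof -
    show "integrable M (\<lambda>x. (C x)\<^sup>2)" unfolding C_def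
      by (rule sum_centred_square_integrable[OF q fin ge1 wl])
    have "(\<integral>x. (C x)\<^sup>2 \<partial>M) \<le> (L / real n)\<^sup>2 * real (card ?I) * varbound (\<lambda>y. y)"
      unfolding C_def by (rule sum_centred_square_le[OF q fin ge1 wl])
    also have "\<dots> \<le> (L / real n)\<^sup>2 * real (card ?I) * Gam"
      by (intro mult_left_mono varbound_le_Gam q) auto
    finally show "(\<integral>x. (C x)\<^sup>2 \<partial>M) \<le> (L / real n)\<^sup>2 * (real l * Gam)" by (simp add: mult.assoc)
  qed
  have Cm [measurable]: "C \<in> borel_measurable M" unfolding C_def cY by measurable
  have C1: "integrable M C" by (rule integrable_of_square[OF Cm C2(1)])
  have Cabs: "(\<integral>x. \<bar>C x\<bar> \<partial>M) \<le> L / real n * sqrt (real l * Gam)"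
  proof -
    have "(\<integral>x. \<bar>C x\<bar> \<partial>M) \<le> sqrt (\<integral>x. (C x)\<^sup>2 \<partial>M)" by (rule expectation_abs_le_sqrt[OF Cm C2(1)])
    also have "\<dots> \<le> sqrt ((L / real n)\<^sup>2 * (real l * Gam))" using C2(2) by simp
    also have "\<dots> = L / real n * sqrt (real l * Gam)" using L by (simp add: real_sqrt_mult)
    finally show ?thesis .
  qed
  have P2: "integrable M (\<lambda>x. (psum (\<lambda>y. y) h l x / real l)\<^sup>2)"
    "(\<integral>x. (psum (\<lambda>y. y) h l x / real l)\<^sup>2 \<partial>M) \<le> Gam / real l"
  proof -
    show "integrable M (\<lambda>x. (psum (\<lambda>y. y) h l x / real l)\<^sup>2)"
      unfolding power_divide by (intro integrable_divide psum_square_integrable q)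
    have "(\<integral>x. (psum (\<lambda>y. y) h l x / real l)\<^sup>2 \<partial>M) = (\<integral>x. (psum (\<lambda>y. y) h l x)\<^sup>2 \<partial>M) / (real l)\<^sup>2"
      unfolding power_divide by (rule integral_divide_zero)
    also have "\<dots> \<le> (real l * Gam) / (real l)\<^sup>2" by (intro divide_right_mono block_second_moment q) auto
    finally show "(\<integral>x. (psum (\<lambda>y. y) h l x / real l)\<^sup>2 \<partial>M) \<le> Gam / real l"
      using lpos by (simp add: power2_eq_square)
  qed
  define E where "E = (\<Sum>i\<in>?I. (w i)\<^sup>2) / real l"
  have E: "0 \<le> E" "E \<le> (L / real n * real l)\<^sup>2"
  proof -
    show "0 \<le> E" unfolding E_def by (intro divide_nonneg_nonneg sum_nonneg) auto
    have "(w i)\<^sup>2 \<le> (L / real n * real l)\<^sup>2" if "i \<in> ?I" for i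
      using power_mono[OF wb[OF that] abs_ge_zero, of 2] by simp
    then have "E \<le> (\<Sum>i\<in>?I. (L / real n * real l)\<^sup>2) / real l"
      unfolding E_def by (intro divide_right_mono sum_mono) auto
    then show "E \<le> (L / real n * real l)\<^sup>2" using lpos by simp
  qed
  have R: "R x = 2 * C x + E - (psum (\<lambda>y. y) h l x / real l)\<^sup>2" for x
    unfolding R_def Ce E_def pY ..
  show iR: "integrable M R"
    unfolding R[abs_def] using C1 P2(1) by auto
  have "(\<integral>x. \<bar>R x\<bar> \<partial>M) \<le> (\<integral>x. 2 * \<bar>C x\<bar> + E + (psum (\<lambda>y. y) h l x / real l)\<^sup>2 \<partial>M)"
  proof (rule integral_mono)
    fix x show "\<bar>R x\<bar> \<le> 2 * \<bar>C x\<bar> + E + (psum (\<lambda>y. y) h l x / real l)\<^sup>2"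
      unfolding R using E(1) zero_le_power2[of "psum (\<lambda>y. y) h l x / real l"] by linarith
  qed (use iR C1 P2(1) in auto)
  also have "\<dots> = 2 * (\<integral>x. \<bar>C x\<bar> \<partial>M) + E + (\<integral>x. (psum (\<lambda>y. y) h l x / real l)\<^sup>2 \<partial>M)"
    using C1 P2(1) by (simp add: prob_space)
  finally show "(\<integral>x. \<bar>R x\<bar> \<partial>M) \<le> Gam / real l + 2 * (L / real n * sqrt (real l * Gam)) + (L / real n * real l)\<^sup>2"
    using Cabs E P2(2) by linarith
qed

lemma block_var_measurable [measurable]:
  assumes [measurable]: "\<And>i. (\<lambda>x. X x i) \<in> borel_measurable N"
  shows "(\<lambda>x. block_var (X x) l j) \<in> borel_measurable N"
  unfolding block_var_def Let_def by measurable

text \<open>A Markov argument with one random variable \<open>T\<close>, which is at least 1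
  whenever the statistic deviates by more than epsilon. Either some block variance leaves the range
  where the logarithm is linearised, or all stay in it and the deviation is at most
  \<open>H\<close>. Summing over blocks in the first alternative is the union bound and produces the
  factor b.\<close>

lemma Ustat_deviation_bound:
  fixes v :: "nat \<Rightarrow> real" and L s \<epsilon> :: real and X :: "'a \<Rightarrow> nat \<Rightarrow> real"
  assumes mean0: "(\<integral>x. Y 1 x \<partial>M) = 0" and var1: "(\<integral>x. (Y 1 x)\<^sup>2 \<partial>M) = 1"
    and \<kappa>: "0 < lrv (\<lambda>y. y\<^sup>2)"
    and l: "1 \<le> l" and b: "2 \<le> b" and n: "0 < n" and L: "0 \<le> L" and s: "0 < s" and \<epsilon>: "0 < \<epsilon>"
    and v: "\<And>i r. i \<in> {1..b*l} \<Longrightarrow> r \<in> {1..b*l} \<Longrightarrow> \<bar>v i - v r\<bar> \<le> L / real n * \<bar>real i - real r\<bar>"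
    and Xm [measurable]: "\<And>i. (\<lambda>x. X x i) \<in> borel_measurable M"
    and X: "\<And>i x. i \<in> {1..b*l} \<Longrightarrow> X x i = s * (Y i x + v i)"
  defines "\<rho> \<equiv> Gam / real l + 2 * (L / real n * sqrt (real l * Gam)) + (L / real n * real l)\<^sup>2"
  shows "measure M {x \<in> space M. \<bar>sqrt (real l) / sqrt (lrv (\<lambda>y. y\<^sup>2)) * Ustat (X x) l b - 2 / sqrt pi\<bar> > \<epsilon>}
    \<le> real b * (16 * (Gam / real l) + 4 * \<rho>)
      + (sqrt (real l) / sqrt (lrv (\<lambda>y. y\<^sup>2)) * (2 * (4 * (Gam / real l) + 2 * \<rho>))
        + 2 * (\<integral>x. \<bar>gini b (\<lambda>j. block_stat (\<lambda>y. y\<^sup>2) l j x) - 2 / sqrt pi\<bar> \<partial>M)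
        + 2 / sqrt pi / (real b - 1)) / \<epsilon>"
proof -
  let ?q = "\<lambda>y::real. y\<^sup>2"
  define K where "K = sqrt (real l) / sqrt (lrv ?q)"
  define v0 where "v0 = 2 / sqrt pi"
  have K: "0 < K" unfolding K_def using l \<kappa> by simp
  have v0: "0 < v0" unfolding v0_def by simp
  have lpos: "0 < real l" using l by simp
  have b1: "0 < real b - 1" "0 < real b" using b by auto
  note q = quad_bounded_square
  note [measurable] = psum_measurable[OF q]
  define I where "I j = {(j - 1) * l + 1 .. (j - 1) * l + l}" for j
  have Isub: "I j \<subseteq> {1..b*l}" if "j \<in> {1..b}" for j
  proof -
    have "(j - 1) * l + l = j * l" using that by (cases j) auto
    also have "\<dots> \<le> b * l" using that by (intro mult_right_mono) auto
    finally show ?thesis unfolding I_def by auto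
  qed
  define w where "w j i = v i - (\<Sum>r\<in>I j. v r) / real l" for j i
  define A where "A j x = psum ?q ((j - 1) * l) l x / real l" for j x
  define R where "R j x = 2 * ((\<Sum>i\<in>I j. Y i x * w j i) / real l) + (\<Sum>i\<in>I j. (w j i)\<^sup>2) / real l - ((\<Sum>i\<in>I j. Y i x) / real l)\<^sup>2" for j x
  have vI: "\<bar>v i - v r\<bar> \<le> L / real n * real l" if "j \<in> {1..b}" "i \<in> I j" "r \<in> I j" for i r j
  proof -
    have "\<bar>real i - real r\<bar> \<le> real l" using that(2,3) unfolding I_def by auto
    then have "L / real n * \<bar>real i - real r\<bar> \<le> L / real n * real l" using L by (intro mult_left_mono) auto
    then show ?thesis using v[of i r] Isub[OF that(1)] that by (meson order_trans subsetD)
  qed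
  have Ri: "integrable M (R j)" and Rb: "(\<integral>x. \<bar>R j x\<bar> \<partial>M) \<le> \<rho>" if "j \<in> {1..b}" for j
  proof -
    note rb = block_remainder_bound[OF mean0 l n L, where h="(j - 1) * l" and v=v, folded I_def,
        OF vI[OF that], folded w_def, folded R_def \<rho>_def]
    show "integrable M (R j)" by (rule rb(1))
    show "(\<integral>x. \<bar>R j x\<bar> \<partial>M) \<le> \<rho>" by (rule rb(2))
  qed
  have Ai: "integrable M (\<lambda>x. (A j x)\<^sup>2)" for j
    unfolding A_def power_divide by (intro integrable_divide psum_square_integrable q)
  have Ab: "(\<integral>x. (A j x)\<^sup>2 \<partial>M) \<le> Gam / real l" for j
  proof -
    have "(\<integral>x. (A j x)\<^sup>2 \<partial>M) = (\<integral>x. (psum ?q ((j - 1) * l) l x)\<^sup>2 \<partial>M) / (real l)\<^sup>2"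
      unfolding A_def power_divide by (rule integral_divide_zero)
    also have "\<dots> \<le> (real l * Gam) / (real l)\<^sup>2" by (intro divide_right_mono block_second_moment q) auto
    finally show ?thesis using lpos by (simp add: power2_eq_square)
  qed
  have bv: "block_var (X x) l j = s\<^sup>2 * (1 + (A j x + R j x))" if j: "j \<in> {1..b}" for j x
  proof -
    have "X x i = s * (Y i x + v i)" if "i \<in> I j" for i using X Isub[OF j] that by blast
    then have "block_var (X x) l j = s\<^sup>2 * ((\<Sum>i\<in>I j. (Y i x)\<^sup>2) / real l - ((\<Sum>i\<in>I j. Y i x) / real l)\<^sup>2
      + 2 * ((\<Sum>i\<in>I j. Y i x * w j i) / real l) + (\<Sum>i\<in>I j. (w j i)\<^sup>2) / real l)"
      using block_var_affine[OF l, of j "X x" s "\<lambda>i. Y i x" v] j unfolding I_def w_def by auto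
    also have "(\<Sum>i\<in>I j. (Y i x)\<^sup>2) / real l = 1 + A j x"
      unfolding A_def psum_def centred_def I_def using var1 lpos by (simp add: sum_subtractf diff_divide_distrib)
    finally show ?thesis unfolding R_def by (simp add: algebra_simps)
  qed
  have WA: "block_stat ?q l j x = K * A j x" for j x
  proof -
    have "K / real l = 1 / (sqrt (lrv ?q) * sqrt (real l))"
      unfolding K_def using lpos \<kappa> by (simp add: field_simps)
    then have "block_stat ?q l j x = K / real l * psum ?q ((j - 1) * l) l x" unfolding block_stat_def by (simp only:)
    then show ?thesis unfolding A_def by simp
  qed
  define V where "V x = gini b (\<lambda>j. block_stat (\<lambda>y. y\<^sup>2) l j x)" for x
  \<comment> \<open>The weights 16 and 4 are the reciprocals of (1/4)^2 and 1/4, so a block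
    exceeding either threshold makes the sum at least 1; the weights 4 and 2 used in
    \<open>H\<close> are those of the logarithm estimate.\<close>
  let ?S = "\<lambda>c d x. \<Sum>j\<in>{1..b}. c * (A j x)\<^sup>2 + d * \<bar>R j x\<bar>"
  define H where "H x = K * (2 / real b * ?S 4 2 x) + 2 * \<bar>V x - v0\<bar> + v0 / (real b - 1)" for x
  define T where "T x = ?S 16 4 x + H x / \<epsilon>" for x
  have H0: "0 \<le> H x" for x
    unfolding H_def using K b1 v0 by (intro add_nonneg_nonneg mult_nonneg_nonneg sum_nonneg) auto
  have S0: "0 \<le> ?S 16 4 x" for x by (intro sum_nonneg) auto
  have good: "\<bar>K * Ustat (X x) l b - v0\<bar> \<le> H x"
    if small: "\<And>j. j \<in> {1..b} \<Longrightarrow> \<bar>A j x\<bar> \<le> 1 / 4 \<and> \<bar>R j x\<bar> \<le> 1 / 4" for x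
  proof -
    define VA where "VA = gini b (\<lambda>j. A j x)"
    have VV: "V x = K * VA"
      unfolding V_def VA_def WA using K by (intro gini_scale) simp
    have "\<bar>ln (block_var (X x) l j) - ln (s\<^sup>2) - A j x\<bar> \<le> 4 * (A j x)\<^sup>2 + 2 * \<bar>R j x\<bar>" if j: "j \<in> {1..b}" for j
    proof -
      have "0 < 1 + (A j x + R j x)" using small[OF j] by linarith
      then have "ln (block_var (X x) l j) = ln (s\<^sup>2) + ln (1 + (A j x + R j x))"
        unfolding bv[OF j] using s by (subst ln_mult) auto
      then show ?thesis using abs_ln_one_plus_add_le[of "A j x" "R j x"] small[OF j] by simp
    qed
    from pairwise_abs_diff_compare[OF b, where u="\<lambda>j. ln (block_var (X x) l j)" and c="ln (s\<^sup>2)"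
        and a="\<lambda>j. A j x" and h="\<lambda>j. 4 * (A j x)\<^sup>2 + 2 * \<bar>R j x\<bar>", OF this]
    have U: "\<bar>Ustat (X x) l b - real b / (real b - 1) * VA\<bar> \<le> 2 / real b * ?S 4 2 x"
      unfolding Ustat_def VA_def by blast
    \<comment> \<open>The excess of b / (b - 1) over 1, multiplied by the limit \<open>v0\<close>,
      leaves the term v0 / (b - 1).\<close>
    have "K * Ustat (X x) l b - v0 = K * (Ustat (X x) l b - real b / (real b - 1) * VA)
       + real b / (real b - 1) * (V x - v0) + v0 / (real b - 1)"
    proof -
      have "v0 = real b / (real b - 1) * v0 - v0 / (real b - 1)"
        using b1 by (simp add: diff_divide_distrib[symmetric] field_simps)
      moreover have "K * x - v0 = K * (x - q * y) + q * (K * y - v0) + d" if "v0 = q * v0 - d" for x y q d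
        using that by (simp add: algebra_simps)
      ultimately show ?thesis unfolding VV by blast
    qed
    also have "\<bar>\<dots>\<bar> \<le> K * \<bar>Ustat (X x) l b - real b / (real b - 1) * VA\<bar> + real b / (real b - 1) * \<bar>V x - v0\<bar> + v0 / (real b - 1)"
    proof -
      have tri: "\<bar>K * x + y * z + u\<bar> \<le> K * \<bar>x\<bar> + y * \<bar>z\<bar> + u" if "0 \<le> y" "0 \<le> u" for x y z u
        using that K by (intro order_trans[OF abs_triangle_ineq] add_mono order_trans[OF abs_triangle_ineq]) (auto simp: abs_mult)
      show ?thesis by (rule tri) (use b1 v0 in auto)
    qed
    also have "\<dots> \<le> K * (2 / real b * ?S 4 2 x) + 2 * \<bar>V x - v0\<bar> + v0 / (real b - 1)"
    proof -
      have "real b / (real b - 1) \<le> 2" using b by (simp add: divide_le_eq)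
      then show ?thesis using K U by (intro add_mono mult_left_mono mult_right_mono) auto
    qed
    finally show ?thesis unfolding H_def .
  qed
  have T1: "1 \<le> T x" if big: "\<bar>K * Ustat (X x) l b - v0\<bar> > \<epsilon>" for x
  proof (cases "\<forall>j\<in>{1..b}. \<bar>A j x\<bar> \<le> 1 / 4 \<and> \<bar>R j x\<bar> \<le> 1 / 4")
    case True
    then have "\<epsilon> < H x" using good[of x] big by fastforce
    then have "1 \<le> H x / \<epsilon>" using \<epsilon> by simp
    then show ?thesis unfolding T_def using S0[of x] by linarith
  next
    case False
    then obtain j where j: "j \<in> {1..b}" "1 / 4 < \<bar>A j x\<bar> \<or> 1 / 4 < \<bar>R j x\<bar>" by fastforce
    have "1 \<le> 16 * (A j x)\<^sup>2 + 4 * \<bar>R j x\<bar>"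
    proof (cases "1 / 4 < \<bar>A j x\<bar>")
      case True
      then have "(1 / 4)\<^sup>2 \<le> \<bar>A j x\<bar>\<^sup>2" by (intro power_mono) auto
      then show ?thesis by (simp add: power_divide)
    next
      case False
      then have "1 \<le> 4 * \<bar>R j x\<bar>" using j by simp
      then show ?thesis using zero_le_power2[of "A j x"] by linarith
    qed
    also have "\<dots> \<le> ?S 16 4 x"
      using j(1) by (intro member_le_sum) auto
    finally show ?thesis unfolding T_def using H0[of x] \<epsilon> by (simp add: add_increasing2)
  qed
  have T0: "0 \<le> T x" for x unfolding T_def using S0 H0 \<epsilon> by (intro add_nonneg_nonneg) auto
  have Wm: "integrable M (block_stat ?q l j)" for j
    unfolding block_stat_def
    by (intro integrable_mult_right integrable_of_square[OF psum_measurable[OF q] psum_square_integrable[OF q]])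
  have iV: "integrable M V"
    unfolding V_def gini_def by (intro integrable_divide Bochner_Integration.integrable_sum integrable_abs Bochner_Integration.integrable_diff Wm)
  have iS: "integrable M (?S c d)" for c d
    using Ai Ri by (intro Bochner_Integration.integrable_sum Bochner_Integration.integrable_add integrable_mult_right integrable_abs) auto
  have ES: "(\<integral>x. ?S c d x \<partial>M) \<le> real b * (c * (Gam / real l) + d * \<rho>)" if "0 \<le> c" "0 \<le> d" for c d
  proof -
    have "(\<integral>x. ?S c d x \<partial>M) = (\<Sum>j\<in>{1..b}. c * (\<integral>x. (A j x)\<^sup>2 \<partial>M) + d * (\<integral>x. \<bar>R j x\<bar> \<partial>M))"
      using Ai Ri by (subst Bochner_Integration.integral_sum) (auto intro!: sum.cong)
    also have "\<dots> \<le> (\<Sum>j\<in>{1..b}. c * (Gam / real l) + d * \<rho>)"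
      using that by (intro sum_mono add_mono mult_left_mono Ab Rb) auto
    finally show ?thesis by simp
  qed
  have iH: "integrable M H"
    unfolding H_def[abs_def] using iS[of 4 2] iV by auto
  have iT: "integrable M T" unfolding T_def[abs_def] using iS[of 16 4] iH by auto
  have "measure M {x \<in> space M. \<bar>K * Ustat (X x) l b - v0\<bar> > \<epsilon>} \<le> (\<integral>x. T x \<partial>M)"
  proof -
    let ?E = "{x \<in> space M. \<bar>K * Ustat (X x) l b - v0\<bar> > \<epsilon>}"
    have Em [measurable]: "?E \<in> sets M" unfolding Ustat_def by measurable
    have "measure M ?E = (\<integral>x. indicator ?E x \<partial>M)" by simp
    also have "\<dots> \<le> (\<integral>x. T x \<partial>M)"
    proof (rule integral_mono[OF _ iT])
      show "integrable M (indicator ?E :: 'a \<Rightarrow> real)" by (rule integrable_const_bound[of _ 1]) (auto simp: indicator_def)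
      show "indicator ?E x \<le> T x" for x using T1[of x] T0[of x] by (auto simp: indicator_def)
    qed
    finally show ?thesis .
  qed
  also have "(\<integral>x. T x \<partial>M) = (\<integral>x. ?S 16 4 x \<partial>M)
     + (K * (2 / real b * (\<integral>x. ?S 4 2 x \<partial>M)) + 2 * (\<integral>x. \<bar>V x - v0\<bar> \<partial>M) + v0 / (real b - 1)) / \<epsilon>"
  proof -
    have "(\<integral>x. H x \<partial>M) = K * (2 / real b * (\<integral>x. ?S 4 2 x \<partial>M)) + 2 * (\<integral>x. \<bar>V x - v0\<bar> \<partial>M) + v0 / (real b - 1)"
    proof -
      have 1: "integrable M (\<lambda>x. K * (2 / real b * ?S 4 2 x))"
        by (intro integrable_mult_right iS)
      have 2: "integrable M (\<lambda>x. 2 * \<bar>V x - v0\<bar>)" using iV by auto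
      have "(\<integral>x. H x \<partial>M) = (\<integral>x. K * (2 / real b * ?S 4 2 x) + 2 * \<bar>V x - v0\<bar> \<partial>M) + v0 / (real b - 1)"
        unfolding H_def by (subst Bochner_Integration.integral_add[OF Bochner_Integration.integrable_add[OF 1 2]]) (auto simp: prob_space)
      also have "\<dots> = (\<integral>x. K * (2 / real b * ?S 4 2 x) \<partial>M) + (\<integral>x. 2 * \<bar>V x - v0\<bar> \<partial>M) + v0 / (real b - 1)"
        by (subst Bochner_Integration.integral_add[OF 1 2]) simp
      finally show ?thesis by (simp only: integral_mult_right_zero)
    qed
    then show ?thesis
      unfolding T_def by (subst Bochner_Integration.integral_add[OF iS integrable_divide[OF iH]]) (simp only: integral_divide_zero)
  qed
  also have "\<dots> \<le> real b * (16 * (Gam / real l) + 4 * \<rho>)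
     + (K * (2 / real b * (real b * (4 * (Gam / real l) + 2 * \<rho>))) + 2 * (\<integral>x. \<bar>V x - v0\<bar> \<partial>M) + v0 / (real b - 1)) / \<epsilon>"
    using K \<epsilon> b1 by (intro add_mono divide_right_mono mult_left_mono ES order_refl) auto
  also have "2 / real b * (real b * (4 * (Gam / real l) + 2 * \<rho>)) = 2 * (4 * (Gam / real l) + 2 * \<rho>)" using b1 by simp
  finally show ?thesis unfolding K_def v0_def V_def .
qed

end

text \<open>The argument of \<open>cov_sq\<close> is the position of the second variable, that of
  \<open>acov\<close> the lag; the two differ by one. Stationarity replaces the mean at that
  position by the mean at position 1.\<close>

lemma (in stationary_mixing) kappa_sq_eq_lrv: "kappa_sq M Y = lrv (\<lambda>y. y\<^sup>2)"
proof -
  have "(\<integral>x. (Y (Suc k) x)\<^sup>2 \<partial>M) = (\<integral>x. (Y 1 x)\<^sup>2 \<partial>M)" for k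
    by (rule stationary_single(1)) auto
  note second_moment = this
  have "cov_sq M Y (Suc k) = acov (\<lambda>y. y\<^sup>2) k" for k
    unfolding cov_sq_def acov_def centred_def second_moment[of k] ..
  from this[of 0] this[of "Suc k" for k] show ?thesis
    unfolding kappa_sq_def lrv_def by simp
qed

section \<open>Asymptotics of the block sizes and the convergence in probability\<close>

lemma bnum_bounds:
  assumes "1 \<le> blen s n"
  shows "real (bnum s n) \<le> real n / real (blen s n)" "real n / real (blen s n) - 1 \<le> real (bnum s n)"
proof -
  have "\<lfloor>real n / real (blen s n)\<rfloor> = int (bnum s n)" unfolding bnum_def by (rule floor_divide_of_nat_eq)
  then show "real (bnum s n) \<le> real n / real (blen s n)" "real n / real (blen s n) - 1 \<le> real (bnum s n)"
    by linarith+
qed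

lemma filterlim_blen: "0 < s \<Longrightarrow> filterlim (blen s) at_top sequentially"
  unfolding blen_def by real_asymp

lemma filterlim_bnum:
  assumes "0 < s" "s < 1"
  shows "filterlim (bnum s) at_top sequentially"
  unfolding filterlim_at_top
proof
  fix Z
  have "filterlim (\<lambda>n. real n / real (blen s n)) at_top sequentially"
    unfolding blen_def using assms by real_asymp
  then have "eventually (\<lambda>n. real Z + 1 \<le> real n / real (blen s n)) sequentially"
    unfolding filterlim_at_top by blast
  moreover have "eventually (\<lambda>n. 1 \<le> blen s n) sequentially"
    using filterlim_blen[OF assms(1)] unfolding filterlim_at_top by blast
  ultimately show "eventually (\<lambda>n. Z \<le> bnum s n) sequentially"
  proof eventually_elim
    case (elim n)
    then show ?case using bnum_bounds(2)[OF elim(2)] by linarith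
  qed
qed

text \<open>For l of order n^s the exponents of n are 1 - 2s, -s/2, s - 1, -s/2, s - 1 and 5s/2 - 2,
  all negative in this range. The first is the price of the union bound over the blocks and is where
  s > 1/2 enters.\<close>

lemma block_length_limits:
  fixes s :: real
  assumes "1 / 2 < s" "s < 3 / 4"
  defines "l \<equiv> \<lambda>n. real (blen s n)"
  shows "(\<lambda>n. real n / l n * (1 / l n)) \<longlonglongrightarrow> 0"
    and "(\<lambda>n. real n / l n * (sqrt (l n) / real n)) \<longlonglongrightarrow> 0"
    and "(\<lambda>n. real n / l n * (l n / real n)\<^sup>2) \<longlonglongrightarrow> 0"
    and "(\<lambda>n. sqrt (l n) * (1 / l n)) \<longlonglongrightarrow> 0"
    and "(\<lambda>n. sqrt (l n) * (sqrt (l n) / real n)) \<longlonglongrightarrow> 0"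
    and "(\<lambda>n. sqrt (l n) * (l n / real n)\<^sup>2) \<longlonglongrightarrow> 0"
  unfolding l_def blen_def using assms(1,2) by real_asymp+

theorem theorem2p4:
  fixes M :: "'a measure" and Y :: "nat \<Rightarrow> 'a \<Rightarrow> real"
    and mu sig :: "real \<Rightarrow> real" and sigH theta s :: real and m :: "nat \<Rightarrow> nat"
  assumes "prob_space M"
    and "\<And>i. Y i \<in> borel_measurable M"
    and "strictly_stationary M Y"
    and "integrable M (Y 1)" and "integral\<^sup>L M (Y 1) = 0"
    and "integrable M (\<lambda>\<omega>. (Y 1 \<omega>)\<^sup>2)" and "integral\<^sup>L M (\<lambda>\<omega>. (Y 1 \<omega>)\<^sup>2) = 1"
    and "betaY M Y \<longlonglongrightarrow> 0"
    and "\<exists>C. C-lipschitz_on {0..1} mu"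
    and "sigH > 0" and "\<forall>t\<in>{0..1}. sig t = sigH"
    and "summable (\<lambda>k. cov_sq M Y (k + 2))" and "kappa_sq M Y > 0"
    and "theta > 0" and "integrable M (\<lambda>\<omega>. \<bar>Y 1 \<omega>\<bar> powr (4 + 2 * theta))"
    and "summable (\<lambda>k. betaY M Y (Suc k) powr (theta / (2 + theta)))"
    and "0.5 < s" and "s < 0.75"
    and "\<forall>n. m n > 0" and "filterlim m at_top sequentially"
    and "(\<lambda>n. real (m n)) \<in> o(\<lambda>n. real n powr (2 * s - 1))"
    and "(\<lambda>n. real (bnum s n) * betaY M Y (m n)) \<longlonglongrightarrow> 0"
  shows "\<forall>\<epsilon>>0. (\<lambda>n. measure M {\<omega> \<in> space M.
            \<bar>sqrt (real (blen s n)) / sqrt (kappa_sq M Y)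
               * Ustat (\<lambda>i. sig (real i / real n) * Y i \<omega> + mu (real i / real n)) (blen s n) (bnum s n)
             - 2 / sqrt pi\<bar> > \<epsilon>}) \<longlonglongrightarrow> 0"
proof (intro allI impI)
  fix \<epsilon> :: real assume \<epsilon>: "0 < \<epsilon>"
  interpret prob_space M by fact
  interpret stationary_mixing M Y theta
    by unfold_locales (use assms in auto)
  obtain C where C: "C-lipschitz_on {0..1} mu" using assms(9) by blast
  have C0: "0 \<le> C" using lipschitz_on_nonneg[OF C] .
  \<comment> \<open>Under the null hypothesis X = sigH (Y + mu / sigH); this is a Lipschitz constant
    of the rescaled drift, and the common factor disappears in differences of logarithms.\<close>
  define L where "L = C / sigH"
  have sH: "0 < sigH" by fact
  have L0: "0 \<le> L" unfolding L_def using C0 sH by simp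
  have s: "1 / 2 < s" "s < 3 / 4" "0 < s" "s < 1" using \<open>0.5 < s\<close> \<open>s < 0.75\<close> by auto
  have \<kappa>: "0 < lrv (\<lambda>y. y\<^sup>2)" using \<open>kappa_sq M Y > 0\<close> by (simp add: kappa_sq_eq_lrv)
  define K where "K = sqrt (lrv (\<lambda>y. y\<^sup>2))"
  have K: "0 < K" unfolding K_def using \<kappa> by simp
  define dev where "dev l b = (\<integral>x. \<bar>gini b (\<lambda>j. block_stat (\<lambda>y. y\<^sup>2) l j x) - 2 / sqrt pi\<bar> \<partial>M)" for l b
  define rho where "rho n l = Gam / l + 2 * (L / real n * sqrt (l * Gam)) + (L / real n * l)\<^sup>2" for n and l :: real
  let ?l = "\<lambda>n. blen s n" and ?b = "\<lambda>n. bnum s n"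
  have l_inf: "filterlim ?l at_top sequentially" and b_inf: "filterlim ?b at_top sequentially"
    using filterlim_blen filterlim_bnum s by auto
  have ev_l: "eventually (\<lambda>n. 1 \<le> ?l n) sequentially" using l_inf unfolding filterlim_at_top by blast
  have ev_b: "eventually (\<lambda>n. 2 \<le> ?b n) sequentially" using b_inf unfolding filterlim_at_top by blast
  \<comment> \<open>The deviation bound with the factor b of the first summand replaced by its upper
    bound n / l, so that this summand is an explicit function of n and l.\<close>
  define T where "T n = real n / ?l n * (16 * (Gam / ?l n) + 4 * rho n (?l n))
      + (sqrt (?l n) / K * (2 * (4 * (Gam / ?l n) + 2 * rho n (?l n))) + 2 * dev (?l n) (?b n) + 2 / sqrt pi / (real (?b n) - 1)) / \<epsilon>" for n
  let ?P = "\<lambda>n. measure M {x \<in> space M.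
            \<bar>sqrt (real (blen s n)) / sqrt (kappa_sq M Y)
               * Ustat (\<lambda>i. sig (real i / real n) * Y i x + mu (real i / real n)) (blen s n) (bnum s n)
             - 2 / sqrt pi\<bar> > \<epsilon>}"
  have bound: "eventually (\<lambda>n. ?P n \<le> T n) sequentially"
    using ev_l ev_b eventually_gt_at_top[of 0]
  proof eventually_elim
    case (elim n)
    define v where "v i = mu (real i / real n) / sigH" for i
    \<comment> \<open>Both \<open>blen\<close> and \<open>bnum\<close> round down, so the blocks may
      stop short of n; all block indices divided by n stay in [0, 1], where the hypotheses on the
      drift and the scale apply.\<close>
    have bl: "?b n * ?l n \<le> n" unfolding bnum_def by (rule div_times_less_eq_dividend)
    have in01: "real i / real n \<in> {0..1}" if "i \<in> {1..?b n * ?l n}" for i using that bl elim by auto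
    have v: "\<bar>v i - v r\<bar> \<le> L / real n * \<bar>real i - real r\<bar>" if "i \<in> {1..?b n * ?l n}" "r \<in> {1..?b n * ?l n}" for i r
    proof -
      have "\<bar>mu (real i / real n) - mu (real r / real n)\<bar> \<le> C * \<bar>real i / real n - real r / real n\<bar>"
        using lipschitz_onD[OF C in01[OF that(1)] in01[OF that(2)]] by (simp add: dist_real_def)
      then have "\<bar>mu (real i / real n) - mu (real r / real n)\<bar> / sigH \<le> C * \<bar>real i / real n - real r / real n\<bar> / sigH"
        using sH by (intro divide_right_mono) auto
      then show ?thesis unfolding v_def L_def using sH
        by (simp add: mult.commute[of sigH] flip: diff_divide_distrib)
    qed
    have X: "sig (real i / real n) * Y i x + mu (real i / real n) = sigH * (Y i x + v i)" if "i \<in> {1..?b n * ?l n}" for i x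
      using assms(11) in01[OF that] sH by (simp add: v_def field_simps)
    have "?P n \<le> real (?b n) * (16 * (Gam / ?l n) + 4 * rho n (?l n))
      + (sqrt (?l n) / K * (2 * (4 * (Gam / ?l n) + 2 * rho n (?l n))) + 2 * dev (?l n) (?b n) + 2 / sqrt pi / (real (?b n) - 1)) / \<epsilon>"
      unfolding kappa_sq_eq_lrv dev_def K_def rho_def
      by (rule Ustat_deviation_bound[where s=sigH and v=v])
         (use assms(5,7) \<kappa> elim L0 sH \<epsilon> v X in auto)
    also have "\<dots> \<le> T n"
      unfolding T_def
    proof (intro add_right_mono mult_right_mono bnum_bounds(1) elim)
      show "0 \<le> 16 * (Gam / real (?l n)) + 4 * rho n (real (?l n))"
        unfolding rho_def using Gam_nonneg L0 by (intro add_nonneg_nonneg mult_nonneg_nonneg) auto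
    qed
    finally show ?case .
  qed
  have dev_lim: "(\<lambda>n. dev (?l n) (?b n)) \<longlonglongrightarrow> 0"
  proof (rule Lim_transform_eventually)
    \<comment> \<open>The limit of the Gini difference is stated for sequences positive at every n,
      whereas block length and number are known to be positive eventually; taking the maximum with 1
      bridges this.\<close>
    show "(\<lambda>n. dev (max 1 (?l n)) (max 1 (?b n))) \<longlonglongrightarrow> 0"
      unfolding dev_def
    proof (rule block_gini_limit[OF quad_bounded_square \<kappa>])
      show "filterlim (\<lambda>n. max 1 (?l n)) at_top sequentially" "filterlim (\<lambda>n. max 1 (?b n)) at_top sequentially"
        by (rule filterlim_at_top_mono[OF l_inf] filterlim_at_top_mono[OF b_inf]; simp)+
    qed auto
    show "eventually (\<lambda>n. dev (max 1 (?l n)) (max 1 (?b n)) = dev (?l n) (?b n)) sequentially"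
      using ev_l ev_b by eventually_elim (simp add: max_def)
  qed
  note lims = block_length_limits[OF s(1,2)]
  \<comment> \<open>Inserting \<open>rho\<close> and collecting terms by the six limits: 20 = 16 + 4
    and 12 = 8 + 4 combine the variance of the block sums of squares with that of the squared block
    mean, and 8 and 4 multiply the cross term and the squared drift.\<close>
  define a where "a = (\<lambda>n. 20 * Gam * (real n / ?l n * (1 / ?l n)) + 8 * L * sqrt Gam * (real n / ?l n * (sqrt (?l n) / real n))
      + 4 * L\<^sup>2 * (real n / ?l n * (?l n / real n)\<^sup>2))"
  define c where "c = (\<lambda>n. 12 * Gam / K * (sqrt (?l n) * (1 / ?l n)) + 8 * L * sqrt Gam / K * (sqrt (?l n) * (sqrt (?l n) / real n))
      + 4 * L\<^sup>2 / K * (sqrt (?l n) * (?l n / real n)\<^sup>2))"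
  have a: "a \<longlonglongrightarrow> 0"
    using tendsto_add[OF tendsto_add[OF tendsto_mult_right_zero[OF lims(1), of "20 * Gam"] tendsto_mult_right_zero[OF lims(2), of "8 * L * sqrt Gam"]]
        tendsto_mult_right_zero[OF lims(3), of "4 * L\<^sup>2"]] unfolding a_def by simp
  have c: "c \<longlonglongrightarrow> 0"
    using tendsto_add[OF tendsto_add[OF tendsto_mult_right_zero[OF lims(4), of "12 * Gam / K"] tendsto_mult_right_zero[OF lims(5), of "8 * L * sqrt Gam / K"]]
        tendsto_mult_right_zero[OF lims(6), of "4 * L\<^sup>2 / K"]] unfolding c_def by simp
  have b_lim: "(\<lambda>n. 2 / sqrt pi / (real (?b n) - 1)) \<longlonglongrightarrow> 0"
  proof -
    have "(\<lambda>m. 2 / sqrt pi / (real m - 1)) \<longlonglongrightarrow> 0" by real_asymp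
    then show ?thesis by (rule filterlim_compose[OF _ b_inf])
  qed
  have "(\<lambda>n. a n + (c n + 2 * dev (?l n) (?b n) + 2 / sqrt pi / (real (?b n) - 1)) / \<epsilon>) \<longlonglongrightarrow> 0 + (0 + 2 * 0 + 0) / \<epsilon>"
    using \<epsilon> by (intro tendsto_add tendsto_divide tendsto_mult tendsto_const a c dev_lim b_lim) auto
  moreover have "T = (\<lambda>n. a n + (c n + 2 * dev (?l n) (?b n) + 2 / sqrt pi / (real (?b n) - 1)) / \<epsilon>)"
  proof
    fix n
    have "real n / ?l n * (16 * (Gam / ?l n) + 4 * rho n (?l n)) = a n"
      unfolding a_def rho_def by (simp add: real_sqrt_mult power_mult_distrib power_divide algebra_simps)
    moreover have "sqrt (?l n) / K * (2 * (4 * (Gam / ?l n) + 2 * rho n (?l n))) = c n"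
      unfolding c_def rho_def by (simp add: real_sqrt_mult power_mult_distrib power_divide algebra_simps add_divide_distrib)
    ultimately show "T n = a n + (c n + 2 * dev (?l n) (?b n) + 2 / sqrt pi / (real (?b n) - 1)) / \<epsilon>"
      unfolding T_def by simp
  qed
  ultimately have T: "T \<longlonglongrightarrow> 0" by simp
  show "?P \<longlonglongrightarrow> 0"
    by (rule tendsto_sandwich[OF _ bound tendsto_const T]) (auto intro: always_eventually)
qed

end
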